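(* Let $K$ and $L$ be convex discs in $\mathbb{R}^2$ with $C^2_+$ smooth boundary such that $K$ is $L$-convex, and assume that $$\max_{x\in\mathrm{bd}\,L}\kappa_L(x)<1<\min_{y\in\mathrm{bd}\,K}\kappa_K(y).$$ Let $x_1,\dots,x_n$ be i.i.d. uniform random points from $K$ and let $K_{(n)}=[x_1,\dots,x_n]_L$ be the corresponding uniform random $L$-polygon. Then $$\lim_{n\to\infty}\mathbb{E}\big(f_0(K_{(n)})\big)\,n^{-\frac13}=\sqrt[3]{\frac{2}{3A(K)}}\;\Gamma\left(\frac53\right)\int_{S^1}\frac{\left(\kappa_K(u)-\kappa_L(u)\right)^{\frac13}}{\kappa_K(u)}\,\mathrm{d}u .$$
   Context: A convex disc is a compact convex set in $\mathbb{R}^2$ with non-empty interior. $C^2_+$ smooth boundary means that the boundary is twice continuously differentiable with strictly positive curvature everywhere. $\mathrm{bd}$ denotes boundary, $A(\cdot)$ area, $\mathbb{E}$ expectation, $\Gamma$ Euler's gamma function, $S^1$ the unit circle, and $\mathrm{d}u$ integration with respect to arc length on $S^1$. $K$ is $L$-convex if it equals the intersection of all translates of $L$ that contain $K$. For a set $X$ contained in a translate of $L$, $[X]_L$ denotes the intersection of all translates of $L$ that contain $X$. For a convex disc $M$ with $C^2_+$ boundary, $\kappa_M(x)$ is the curvature of $\mathrm{bd}\,M$ at $x\in\mathrm{bd}\,M$. For $u\in S^1$, $\kappa_M(u)$ denotes the curvature of $\mathrm{bd}\,M$ at the unique boundary point where the outer unit normal is $u$. A point $x_{i}\in\{x_1,\dots,x_n\}$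 is a vertex of $K_{(n)}$ if it is a non-smooth point of $\mathrm{bd}\,K_{(n)}$; $f_0(K_{(n)})$ is the number of vertices of $K_{(n)}$. *)

theory Defs
  imports "HOL-Probability.Probability"
begin

definition convex_disc :: "(real^2) set \<Rightarrow> bool" where
  "convex_disc M \<longleftrightarrow> compact M \<and> convex M \<and> interior M \<noteq> {}"

(* A regular, twice continuously differentiable, simple closed parametrization of bd M,
   extended to the whole line by 1-periodicity, so that C^2 also holds at the point
   where the curve closes up. *)
definition C2_boundary_param :: "(real^2) set \<Rightarrow> (real \<Rightarrow> real^2) \<Rightarrow> bool" where
  "C2_boundary_param M \<gamma> \<longleftrightarrow>
     \<gamma> C1_differentiable_on UNIV \<and>
     (\<lambda>t. vector_derivative \<gamma> (at t)) C1_differentiable_on UNIV \<and>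
     (\<forall>t. vector_derivative \<gamma> (at t) \<noteq> 0) \<and>
     (\<forall>t. \<gamma> (t + 1) = \<gamma> t) \<and>
     simple_path \<gamma> \<and> path_image \<gamma> = frontier M"

(* |det(g', g'')| / |g'|^3; the absolute value makes it independent of the orientation,
   and for the boundary of a convex disc it is the usual non-negative curvature. *)
definition curve_curvature :: "(real \<Rightarrow> real^2) \<Rightarrow> real \<Rightarrow> real" where
  "curve_curvature \<gamma> t =
     (let v = vector_derivative \<gamma> (at t);
          a = vector_derivative (\<lambda>s. vector_derivative \<gamma> (at s)) (at t)
      in \<bar>v $ 1 * a $ 2 - v $ 2 * a $ 1\<bar> / norm v ^ 3)"

(* Meaningful when bd M is C^2: the value then does not depend on the parametrization. *)
definition boundary_curvature :: "(real^2) set \<Rightarrow> real^2 \<Rightarrow> real" where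
  "boundary_curvature M x =
     (THE k. \<exists>\<gamma> t. C2_boundary_param M \<gamma> \<and> \<gamma> t = x \<and> k = curve_curvature \<gamma> t)"

definition C2_plus_boundary :: "(real^2) set \<Rightarrow> bool" where
  "C2_plus_boundary M \<longleftrightarrow>
     (\<exists>\<gamma>. C2_boundary_param M \<gamma>) \<and> (\<forall>x\<in>frontier M. 0 < boundary_curvature M x)"

definition outer_unit_normal :: "(real^2) set \<Rightarrow> real^2 \<Rightarrow> real^2 \<Rightarrow> bool" where
  "outer_unit_normal M x u \<longleftrightarrow>
     x \<in> frontier M \<and> norm u = 1 \<and> (\<forall>y\<in>M. u \<bullet> (y - x) \<le> 0)"

definition curvature_at_normal :: "(real^2) set \<Rightarrow> real^2 \<Rightarrow> real" where
  "curvature_at_normal M u = boundary_curvature M (THE x. outer_unit_normal M x u)"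

(* If no translate of L contains X, the intersection is the whole plane. *)
definition L_hull :: "(real^2) set \<Rightarrow> (real^2) set \<Rightarrow> (real^2) set" where
  "L_hull L X = \<Inter>{T. (\<exists>t. T = (+) t ` L) \<and> X \<subseteq> T}"

definition L_convex :: "(real^2) set \<Rightarrow> (real^2) set \<Rightarrow> bool" where
  "L_convex L K \<longleftrightarrow> L_hull L K = K"

(* For a closed convex set: a boundary point with exactly one supporting line. *)
definition smooth_boundary_point :: "(real^2) set \<Rightarrow> real^2 \<Rightarrow> bool" where
  "smooth_boundary_point M x \<longleftrightarrow> x \<in> frontier M \<and> (\<exists>!u. outer_unit_normal M x u)"

definition L_polygon_vertices :: "(real^2) set \<Rightarrow> (real^2) set \<Rightarrow> (real^2) set" where
  "L_polygon_vertices L X =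
     {x \<in> X. x \<in> frontier (L_hull L X) \<and> \<not> smooth_boundary_point (L_hull L X) x}"

definition f0 :: "(real^2) set \<Rightarrow> (real^2) set \<Rightarrow> nat" where
  "f0 L X = card (L_polygon_vertices L X)"

(* Integration with respect to arc length on the unit circle. *)
definition circle_integral :: "(real^2 \<Rightarrow> real) \<Rightarrow> real" where
  "circle_integral g = (LBINT t:{0..2*pi}. g (vector [cos t, sin t]))"

end

theory Submission
  imports Defs
begin

text \<open>Parametrize the boundaries of \<open>L\<close> and \<open>K\<close> by the angle \<open>a\<close> of the outer normal: \<open>l a\<close> and \<open>k a\<close> then
  have derivatives \<open>r a\<close> and \<open>q a\<close> times the unit tangent, where \<open>r > 1 > q\<close> are the radii of
  curvature. Almost surely, the vertices of the hull of a sample correspond one to one to the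
  ordered pairs \<open>(x, y)\<close> of sample points such that some translate of \<open>L\<close> contains the sample and
  its boundary passes through \<open>x\<close> and then, less than half a turn counterclockwise, through \<open>y\<close>. So
  the expected number of vertices is \<open>n (n - 1)\<close> times the integral over \<open>(x, y)\<close> of the power \<open>n -
  2\<close> of the normalized area of the part of \<open>K\<close> inside the translate. Substitute \<open>y = x + l b - l a\<close>,
  with Jacobian \<open>r a * r b * sin (b - a)\<close>, and rescale \<open>b - a\<close> and the tangential offset of \<open>x\<close> from
  \<open>k a\<close> by \<open>n powr (-1/3)\<close>, the depth of \<open>x\<close> by \<open>n powr (-2/3)\<close>. In the limit both curves become
  parabolas, the part of \<open>K\<close> cut off by the translate becomes a parabolic segment, and the integral
  reduces to a Gamma integral. At each boundary point, the internally tangent unit disc contains \<open>K\<close>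
  in the case of \<open>K\<close> and is contained in \<open>L\<close> in the case of \<open>L\<close>; this gives the domination that the
  passage to the limit needs.\<close>

section \<open>Ovals parametrized by the normal angle\<close>

text \<open>The normal angle is a good parameter because the tangent at angle \<open>s\<close> is
  then the same vector for every oval: curves can be subtracted, and comparing radii of curvature is
  a sign check of one derivative. The price is that \<open>boundary_curvature\<close> must first be
  recognized as a property of the set, and that a normal angle must be extracted from an arbitrary
  C2 parametrization. The pairs describe the vertices only almost surely, because a third sample
  point on the boundary of the same translate can spoil the count; this has probability zero, since
  two points already determine the translate. The exponents are forced: depth is quadratic in the
  tangential offset, so a cut-off region has area of order \<open>e ^ 3\<close>, and it should hold
  about one of \<open>n\<close> points, so \<open>e ^ 3\<close> is about \<open>1 / n\<close>. The
  measure of the pairs contributes \<open>e ^ 3\<close> for the first point, \<open>e\<close> for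
  the arc and \<open>e\<close> for the sine, and \<open>n\<^sup>2 * e ^ 5\<close> is of order
  \<open>n powr (1/3)\<close>. The limiting area depends on offset and depth only through
  \<open>sag\<close>, which is why the inner threefold integral collapses.\<close>

definition U :: "real \<Rightarrow> real^2" where "U t = vector [cos t, sin t]"
definition W :: "real \<Rightarrow> real^2" where "W t = vector [- sin t, cos t]"

section \<open>The rotating frame, periodicity and polar angles\<close>

lemma inner_real2: "(x::real^2) \<bullet> y = x$1 * y$1 + x$2 * y$2"
  by (simp add: inner_vec_def sum_2)

lemma U_nth [simp]: "U t $ 1 = cos t" "U t $ 2 = sin t"
  and W_nth [simp]: "W t $ 1 = - sin t" "W t $ 2 = cos t"
  by (simp_all add: U_def W_def)

lemma U_inner_U: "U s \<bullet> U t = cos (s - t)" and U_inner_W: "U s \<bullet> W t = sin (s - t)"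
  and W_inner_U: "W s \<bullet> U t = sin (t - s)" and W_inner_W: "W s \<bullet> W t = cos (s - t)"
  by (simp_all add: inner_real2 cos_diff sin_diff algebra_simps)

lemma norm_U [simp]: "norm (U t) = 1" and norm_W [simp]: "norm (W t) = 1"
  by (simp_all add: norm_eq_sqrt_inner U_inner_U W_inner_W)

lemma U_decomp: "v = (W t \<bullet> v) *\<^sub>R W t + (U t \<bullet> v) *\<^sub>R U t"
proof -
  have s: "sin t * sin t = 1 - cos t * cos t"
    using sin_cos_squared_add[of t] by (simp add: power2_eq_square)
  have "(- sin t * v$1 + cos t * v$2) * (- sin t) + (cos t * v$1 + sin t * v$2) * cos t
      = (sin t * sin t + cos t * cos t) * v$1"
    by algebra
  moreover have "(- sin t * v$1 + cos t * v$2) * cos t + (cos t * v$1 + sin t * v$2) * sin t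
      = (sin t * sin t + cos t * cos t) * v$2"
    by algebra
  ultimately show ?thesis using s by (simp add: vec_eq_iff forall_2 inner_real2)
qed

lemma norm_UW: "(norm (x *\<^sub>R W t + y *\<^sub>R U t))\<^sup>2 = x\<^sup>2 + y\<^sup>2"
  unfolding power2_norm_eq_inner
  by (simp add: inner_add_left inner_add_right U_inner_U U_inner_W W_inner_U W_inner_W power2_eq_square)

lemma has_vector_derivative_real2:
  assumes "((\<lambda>t. f t $ 1) has_real_derivative f' $ 1) (at x)" "((\<lambda>t. f t $ 2) has_real_derivative f' $ 2) (at x)"
  shows "(f has_vector_derivative (f'::real^2)) (at x)"
proof -
  have "((\<lambda>t. f t \<bullet> i) has_vector_derivative f' \<bullet> i) (at x)" if i: "i \<in> Basis" for i :: "real^2"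
  proof -
    from i obtain k where "i = axis k 1" by (auto simp: Basis_vec_def)
    moreover have "k = 1 \<or> k = 2" using exhaust_2 by blast
    ultimately show ?thesis using assms by (auto simp: inner_axis has_real_derivative_iff_has_vector_derivative)
  qed
  then show ?thesis
    unfolding has_vector_derivative_def has_derivative_componentwise_within[of f] by simp
qed

lemma U_deriv: "(U has_vector_derivative W t) (at t)"
  and W_deriv: "(W has_vector_derivative - U t) (at t)"
  by (rule has_vector_derivative_real2; auto intro!: derivative_eq_intros)+

lemma continuous_U: "continuous_on S U" and continuous_W: "continuous_on S W"
  by (auto intro!: continuous_at_imp_continuous_on has_vector_derivative_continuous U_deriv W_deriv)

lemma shift_into:
  obtains k :: int where "\<theta> + 2 * pi * of_int k \<in> {c..<c + 2 * pi}"
proof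
  define j where "j = \<lfloor>(\<theta> - c) / (2 * pi)\<rfloor>"
  have "of_int j \<le> (\<theta> - c) / (2*pi)" "(\<theta> - c) / (2*pi) < of_int j + 1"
    unfolding j_def by linarith+
  then have "of_int j * (2*pi) \<le> \<theta> - c" "\<theta> - c < (of_int j + 1) * (2*pi)"
    by (simp_all add: pos_le_divide_eq pos_divide_less_eq)
  then show "\<theta> + 2 * pi * of_int (- j) \<in> {c..<c + 2 * pi}"
    by (simp add: algebra_simps)
qed

lemma periodic_int:
  assumes "\<And>t. f (t + 2 * pi) = f t"
  shows "f (t + 2 * pi * of_int k) = f t"
proof -
  have n: "f (t + 2 * pi * real n) = f t" for t n
  proof (induction n)
    case (Suc n)
    then show ?case using assms[of "t + 2 * pi * real n"] by (simp add: algebra_simps)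
  qed simp
  show ?thesis
  proof (cases "k \<ge> 0")
    case True
    then show ?thesis using n[of t "nat k"] by simp
  next
    case False
    then show ?thesis using n[of "t + 2 * pi * of_int k" "nat (- k)"] by simp
  qed
qed

lemma U_periodic: "U (t + 2 * pi) = U t" and W_periodic: "W (t + 2 * pi) = W t"
  by (simp_all add: vec_eq_iff forall_2)

lemma U_int [simp]: "U (t + 2 * pi * of_int k) = U t"
  by (rule periodic_int) (rule U_periodic)

lemma U_eq_iff: "U s = U t \<longleftrightarrow> (\<exists>k::int. s = t + 2 * pi * of_int k)"
proof
  assume "U s = U t"
  then have "sin s = sin t \<and> cos s = cos t" by (metis U_nth)
  then show "\<exists>k::int. s = t + 2 * pi * of_int k" unfolding sin_cos_eq_iff .
qed auto

text \<open>The start \<open>c\<close> of the window is free, since later arguments need the angle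
  either within half a turn of a given one or in the full turn after it.\<close>

lemma polar_real2:
  obtains t where "t \<in> {c..<c + 2*pi}" "v = norm v *\<^sub>R U t"
proof (cases "v = 0")
  case True
  then show ?thesis using that[of c] by simp
next
  case False
  have "(v$1 / norm v)\<^sup>2 + (v$2 / norm v)\<^sup>2 = (v \<bullet> v) / (norm v)\<^sup>2"
    by (simp add: inner_real2 power2_eq_square add_divide_distrib)
  also have "\<dots> = 1" using False by (simp add: power2_norm_eq_inner)
  finally obtain s where s: "v$1 / norm v = cos s" "v$2 / norm v = sin s"
    by (rule sincos_total_2pi) blast
  have "v = norm v *\<^sub>R U s" using False by (simp add: vec_eq_iff forall_2 s[symmetric])
  then have "v = norm v *\<^sub>R U (s + 2 * pi * of_int k)" for k unfolding U_int .
  moreover obtain k where "s + 2 * pi * of_int k \<in> {c..<c + 2 * pi}" using shift_into by blast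
  ultimately show ?thesis using that by blast
qed

text \<open>The difference of two curves with tangent \<^term>\<open>W\<close> is again such a curve, so \<^term>\<open>r\<close> is not
  assumed positive here.\<close>

lemma turning_le:
  assumes der: "\<And>s. (m has_vector_derivative r s *\<^sub>R W s) (at s)"
    and bd: "\<And>s. s \<in> closed_segment \<theta> \<phi> \<Longrightarrow> c \<le> r s" and le: "\<bar>\<phi> - \<theta>\<bar> \<le> pi"
  shows "U \<theta> \<bullet> (m \<phi> - m \<theta>) \<le> - c * (1 - cos (\<phi> - \<theta>))"
proof -
  \<comment> \<open>For a circle of radius \<open>c\<close> this function vanishes identically. In
    general its derivative \<open>(r s - c) * sin (\<theta> - s)\<close> is nonnegative before
    \<theta> and nonpositive after it, within half a turn, so the maximum is at \<theta>.\<close>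
  define h where "h s = U \<theta> \<bullet> (m s - m \<theta>) + c * (1 - cos (s - \<theta>))" for s
  have h': "(h has_real_derivative (r s - c) * sin (\<theta> - s)) (at s)" for s
  proof -
    have "((\<lambda>s. U \<theta> \<bullet> (m s - m \<theta>)) has_vector_derivative U \<theta> \<bullet> (r s *\<^sub>R W s - 0)) (at s)"
      by (intro bounded_linear.has_vector_derivative[OF bounded_linear_inner_right]
          has_vector_derivative_diff der has_vector_derivative_const)
    then have "((\<lambda>s. U \<theta> \<bullet> (m s - m \<theta>)) has_real_derivative r s * sin (\<theta> - s)) (at s)"
      by (simp add: has_real_derivative_iff_has_vector_derivative U_inner_W)
    moreover have "((\<lambda>s. c * (1 - cos (s - \<theta>))) has_real_derivative c * sin (s - \<theta>)) (at s)"
      by (auto intro!: derivative_eq_intros)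
    ultimately have "(h has_real_derivative r s * sin (\<theta> - s) + c * sin (s - \<theta>)) (at s)"
      unfolding h_def by (rule DERIV_add)
    moreover have "sin (s - \<theta>) = - sin (\<theta> - s)" using sin_minus[of "\<theta> - s"] by simp
    ultimately show ?thesis by (simp add: algebra_simps)
  qed
  have "h \<phi> \<le> h \<theta>"
  proof (cases "\<theta> \<le> \<phi>")
    case True
    show ?thesis
    proof (rule DERIV_nonpos_imp_nonincreasing[where f = h, OF True])
      fix x assume x: "\<theta> \<le> x" "x \<le> \<phi>"
      have "sin (x - \<theta>) \<ge> 0" using x le by (intro sin_ge_zero) auto
      then have "sin (\<theta> - x) \<le> 0" using sin_minus[of "\<theta> - x"] by simp
      moreover have "c \<le> r x" using x by (intro bd) (auto simp: closed_segment_eq_real_ivl)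
      ultimately show "\<exists>y. (h has_real_derivative y) (at x) \<and> y \<le> 0"
        using h' by (metis mult_nonneg_nonpos diff_ge_0_iff_ge)
    qed
  next
    case False
    show ?thesis
    proof (rule DERIV_nonneg_imp_nondecreasing[where f = h])
      show "\<phi> \<le> \<theta>" using False by simp
      fix x assume x: "\<phi> \<le> x" "x \<le> \<theta>"
      have "sin (\<theta> - x) \<ge> 0" using x le by (intro sin_ge_zero) auto
      moreover have "c \<le> r x" using x by (intro bd) (auto simp: closed_segment_eq_real_ivl)
      ultimately show "\<exists>y. (h has_real_derivative y) (at x) \<and> 0 \<le> y"
        using h' by (metis mult_nonneg_nonneg diff_ge_0_iff_ge)
    qed
  qed
  then show ?thesis by (simp add: h_def)
qed

text \<open>Negating the curve and its radius exchanges upper and lower bounds; the negated radius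
  is another reason to allow any sign in \<open>turning_le\<close>.\<close>

lemma turning_ge:
  assumes der: "\<And>s. (m has_vector_derivative r s *\<^sub>R W s) (at s)"
    and bd: "\<And>s. s \<in> closed_segment \<theta> \<phi> \<Longrightarrow> r s \<le> c" and le: "\<bar>\<phi> - \<theta>\<bar> \<le> pi"
  shows "- c * (1 - cos (\<phi> - \<theta>)) \<le> U \<theta> \<bullet> (m \<phi> - m \<theta>)"
proof -
  have "((\<lambda>s. - m s) has_vector_derivative (- r s) *\<^sub>R W s) (at s)" for s
    using has_vector_derivative_minus[OF der[of s]] by simp
  from turning_le[OF this, of \<theta> \<phi> "- c"] bd le show ?thesis
    by (simp add: inner_diff_right)
qed

text \<open>\<open>M\<close> is the intersection of its supporting half-planes, \<open>m \<theta>\<close> is the boundary point with outer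
  normal \<^term>\<open>U \<theta>\<close>, and \<open>r \<theta>\<close> is the radius of curvature there.\<close>

locale oval =
  fixes M :: "(real^2) set" and m :: "real \<Rightarrow> real^2" and r :: "real \<Rightarrow> real"
  assumes der: "(m has_vector_derivative r s *\<^sub>R W s) (at s)"
    and cont_r: "continuous_on UNIV r"
    and r_pos: "0 < r s"
    and m_periodic: "m (s + 2 * pi) = m s"
    and r_periodic: "r (s + 2 * pi) = r s"
    and mem_iff: "y \<in> M \<longleftrightarrow> (\<forall>\<theta>. U \<theta> \<bullet> (y - m \<theta>) \<le> 0)"
begin

lemma cont_m: "continuous_on S m"
  by (auto intro!: continuous_at_imp_continuous_on has_vector_derivative_continuous der)

lemma m_int [simp]: "m (t + 2 * pi * of_int k) = m t"
  by (rule periodic_int) (rule m_periodic)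

lemma r_int [simp]: "r (t + 2 * pi * of_int k) = r t"
  by (rule periodic_int) (rule r_periodic)

lemma r_bounds: obtains c C where "0 < c" "\<And>s. c \<le> r s" "\<And>s. r s \<le> C"
proof -
  have c: "continuous_on {0..2*pi} r" using cont_r continuous_on_subset by blast
  have ne: "{0..2*pi} \<noteq> {}" by simp
  obtain s1 where s1: "\<forall>y\<in>{0..2*pi}. r s1 \<le> r y"
    using continuous_attains_inf[OF compact_Icc ne c] by blast
  obtain s2 where s2: "\<forall>y\<in>{0..2*pi}. r y \<le> r s2"
    using continuous_attains_sup[OF compact_Icc ne c] by blast
  have "r s1 \<le> r s \<and> r s \<le> r s2" for s
  proof -
    obtain k where "s + 2 * pi * of_int k \<in> {0..<0 + 2 * pi}" using shift_into by blast
    then have "r s1 \<le> r (s + 2 * pi * of_int k)" "r (s + 2 * pi * of_int k) \<le> r s2"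
      using s1 s2 by (metis add_0 atLeastAtMost_iff atLeastLessThan_iff less_eq_real_def)+
    then show ?thesis unfolding r_int by blast
  qed
  then show ?thesis using that[of "r s1" "r s2"] r_pos by blast
qed

lemma r_lower: obtains c where "0 < c" "\<And>s. c \<le> r s"
proof (rule r_bounds)
  fix c C assume "0 < c" "\<And>s. c \<le> r s" then show thesis by (rule that)
qed

lemma r_upper: obtains C where "0 < C" "\<And>s. r s \<le> C"
proof (rule r_bounds)
  fix c C assume C: "\<And>s. r s \<le> C"
  have "0 < C" using C[of 0] r_pos[of 0] by linarith
  then show thesis using C by (rule that)
qed

section \<open>Supporting lines and tangent discs\<close>

text \<open>By periodicity the half-planes of one full turn suffice. The turn is centred at
  \<open>c\<close> so that all its angles are within half a turn of \<open>c\<close>, where the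
  turning inequalities apply.\<close>

lemma mem_local: "y \<in> M \<longleftrightarrow> (\<forall>\<theta>. \<bar>\<theta> - c\<bar> \<le> pi \<longrightarrow> U \<theta> \<bullet> (y - m \<theta>) \<le> 0)"
proof
  assume *: "\<forall>\<theta>. \<bar>\<theta> - c\<bar> \<le> pi \<longrightarrow> U \<theta> \<bullet> (y - m \<theta>) \<le> 0"
  have "U \<theta> \<bullet> (y - m \<theta>) \<le> 0" for \<theta>
  proof -
    obtain k where k: "\<theta> + 2 * pi * of_int k \<in> {c - pi..<c - pi + 2 * pi}" using shift_into by blast
    then have "\<bar>\<theta> + 2 * pi * of_int k - c\<bar> \<le> pi" by auto
    from *[rule_format, OF this] show ?thesis by simp
  qed
  then show "y \<in> M" by (simp add: mem_iff)
qed (simp add: mem_iff)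

lemma strict_local: assumes "0 < \<bar>\<phi> - \<theta>\<bar>" "\<bar>\<phi> - \<theta>\<bar> \<le> pi" shows "U \<theta> \<bullet> (m \<phi> - m \<theta>) < 0"
proof -
  obtain c where c: "0 < c" "\<And>s. c \<le> r s" by (rule r_lower) blast
  have "cos \<bar>\<phi> - \<theta>\<bar> < cos 0" using assms by (intro cos_monotone_0_pi) auto
  then have "0 < c * (1 - cos (\<phi> - \<theta>))" using c by simp
  moreover have "U \<theta> \<bullet> (m \<phi> - m \<theta>) \<le> - c * (1 - cos (\<phi> - \<theta>))"
    by (rule turning_le[OF der]) (use c assms in auto)
  ultimately show ?thesis by simp
qed

lemma m_in [simp]: "m \<phi> \<in> M"
  unfolding mem_local[of _ \<phi>]
proof (intro allI impI)
  fix \<theta> assume "\<bar>\<theta> - \<phi>\<bar> \<le> pi"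
  then show "U \<theta> \<bullet> (m \<phi> - m \<theta>) \<le> 0"
    using strict_local[of \<phi> \<theta>] by (cases "\<phi> = \<theta>") (auto simp: abs_minus_commute)
qed

lemma strict: assumes "0 < \<bar>\<phi> - \<theta>\<bar>" "\<bar>\<phi> - \<theta>\<bar> < 2 * pi" shows "U \<theta> \<bullet> (m \<phi> - m \<theta>) < 0"
proof -
  consider "\<bar>\<phi> - \<theta>\<bar> \<le> pi" | "\<phi> - \<theta> > pi" | "\<phi> - \<theta> < -pi" by linarith
  then show ?thesis
  proof cases
    case 1 then show ?thesis using strict_local assms by blast
  next
    case 2
    then show ?thesis using strict_local[of "\<phi> + 2 * pi * of_int (-1)" \<theta>] assms
      unfolding m_int by auto
  next
    case 3
    then show ?thesis using strict_local[of "\<phi> + 2 * pi * of_int 1" \<theta>] assms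
      unfolding m_int by auto
  qed
qed

text \<open>One half of Blaschke's rolling theorem. The distance from the centre is measured in its
  own direction \<phi>; there the supporting half-plane of \<open>M\<close> at \<phi> and the
  turning inequality from \<phi> back to \<theta> combine to exactly \<open>C\<close>.\<close>

lemma outer_ball:
  assumes C: "\<And>s. r s \<le> C" and y: "y \<in> M"
  shows "norm (y - (m \<theta> - C *\<^sub>R U \<theta>)) \<le> C"
proof -
  define w where "w = y - (m \<theta> - C *\<^sub>R U \<theta>)"
  obtain \<phi> where p: "\<phi> \<in> {\<theta> - pi..<\<theta> - pi + 2 * pi}" "w = norm w *\<^sub>R U \<phi>" using polar_real2 by metis
  have "norm w = U \<phi> \<bullet> w" by (subst p(2)) (simp add: U_inner_U)
  also have "\<dots> = U \<phi> \<bullet> (y - m \<phi>) - U \<phi> \<bullet> (m \<theta> - m \<phi>) + C * cos (\<phi> - \<theta>)"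
    by (simp add: w_def inner_diff_right inner_add_right U_inner_U)
  also have "\<dots> \<le> 0 + C * (1 - cos (\<theta> - \<phi>)) + C * cos (\<phi> - \<theta>)"
  proof -
    have "- C * (1 - cos (\<theta> - \<phi>)) \<le> U \<phi> \<bullet> (m \<theta> - m \<phi>)"
      by (rule turning_ge[OF der]) (use C p in auto)
    moreover have "U \<phi> \<bullet> (y - m \<phi>) \<le> 0" using y mem_iff by blast
    ultimately show ?thesis by simp
  qed
  also have "\<dots> = C" using cos_minus[of "\<theta> - \<phi>"] by (simp add: algebra_simps)
  finally show ?thesis by (simp add: w_def)
qed

text \<open>The other half of the rolling theorem, for one half-plane at a time. It asks for the
  bound on the radius only along the arc between the two normals, so that near a point a disc almost
  as large as the osculating one can be used.\<close>

lemma inner_ball_local: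
  assumes "\<And>s. s \<in> closed_segment \<theta> \<phi> \<Longrightarrow> c \<le> r s" and "\<bar>\<phi> - \<theta>\<bar> \<le> pi"
    and y: "norm (y - (m \<theta> - c *\<^sub>R U \<theta>)) \<le> c"
  shows "U \<phi> \<bullet> (y - m \<phi>) \<le> 0"
proof -
  have "U \<phi> \<bullet> (y - m \<phi>) = U \<phi> \<bullet> (y - (m \<theta> - c *\<^sub>R U \<theta>)) - c * cos (\<phi> - \<theta>) + U \<phi> \<bullet> (m \<theta> - m \<phi>)"
    by (simp add: inner_diff_right inner_add_right U_inner_U)
  also have "\<dots> \<le> c - c * cos (\<phi> - \<theta>) - c * (1 - cos (\<theta> - \<phi>))"
  proof -
    have "U \<phi> \<bullet> (m \<theta> - m \<phi>) \<le> - c * (1 - cos (\<theta> - \<phi>))"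
      by (rule turning_le[OF der]) (use assms in \<open>auto simp: closed_segment_commute\<close>)
    moreover have "U \<phi> \<bullet> (y - (m \<theta> - c *\<^sub>R U \<theta>)) \<le> c"
      using y norm_cauchy_schwarz[of "U \<phi>" "y - (m \<theta> - c *\<^sub>R U \<theta>)"] by simp
    ultimately show ?thesis by simp
  qed
  also have "\<dots> = 0" using cos_minus[of "\<theta> - \<phi>"] by (simp add: algebra_simps)
  finally show ?thesis .
qed

lemma inner_ball:
  assumes "\<And>s. c \<le> r s" and "norm (y - (m \<theta> - c *\<^sub>R U \<theta>)) \<le> c"
  shows "y \<in> M"
  unfolding mem_local[of _ \<theta>] using inner_ball_local assms by blast

text \<open>\<open>M\<close> lies in a disc that touches the supporting line at
  \<open>m \<theta>\<close>, and a disc meets its tangent in one point.\<close>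

lemma eq_m: assumes "y \<in> M" "U \<theta> \<bullet> (y - m \<theta>) = 0" shows "y = m \<theta>"
proof -
  obtain C where C: "\<And>s. r s \<le> C" by (rule r_upper) blast
  have "norm (y - (m \<theta> - C *\<^sub>R U \<theta>)) \<le> C" using outer_ball C assms by blast
  moreover define l where "l = W \<theta> \<bullet> (y - m \<theta>)"
  have "y - m \<theta> = l *\<^sub>R W \<theta>" using U_decomp[of "y - m \<theta>" \<theta>] assms(2) by (simp add: l_def)
  then have e: "y - (m \<theta> - C *\<^sub>R U \<theta>) = l *\<^sub>R W \<theta> + C *\<^sub>R U \<theta>" by (simp add: algebra_simps)
  ultimately have "(norm (l *\<^sub>R W \<theta> + C *\<^sub>R U \<theta>))\<^sup>2 \<le> C\<^sup>2" by (simp add: power_mono)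
  then have "l = 0" by (simp add: norm_UW)
  then show ?thesis using \<open>y - m \<theta> = l *\<^sub>R W \<theta>\<close> by simp
qed

lemma m_eq_iff: "m \<phi> = m \<theta> \<longleftrightarrow> (\<exists>k::int. \<phi> = \<theta> + 2 * pi * of_int k)"
proof
  assume e: "m \<phi> = m \<theta>"
  obtain k where k: "\<phi> + 2 * pi * of_int k \<in> {\<theta>..<\<theta> + 2 * pi}" using shift_into by blast
  have "\<phi> + 2 * pi * of_int k = \<theta>"
  proof (rule ccontr)
    assume "\<phi> + 2 * pi * of_int k \<noteq> \<theta>"
    then have "U \<theta> \<bullet> (m (\<phi> + 2 * pi * of_int k) - m \<theta>) < 0" using k by (intro strict) auto
    then show False using e by simp
  qed
  then have "\<phi> = \<theta> + 2 * pi * of_int (- k)" by simp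
  then show "\<exists>k::int. \<phi> = \<theta> + 2 * pi * of_int k" by blast
qed auto

section \<open>Topology of an oval\<close>

lemma closed_M: "closed M"
proof -
  have "M = (\<Inter>\<theta>. {y. U \<theta> \<bullet> (y - m \<theta>) \<le> 0})" by (auto simp: mem_iff)
  also have "closed \<dots>"
    by (intro closed_INT ballI closed_Collect_le continuous_intros)
  finally show ?thesis .
qed

lemma convex_M: "convex M"
proof -
  have "M = (\<Inter>\<theta>. {y. U \<theta> \<bullet> y \<le> U \<theta> \<bullet> m \<theta>})" by (auto simp: mem_iff inner_diff_right)
  also have "convex \<dots>" by (intro convex_INT convex_halfspace_le)
  finally show ?thesis .
qed

lemma compact_M: "compact M"
proof -
  obtain C where C: "\<And>s. r s \<le> C" by (rule r_upper) blast
  have "M \<subseteq> cball (m 0 - C *\<^sub>R U 0) C"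
    using outer_ball[OF C, of _ 0] by (auto simp: dist_norm norm_minus_commute)
  then show ?thesis using closed_M bounded_cball bounded_subset compact_eq_bounded_closed by blast
qed

lemma interior_iff: "y \<in> interior M \<longleftrightarrow> (\<forall>\<theta>. U \<theta> \<bullet> (y - m \<theta>) < 0)"
proof
  assume y: "y \<in> interior M"
  show "\<forall>\<theta>. U \<theta> \<bullet> (y - m \<theta>) < 0"
  proof
    fix \<theta>
    obtain e where e: "e > 0" "cball y e \<subseteq> M" using y mem_interior_cball by blast
    have "y + e *\<^sub>R U \<theta> \<in> M" using e by (auto simp: subset_iff dist_norm)
    then have "U \<theta> \<bullet> (y + e *\<^sub>R U \<theta> - m \<theta>) \<le> 0" using mem_iff by blast
    then show "U \<theta> \<bullet> (y - m \<theta>) < 0" using e(1) by (simp add: inner_diff_right inner_add_right U_inner_U)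
  qed
next
  assume *: "\<forall>\<theta>. U \<theta> \<bullet> (y - m \<theta>) < 0"
  have "continuous_on {-pi..pi} (\<lambda>\<theta>. U \<theta> \<bullet> (y - m \<theta>))"
    by (intro continuous_intros continuous_U cont_m)
  from continuous_attains_sup[OF compact_Icc _ this] obtain \<theta>0 where
    t0: "\<forall>\<theta>\<in>{-pi..pi}. U \<theta> \<bullet> (y - m \<theta>) \<le> U \<theta>0 \<bullet> (y - m \<theta>0)"
    by force
  \<comment> \<open>The least slack over one period, attained by compactness; the disc of this
    radius about \<open>y\<close> violates none of the half-planes.\<close>
  define d where "d = - (U \<theta>0 \<bullet> (y - m \<theta>0))"
  have d: "d > 0" using * by (simp add: d_def)
  have "cball y d \<subseteq> M"
  proof
    fix z assume z: "z \<in> cball y d"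
    show "z \<in> M" unfolding mem_local[of _ 0]
    proof (intro allI impI)
      fix \<theta> assume "\<bar>\<theta> - 0\<bar> \<le> pi"
      then have "\<theta> \<in> {-pi..pi}" by auto
      from t0[rule_format, OF this] have "U \<theta> \<bullet> (y - m \<theta>) \<le> - d" by (simp add: d_def)
      moreover have "U \<theta> \<bullet> (z - y) \<le> d"
        using norm_cauchy_schwarz[of "U \<theta>" "z - y"] z by (simp add: dist_norm norm_minus_commute)
      ultimately show "U \<theta> \<bullet> (z - m \<theta>) \<le> 0" by (simp add: inner_diff_right)
    qed
  qed
  then show "y \<in> interior M" using d mem_interior_cball by blast
qed

lemma frontier_eq: "frontier M = range m"
proof -
  have "frontier M = M - interior M" using closed_M by (simp add: frontier_def)
  also have "\<dots> = range m"
  proof (intro equalityI subsetI)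
    fix y assume "y \<in> M - interior M"
    then obtain \<theta> where "y \<in> M" "\<not> U \<theta> \<bullet> (y - m \<theta>) < 0" using interior_iff by blast
    moreover from this have "U \<theta> \<bullet> (y - m \<theta>) \<le> 0" using mem_iff by blast
    ultimately show "y \<in> range m" using eq_m[of y \<theta>] by auto
  next
    fix y assume "y \<in> range m"
    then obtain \<theta> where "y = m \<theta>" by blast
    moreover from this have "U \<theta> \<bullet> (y - m \<theta>) = 0" by simp
    ultimately show "y \<in> M - interior M" using interior_iff[of y] by (metis DiffI less_irrefl m_in)
  qed
  finally show ?thesis .
qed

lemma interior_if: "y \<in> M \<Longrightarrow> y \<notin> range m \<Longrightarrow> y \<in> interior M"
  using frontier_eq closed_M by (auto simp: frontier_def)

end

section \<open>The normal angle of a boundary curve of class C2\<close>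

lemma outer_unit_normal_interior:
  assumes "outer_unit_normal M x u" "c \<in> interior M" shows "u \<bullet> (c - x) < 0"
proof -
  obtain e where e: "e > 0" "cball c e \<subseteq> M" using assms(2) mem_interior_cball by blast
  have "c + e *\<^sub>R u \<in> M"
    using e assms(1) by (auto simp: subset_iff dist_norm outer_unit_normal_def)
  then have "u \<bullet> (c + e *\<^sub>R u - x) \<le> 0" "norm u = 1"
    using assms(1) by (auto simp: outer_unit_normal_def)
  then have "u \<bullet> (c - x) + e \<le> 0"
    by (simp add: inner_diff_right inner_add_right norm_eq_1)
  then show ?thesis using e by simp
qed

lemma outer_unit_normal_exists:
  assumes "closed M" "convex M" "x \<in> frontier M" "interior M \<noteq> {}"
  obtains u where "outer_unit_normal M x u"
proof -
  have x: "x \<in> M" "x \<notin> interior M" using assms by (auto simp: frontier_def)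
  have "x \<notin> rel_interior M" using x(2) assms(4) rel_interior_nonempty_interior by blast
  then obtain a where a: "a \<noteq> 0" "\<And>y. y \<in> M \<Longrightarrow> a \<bullet> x \<le> a \<bullet> y"
    using supporting_hyperplane_rel_boundary[OF assms(2) x(1)] by metis
  have "outer_unit_normal M x (- (1 / norm a) *\<^sub>R a)"
    using a assms(3) by (auto simp: outer_unit_normal_def inner_diff_right divide_simps)
  then show ?thesis using that by blast
qed

lemma const_sign:
  fixes g :: "real \<Rightarrow> real"
  assumes "continuous_on UNIV g" "\<And>t. g t \<noteq> 0" "g s > 0" shows "g t > 0"
proof (rule ccontr)
  assume "\<not> g t > 0"
  then have "g t < 0" using assms(2)[of t] by linarith
  moreover have "connected (range g)" using assms(1) connected_continuous_image by blast
  ultimately have "0 \<in> range g"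
    using connected_ivt_component[of "range g" "g t" "g s" 1 0] assms(3) by auto
  then show False using assms(2) by (metis imageE)
qed

text \<open>The counterclockwise quarter turn; \<open>J x \<bullet> y\<close> is the determinant of
  \<open>x\<close> and \<open>y\<close>, which lets curvature be handled with inner
  products.\<close>

definition J :: "real^2 \<Rightarrow> real^2" where "J x = vector [- x$2, x$1]"

lemma J_nth [simp]: "J x $ 1 = - x$2" "J x $ 2 = x$1"
  by (simp_all add: J_def)

lemma J_simps: "J x \<bullet> y = - (x \<bullet> J y)" "J x \<bullet> x = 0" "J (J x) = - x" "J x \<bullet> J y = x \<bullet> y"
    "J (k *\<^sub>R x) = k *\<^sub>R J x" "norm (J x) = norm x" "J (- x) = - J x"
  by (auto simp: inner_real2 vec_eq_iff forall_2 norm_eq_sqrt_inner algebra_simps)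

lemma J_U: "J (U t) = W t" and J_W: "J (W t) = - U t"
  by (simp_all add: vec_eq_iff forall_2)

lemma continuous_J: "continuous_on S f \<Longrightarrow> continuous_on S (\<lambda>x. J (f x))"
proof -
  have "linear J" by (rule linearI) (simp_all add: vec_eq_iff forall_2)
  then show "continuous_on S f \<Longrightarrow> continuous_on S (\<lambda>x. J (f x))"
    by (simp add: bounded_linear.continuous_on linear_conv_bounded_linear)
qed

lemma orthogonal_real2:
  assumes "n \<bullet> v = 0" "v \<noteq> 0" "norm n = 1"
  obtains s where "s = 1 \<or> s = - 1" "n = (s / norm v) *\<^sub>R J v"
proof -
  define k where "k = (n \<bullet> J v) / (v \<bullet> v)"
  have v: "v \<bullet> v > 0" using assms by simp
  have 0: "n$1 * v$1 + n$2 * v$2 = 0" using assms(1) by (simp add: inner_real2)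
  have nk: "(v \<bullet> v) *\<^sub>R n = (n \<bullet> J v) *\<^sub>R J v"
  proof -
    have "(v$1 * v$1 + v$2 * v$2) * n$1 - (n$2 * v$1 - n$1 * v$2) * (- v$2) = v$1 * (n$1 * v$1 + n$2 * v$2)"
      "(v$1 * v$1 + v$2 * v$2) * n$2 - (n$2 * v$1 - n$1 * v$2) * v$1 = v$2 * (n$1 * v$1 + n$2 * v$2)"
      by algebra+
    then show ?thesis using 0 by (simp add: vec_eq_iff forall_2 inner_real2 algebra_simps)
  qed
  have n: "n = k *\<^sub>R J v"
  proof -
    have "n = (1 / (v \<bullet> v)) *\<^sub>R ((v \<bullet> v) *\<^sub>R n)" using v by simp
    also have "\<dots> = k *\<^sub>R J v" unfolding nk by (simp add: k_def)
    finally show ?thesis .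
  qed
  then have "\<bar>k\<bar> * norm v = 1" using assms(3) by (simp add: J_simps)
  then have "k * norm v = 1 \<or> k * norm v = -1" by (auto simp: abs_if split: if_splits)
  then have "k = (k * norm v) / norm v" "k * norm v = 1 \<or> k * norm v = -1" using assms(2) by auto
  then show ?thesis using n that[of "k * norm v"] by metis
qed

section \<open>Boundary curves and the intrinsic meaning of curvature\<close>

text \<open>Velocity and acceleration are parameters and no orientation is fixed, so that the curve
  run backwards is an instance as well. Simplicity is expressed as injectivity modulo the period
  1.\<close>

locale c2_curve =
  fixes M :: "(real^2) set" and \<gamma> v a :: "real \<Rightarrow> real^2"
  assumes conv: "convex M" and comp: "compact M" and int_ne: "interior M \<noteq> {}"
    and der_g: "(\<gamma> has_vector_derivative v t) (at t)"
    and der_v: "(v has_vector_derivative a t) (at t)"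
    and cont_a: "continuous_on UNIV a"
    and v_nz: "v t \<noteq> 0"
    and per: "\<gamma> (t + 1) = \<gamma> t"
    and inj: "\<gamma> s = \<gamma> t \<Longrightarrow> \<exists>k::int. s = t + of_int k"
    and front: "frontier M = range \<gamma>"
begin

lemma cont_g: "continuous_on S \<gamma>" and cont_v: "continuous_on S v"
  by (auto intro!: continuous_at_imp_continuous_on has_vector_derivative_continuous der_g der_v)

lemma cont_a': "continuous_on S a" using cont_a continuous_on_subset by blast

lemma closed_M: "closed M" using comp compact_imp_closed by blast

text \<open>The height \<open>n \<bullet> (\<gamma> s - \<gamma> t)\<close> is nowhere positive and
  is zero at \<open>t\<close>; these are the first and second order conditions at a maximum.\<close>

lemma normal_orth:
  assumes n: "outer_unit_normal M (\<gamma> t) n"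
  shows "n \<bullet> v t = 0" "n \<bullet> a t \<le> 0"
proof -
  define h where "h s = n \<bullet> (\<gamma> s - \<gamma> t)" for s
  have h': "(h has_real_derivative n \<bullet> v s) (at s)" for s
    unfolding h_def has_real_derivative_iff_has_vector_derivative
    using bounded_linear.has_vector_derivative[OF bounded_linear_inner_right
        has_vector_derivative_diff[OF der_g has_vector_derivative_const]] by simp
  have h'': "((\<lambda>s. n \<bullet> v s) has_real_derivative n \<bullet> a s) (at s)" for s
    unfolding has_real_derivative_iff_has_vector_derivative
    using bounded_linear.has_vector_derivative[OF bounded_linear_inner_right der_v] by simp
  have le: "h s \<le> 0" for s
  proof -
    have "\<gamma> s \<in> M" using front closed_M by (auto simp: frontier_def)
    then show ?thesis using n by (simp add: h_def outer_unit_normal_def)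
  qed
  have ht: "h t = 0" by (simp add: h_def)
  show 0: "n \<bullet> v t = 0" using DERIV_local_max[OF h', of 1 t] le ht by simp
  show "n \<bullet> a t \<le> 0"
  proof (rule ccontr)
    assume "\<not> n \<bullet> a t \<le> 0"
    then obtain d where d: "d > 0" "\<And>e. 0 < e \<Longrightarrow> e < d \<Longrightarrow> 0 < n \<bullet> v (t + e)"
      using DERIV_pos_inc_right[OF h''[of t]] 0 by auto
    have "h t < h (t + d/2)"
    proof (rule DERIV_pos_imp_increasing_open[where f = h])
      show "t < t + d / 2" using d by simp
      fix x assume "t < x" "x < t + d / 2"
      then show "\<exists>y. (h has_real_derivative y) (at x) \<and> 0 < y" using h' d(2)[of "x - t"] by auto
    next
      show "continuous_on {t..t + d/2} h" unfolding h_def by (intro continuous_intros cont_g)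
    qed
    then show False using le[of "t + d/2"] ht by simp
  qed
qed

text \<open>The quotient involves boundary points and the normal but not the parameter, and so
  identifies curvature as a property of the set. Its value comes from the second order expansion of
  the height and the first order expansion of the chord.\<close>

lemma curvature_limit:
  assumes n: "outer_unit_normal M (\<gamma> t) n"
  shows "((\<lambda>s. - 2 * (n \<bullet> (\<gamma> s - \<gamma> t)) / (norm (\<gamma> s - \<gamma> t))\<^sup>2)
     \<longlongrightarrow> \<bar>v t $ 1 * a t $ 2 - v t $ 2 * a t $ 1\<bar> / norm (v t) ^ 3) (at t)"
proof -
  define h where "h s = n \<bullet> (\<gamma> s - \<gamma> t)" for s
  have h': "(h has_real_derivative n \<bullet> v s) (at s)" for s
    unfolding h_def has_real_derivative_iff_has_vector_derivative
    using bounded_linear.has_vector_derivative[OF bounded_linear_inner_right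
        has_vector_derivative_diff[OF der_g has_vector_derivative_const]] by simp
  have h'': "((\<lambda>s. n \<bullet> v s) has_real_derivative n \<bullet> a s) (at s)" for s
    unfolding has_real_derivative_iff_has_vector_derivative
    using bounded_linear.has_vector_derivative[OF bounded_linear_inner_right der_v] by simp
  note orth = normal_orth[OF n]
  \<comment> \<open>One application of l'Hospital suffices: since \<open>n \<bullet> v t\<close> is
    zero, the quotient of the derivatives is half the difference quotient of
    \<open>n \<bullet> v\<close> at \<open>t\<close>.\<close>
  have l1: "((\<lambda>s. h s / (s - t)\<^sup>2) \<longlongrightarrow> (n \<bullet> a t) / 2) (at t)"
  proof (rule lhopital[where f' = "\<lambda>s. n \<bullet> v s" and g' = "\<lambda>s. 2 * (s - t)"])
    have "isCont h t" using h' DERIV_isCont by blast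
    then show "(h \<longlongrightarrow> 0) (at t)" by (simp add: isCont_def h_def)
    show "((\<lambda>s. (s - t)\<^sup>2) \<longlongrightarrow> 0) (at t)" by (auto intro!: tendsto_eq_intros)
    show "\<forall>\<^sub>F s in at t. (s - t)\<^sup>2 \<noteq> 0" by (auto simp: eventually_at intro!: exI[of _ 1])
    show "\<forall>\<^sub>F s in at t. 2 * (s - t) \<noteq> 0" by (auto simp: eventually_at intro!: exI[of _ 1])
    show "\<forall>\<^sub>F s in at t. (h has_real_derivative n \<bullet> v s) (at s)" using h' by simp
    show "\<forall>\<^sub>F s in at t. ((\<lambda>s. (s - t)\<^sup>2) has_real_derivative 2 * (s - t)) (at s)"
      by (auto intro!: always_eventually derivative_eq_intros)
    have "((\<lambda>s. (n \<bullet> v s - n \<bullet> v t) / (s - t) / 2) \<longlongrightarrow> (n \<bullet> a t) / 2) (at t)"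
      using h''[of t] by (intro tendsto_intros) (auto simp: has_field_derivative_iff)
    then show "((\<lambda>s. n \<bullet> v s / (2 * (s - t))) \<longlongrightarrow> (n \<bullet> a t) / 2) (at t)"
      using orth by (simp add: mult.commute)
  qed
  have "((\<lambda>s. (\<gamma> s - \<gamma> t) /\<^sub>R (s - t)) \<longlongrightarrow> v t) (at t)"
  proof (rule Lim_null[THEN iffD2], rule tendsto_norm_zero_cancel)
    have "((\<lambda>s. norm (\<gamma> s - \<gamma> t - (s - t) *\<^sub>R v t) / norm (s - t)) \<longlongrightarrow> 0) (at t)"
      using der_g[of t] by (simp add: has_vector_derivative_def has_derivative_iff_norm)
    moreover have "\<forall>\<^sub>F s in at t. norm (\<gamma> s - \<gamma> t - (s - t) *\<^sub>R v t) / norm (s - t)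
        = norm ((\<gamma> s - \<gamma> t) /\<^sub>R (s - t) - v t)"
      unfolding eventually_at
    proof (intro exI[of _ 1] conjI ballI impI, simp)
      fix s assume "s \<noteq> t \<and> dist s t < 1"
      then have "(\<gamma> s - \<gamma> t) /\<^sub>R (s - t) - v t = (\<gamma> s - \<gamma> t - (s - t) *\<^sub>R v t) /\<^sub>R (s - t)"
        by (simp add: scaleR_right_diff_distrib)
      then show "norm (\<gamma> s - \<gamma> t - (s - t) *\<^sub>R v t) / norm (s - t)
        = norm ((\<gamma> s - \<gamma> t) /\<^sub>R (s - t) - v t)" by (simp add: divide_inverse_commute)
    qed
    ultimately show "((\<lambda>s. norm ((\<gamma> s - \<gamma> t) /\<^sub>R (s - t) - v t)) \<longlongrightarrow> 0) (at t)"
      by (rule Lim_transform_eventually)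
  qed
  then have l2: "((\<lambda>s. (norm ((\<gamma> s - \<gamma> t) /\<^sub>R (s - t)))\<^sup>2) \<longlongrightarrow> (norm (v t))\<^sup>2) (at t)"
    by (intro tendsto_intros)
  have "((\<lambda>s. - 2 * (h s / (s - t)\<^sup>2) / (norm ((\<gamma> s - \<gamma> t) /\<^sub>R (s - t)))\<^sup>2)
     \<longlongrightarrow> - 2 * ((n \<bullet> a t) / 2) / (norm (v t))\<^sup>2) (at t)"
    by (intro tendsto_intros l1 l2) (simp add: v_nz)
  moreover have "- 2 * ((n \<bullet> a t) / 2) / (norm (v t))\<^sup>2 = \<bar>v t $ 1 * a t $ 2 - v t $ 2 * a t $ 1\<bar> / norm (v t) ^ 3"
  proof -
    obtain s where s: "s = 1 \<or> s = - 1" "n = (s / norm (v t)) *\<^sub>R J (v t)"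
      using orthogonal_real2[OF orth(1) v_nz] n by (auto simp: outer_unit_normal_def)
    have c: "J (v t) \<bullet> a t = v t $ 1 * a t $ 2 - v t $ 2 * a t $ 1" by (simp add: inner_real2)
    have "- (n \<bullet> a t) = \<bar>n \<bullet> a t\<bar>" using orth by simp
    also have "\<dots> = \<bar>v t $ 1 * a t $ 2 - v t $ 2 * a t $ 1\<bar> / norm (v t)"
      unfolding s(2) inner_scaleR_left c using s(1) by (auto simp: abs_mult)
    finally show ?thesis by (simp add: power2_eq_square power3_eq_cube)
  qed
  moreover have "\<forall>\<^sub>F s in at t. - 2 * (h s / (s - t)\<^sup>2) / (norm ((\<gamma> s - \<gamma> t) /\<^sub>R (s - t)))\<^sup>2
     = - 2 * (n \<bullet> (\<gamma> s - \<gamma> t)) / (norm (\<gamma> s - \<gamma> t))\<^sup>2"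
    unfolding eventually_at
  proof (intro exI[of _ 1] conjI ballI impI, simp)
    fix s assume "s \<noteq> t \<and> dist s t < 1"
    then have "(s - t)\<^sup>2 \<noteq> 0" by simp
    moreover have "(norm ((\<gamma> s - \<gamma> t) /\<^sub>R (s - t)))\<^sup>2 = (norm (\<gamma> s - \<gamma> t))\<^sup>2 / (s - t)\<^sup>2"
      by (simp add: power_mult_distrib power_inverse divide_inverse mult.commute)
    ultimately show "- 2 * (h s / (s - t)\<^sup>2) / (norm ((\<gamma> s - \<gamma> t) /\<^sub>R (s - t)))\<^sup>2
      = - 2 * (n \<bullet> (\<gamma> s - \<gamma> t)) / (norm (\<gamma> s - \<gamma> t))\<^sup>2" by (simp add: h_def)
  qed
  ultimately show ?thesis using Lim_transform_eventually by fastforce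
qed

end

text \<open>Both values are limits of the same geometric quotient along one sequence of boundary
  points. The sequence comes from the first curve; compactness makes the parameters on the second
  curve converge as well, along a subsequence.\<close>

lemma c2_curve_curvature_unique:
  assumes 1: "c2_curve M \<gamma>1 v1 a1" and 2: "c2_curve M \<gamma>2 v2 a2" and eq: "\<gamma>1 t1 = \<gamma>2 t2"
  shows "\<bar>v1 t1 $ 1 * a1 t1 $ 2 - v1 t1 $ 2 * a1 t1 $ 1\<bar> / norm (v1 t1) ^ 3 =
    \<bar>v2 t2 $ 1 * a2 t2 $ 2 - v2 t2 $ 2 * a2 t2 $ 1\<bar> / norm (v2 t2) ^ 3"
    (is "?k1 = ?k2")
proof -
  interpret c1: c2_curve M \<gamma>1 v1 a1 by fact
  interpret c2: c2_curve M \<gamma>2 v2 a2 by fact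
  have fr: "\<gamma>1 t1 \<in> frontier M" using c1.front by simp
  obtain n where n1: "outer_unit_normal M (\<gamma>1 t1) n"
    using outer_unit_normal_exists[OF c1.closed_M c1.conv fr c1.int_ne] .
  then have n2: "outer_unit_normal M (\<gamma>2 t2) n" using eq by simp
  \<comment> \<open>Two successors keep the offset strictly between 0 and the period 1, so the
    points never coincide with \<open>\<gamma>1 t1\<close>.\<close>
  define s where "s i = t1 + inverse (real (Suc (Suc i)))" for i
  have sl: "s \<longlonglongrightarrow> t1"
  proof -
    have "(\<lambda>i. inverse (real (Suc (Suc i)))) \<longlonglongrightarrow> 0" using LIMSEQ_inverse_real_of_nat LIMSEQ_Suc by blast
    then show ?thesis unfolding s_def using tendsto_add[OF tendsto_const] by fastforce
  qed
  have ne: "\<gamma>1 (s i) \<noteq> \<gamma>1 t1" for i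
  proof
    assume "\<gamma>1 (s i) = \<gamma>1 t1"
    then obtain k :: int where k: "s i = t1 + of_int k" using c1.inj by blast
    have "0 < inverse (real (Suc (Suc i)))" "inverse (real (Suc (Suc i))) < 1"
      by (auto simp: field_simps)
    moreover have e: "inverse (real (Suc (Suc i))) = real_of_int k" using k unfolding s_def by linarith
    ultimately have "0 < k" "k < 1" unfolding e by simp_all
    then show False by simp
  qed
  \<comment> \<open>The window of length 1 is centred at \<open>t2\<close>, so that a limit
    differing from \<open>t2\<close> by an integer must be \<open>t2\<close> itself.\<close>
  have "\<exists>\<tau>. \<gamma>2 \<tau> = \<gamma>1 (s i) \<and> \<tau> \<in> {t2 - 1/2..t2 + 1/2}" for i
  proof -
    have "\<gamma>1 (s i) \<in> range \<gamma>2" using c1.front c2.front by auto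
    then obtain \<tau> where t: "\<gamma>1 (s i) = \<gamma>2 \<tau>" by blast
    define k where "k = \<lfloor>\<tau> - t2 + 1/2\<rfloor>"
    have "\<gamma>2 (\<tau> + of_int (- k)) = \<gamma>2 \<tau>"
    proof -
      have n: "\<gamma>2 (x + real j) = \<gamma>2 x" for x j
      proof (induction j)
        case (Suc j) then show ?case using c2.per[of "x + real j"] by (simp add: algebra_simps)
      qed simp
      show ?thesis
      proof (cases "k \<ge> 0")
        case True then show ?thesis using n[of "\<tau> - of_int k" "nat k"] by simp
      next
        case False then show ?thesis using n[of "\<tau>" "nat (-k)"] by simp
      qed
    qed
    moreover have "\<tau> + of_int (- k) \<in> {t2 - 1/2..t2 + 1/2}"
      unfolding k_def by simp linarith
    ultimately show ?thesis using t by metis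
  qed
  then obtain \<tau> where tau: "\<And>i. \<gamma>2 (\<tau> i) = \<gamma>1 (s i)" "\<And>i. \<tau> i \<in> {t2 - 1/2..t2 + 1/2}" by metis
  obtain l q where l: "l \<in> {t2 - 1/2..t2 + 1/2}" "strict_mono q" "(\<tau> \<circ> q) \<longlonglongrightarrow> l"
    using compact_Icc[of "t2 - 1/2" "t2 + 1/2"] tau(2) unfolding compact_def by metis
  have "l = t2"
  proof -
    have "(\<lambda>i. \<gamma>2 ((\<tau> \<circ> q) i)) \<longlonglongrightarrow> \<gamma>2 l"
      by (rule continuous_on_tendsto_compose[OF c2.cont_g[of UNIV] l(3)]) auto
    moreover have "(\<lambda>i. \<gamma>1 ((s \<circ> q) i)) \<longlonglongrightarrow> \<gamma>1 t1"
      by (rule continuous_on_tendsto_compose[OF c1.cont_g[of UNIV] LIMSEQ_subseq_LIMSEQ[OF sl l(2)]]) auto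
    ultimately have "\<gamma>2 l = \<gamma>1 t1" using tau(1) LIMSEQ_unique by (simp add: o_def)
    then obtain k :: int where k: "l = t2 + of_int k" using c2.inj eq by metis
    then have "\<bar>real_of_int k\<bar> \<le> 1/2" using l(1) by auto
    then have "k = 0" by linarith
    then show ?thesis using k by simp
  qed
  define Q where "Q y = - 2 * (n \<bullet> (y - \<gamma>1 t1)) / (norm (y - \<gamma>1 t1))\<^sup>2" for y
  have ne1: "s i \<noteq> t1" and ne2: "\<tau> i \<noteq> t2" for i using ne[of i] tau(1)[of i] eq by metis+
  have f1: "filterlim (s \<circ> q) (at t1) sequentially"
    unfolding filterlim_at using LIMSEQ_subseq_LIMSEQ[OF sl l(2)] ne1 by (auto simp: o_def)
  have f2: "filterlim (\<tau> \<circ> q) (at t2) sequentially"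
    unfolding filterlim_at using l(3) \<open>l = t2\<close> ne2 by (auto simp: o_def)
  have "(\<lambda>i. Q (\<gamma>1 ((s \<circ> q) i))) \<longlonglongrightarrow> ?k1"
    using filterlim_compose[OF c1.curvature_limit[OF n1] f1] by (simp add: Q_def)
  moreover have "(\<lambda>i. Q (\<gamma>2 ((\<tau> \<circ> q) i))) \<longlonglongrightarrow> ?k2"
    using filterlim_compose[OF c2.curvature_limit[OF n2] f2] by (simp add: Q_def eq)
  ultimately show ?thesis using tau(1) LIMSEQ_unique by (simp add: o_def)
qed

lemma C2_boundary_param_c2_curve:
  assumes M: "convex_disc M" and g: "C2_boundary_param M \<gamma>"
  shows "c2_curve M \<gamma> (\<lambda>t. vector_derivative \<gamma> (at t))
    (\<lambda>t. vector_derivative (\<lambda>s. vector_derivative \<gamma> (at s)) (at t))"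
proof
  have per: "\<gamma> (t + 1) = \<gamma> t" for t using g by (auto simp: C2_boundary_param_def)
  show "convex M" "compact M" "interior M \<noteq> {}" using M by (auto simp: convex_disc_def)
  show "(\<gamma> has_vector_derivative vector_derivative \<gamma> (at t)) (at t)" for t
    using g unfolding C2_boundary_param_def C1_differentiable_on_eq
    by (simp add: vector_derivative_works[symmetric])
  show "((\<lambda>s. vector_derivative \<gamma> (at s)) has_vector_derivative
      vector_derivative (\<lambda>s. vector_derivative \<gamma> (at s)) (at t)) (at t)" for t
    using g unfolding C2_boundary_param_def C1_differentiable_on_eq
    by (simp add: vector_derivative_works[symmetric])
  show "continuous_on UNIV (\<lambda>t. vector_derivative (\<lambda>s. vector_derivative \<gamma> (at s)) (at t))"
    using g unfolding C2_boundary_param_def C1_differentiable_on_eq by blast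
  show "vector_derivative \<gamma> (at t) \<noteq> 0" "\<gamma> (t + 1) = \<gamma> t" for t
    using g by (auto simp: C2_boundary_param_def)
  have frac: "\<gamma> (frac t) = \<gamma> t" for t
  proof -
    have n: "\<gamma> (x + real j) = \<gamma> x" for x j
    proof (induction j)
      case (Suc j) then show ?case using per[of "x + real j"] by (simp add: algebra_simps)
    qed simp
    show ?thesis
    proof (cases "\<lfloor>t\<rfloor> \<ge> 0")
      case True then show ?thesis using n[of "frac t" "nat \<lfloor>t\<rfloor>"] by (simp add: frac_def)
    next
      case False then show ?thesis using n[of t "nat (- \<lfloor>t\<rfloor>)"] by (simp add: frac_def)
    qed
  qed
  \<comment> \<open>\<open>loop_free\<close> speaks of the closed unit interval and exempts its two
    ends; fractional parts never reach 1, which avoids the exemption.\<close>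
  show "\<exists>k::int. s = t + of_int k" if "\<gamma> s = \<gamma> t" for s t
  proof -
    have "\<gamma> (frac s) = \<gamma> (frac t)" using that frac by simp
    moreover have "frac s \<in> {0..<1}" "frac t \<in> {0..<1}" by (auto simp: frac_lt_1)
    moreover have "loop_free \<gamma>" using g by (auto simp: C2_boundary_param_def simple_path_def)
    ultimately have "frac s = frac t" unfolding loop_free_def by fastforce
    then have "s = t + of_int (\<lfloor>s\<rfloor> - \<lfloor>t\<rfloor>)" by (simp add: frac_def)
    then show ?thesis by blast
  qed
  have "frontier M = \<gamma> ` {0..1}" using g by (simp add: C2_boundary_param_def path_image_def)
  also have "\<dots> = range \<gamma>"
  proof
    show "range \<gamma> \<subseteq> \<gamma> ` {0..1}"
    proof
      fix y assume "y \<in> range \<gamma>"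
      then obtain t where "y = \<gamma> (frac t)" using frac by auto
      then show "y \<in> \<gamma> ` {0..1}" using frac_lt_1[of t] by (intro image_eqI[of _ _ "frac t"]) auto
    qed
  qed auto
  finally show "frontier M = range \<gamma>" .
qed

lemma boundary_curvature_eq:
  assumes M: "convex_disc M" and g: "C2_boundary_param M \<gamma>"
  shows "boundary_curvature M (\<gamma> t) = curve_curvature \<gamma> t"
  unfolding boundary_curvature_def
proof (rule the_equality)
  show "\<exists>\<gamma>' t'. C2_boundary_param M \<gamma>' \<and> \<gamma>' t' = \<gamma> t \<and> curve_curvature \<gamma> t = curve_curvature \<gamma>' t'"
    using g by blast
next
  fix k assume "\<exists>\<gamma>' t'. C2_boundary_param M \<gamma>' \<and> \<gamma>' t' = \<gamma> t \<and> k = curve_curvature \<gamma>' t'"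
  then obtain \<gamma>' t' where *: "C2_boundary_param M \<gamma>'" "\<gamma>' t' = \<gamma> t" "k = curve_curvature \<gamma>' t'" by blast
  from c2_curve_curvature_unique[OF C2_boundary_param_c2_curve[OF M *(1)] C2_boundary_param_c2_curve[OF M g] *(2)]
  show "k = curve_curvature \<gamma> t" unfolding *(3) curve_curvature_def Let_def .
qed

section \<open>Reparametrization by the normal angle\<close>

text \<open>\<open>ccw\<close> says that the interior point \<open>c\<close> lies to the left of
  every tangent, which fixes the counterclockwise orientation.\<close>

locale c2_plus_curve = c2_curve +
  fixes c :: "real^2"
  assumes c_int: "c \<in> interior M"
    and ccw: "J (v t) \<bullet> (c - \<gamma> t) > 0"
    and curved: "v t $ 1 * a t $ 2 - v t $ 2 * a t $ 1 \<noteq> 0"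
begin

text \<open>The angular speed of the tangent: the determinant of velocity and acceleration over the
  squared speed.\<close>

definition "\<omega> t = (J (v t) \<bullet> a t) / (v t \<bullet> v t)"

lemma vv: "v t \<bullet> v t > 0" using v_nz by simp

text \<open>Orthogonality to the tangent leaves two opposite unit vectors, and the interior point on
  the left rules out one of them.\<close>

lemma normal: "outer_unit_normal M (\<gamma> t) n \<longleftrightarrow> n = (- 1 / norm (v t)) *\<^sub>R J (v t)"
proof -
  have imp: "n = (- 1 / norm (v t)) *\<^sub>R J (v t)" if n: "outer_unit_normal M (\<gamma> t) n" for n
  proof -
    obtain s where s: "s = 1 \<or> s = - 1" "n = (s / norm (v t)) *\<^sub>R J (v t)"
      using orthogonal_real2[OF normal_orth(1)[OF n] v_nz] n by (auto simp: outer_unit_normal_def)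
    have "n \<bullet> (c - \<gamma> t) < 0" by (rule outer_unit_normal_interior[OF n c_int])
    then have "s / norm (v t) * (J (v t) \<bullet> (c - \<gamma> t)) < 0" unfolding s(2) by simp
    moreover have "0 \<le> 1 / norm (v t) * (J (v t) \<bullet> (c - \<gamma> t))" using ccw[of t] by simp
    ultimately have "s \<noteq> 1" by (metis not_le)
    then show ?thesis using s by auto
  qed
  have "\<gamma> t \<in> frontier M" using front by simp
  then obtain n0 where "outer_unit_normal M (\<gamma> t) n0"
    using outer_unit_normal_exists[OF closed_M conv _ int_ne] by blast
  then show ?thesis using imp by blast
qed

lemma cross_pos: "J (v t) \<bullet> a t > 0"
proof -
  define n where "n = (- 1 / norm (v t)) *\<^sub>R J (v t)"
  have "n \<bullet> a t \<le> 0" using normal normal_orth(2) n_def by blast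
  then have "0 \<le> (J (v t) \<bullet> a t) / norm (v t)" by (simp add: n_def)
  then have "0 \<le> J (v t) \<bullet> a t" using v_nz by (simp add: zero_le_divide_iff)
  moreover have "J (v t) \<bullet> a t \<noteq> 0" using curved by (simp add: inner_real2 algebra_simps)
  ultimately show ?thesis by simp
qed

lemma omega_pos: "\<omega> t > 0" unfolding \<omega>_def using cross_pos vv by simp

lemma cont_omega: "continuous_on S \<omega>"
  unfolding \<omega>_def using vv
  by (intro continuous_intros continuous_J cont_v cont_a') (metis less_irrefl)

lemma a_decomp: "a t = ((a t \<bullet> v t) / (v t \<bullet> v t)) *\<^sub>R v t + \<omega> t *\<^sub>R J (v t)"
proof -
  have "(v t \<bullet> v t) *\<^sub>R a t = (a t \<bullet> v t) *\<^sub>R v t + (J (v t) \<bullet> a t) *\<^sub>R J (v t)"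
    by (simp add: vec_eq_iff forall_2 inner_real2 algebra_simps)
  then have "(1 / (v t \<bullet> v t)) *\<^sub>R ((v t \<bullet> v t) *\<^sub>R a t)
    = (1 / (v t \<bullet> v t)) *\<^sub>R ((a t \<bullet> v t) *\<^sub>R v t + (J (v t) \<bullet> a t) *\<^sub>R J (v t))" by simp
  then show ?thesis using vv[of t] by (simp add: \<omega>_def scaleR_right_distrib)
qed

lemma v_per: "v (t + 1) = v t" and a_per: "a (t + 1) = a t"
proof -
  have sh: "((\<lambda>s. s + 1) has_vector_derivative 1) (at t)" for t :: real
    unfolding has_real_derivative_iff_has_vector_derivative[symmetric] by (auto intro!: derivative_eq_intros)
  have "((\<lambda>s. \<gamma> (s + 1)) has_vector_derivative v (t + 1)) (at t)" for t
    using vector_diff_chain_at[OF sh der_g] by (simp add: o_def)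
  then have v: "v (t + 1) = v t" for t
    using der_g[of t] vector_derivative_unique_at by (simp add: per) blast
  show "v (t + 1) = v t" by (rule v)
  have "((\<lambda>s. v (s + 1)) has_vector_derivative a (t + 1)) (at t)"
    using vector_diff_chain_at[OF sh der_v] by (simp add: o_def)
  then show "a (t + 1) = a t"
    using der_v[of t] vector_derivative_unique_at by (simp add: v) blast
qed

lemma omega_lower: obtains w where "w > 0" "\<And>t. w \<le> \<omega> t"
proof -
  obtain s where s: "\<forall>t\<in>{0..1}. \<omega> s \<le> \<omega> t"
    using continuous_attains_inf[OF compact_Icc _ cont_omega, of 0 1] by auto
  have "\<omega> s \<le> \<omega> t" for t
  proof -
    have "\<omega> (x + real j) = \<omega> x" for x j
    proof (induction j)
      case (Suc j)
      have "\<omega> (y + 1) = \<omega> y" for y by (simp add: \<omega>_def v_per a_per)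
      from this[of "x + real j"] show ?case using Suc by (simp add: algebra_simps)
    qed simp
    note n = this
    have "\<omega> (frac t) = \<omega> t"
    proof (cases "\<lfloor>t\<rfloor> \<ge> 0")
      case True then show ?thesis using n[of "frac t" "nat \<lfloor>t\<rfloor>"] by (simp add: frac_def)
    next
      case False then show ?thesis using n[of t "nat (- \<lfloor>t\<rfloor>)"] by (simp add: frac_def)
    qed
    moreover have "frac t \<in> {0..1}" using frac_lt_1[of t] by auto
    ultimately show ?thesis using s by metis
  qed
  then show ?thesis using that omega_pos by blast
qed

text \<open>\<theta> is an integral of the angular speed. The component of \<open>v\<close> along
  \<open>U (\<theta> t)\<close> then satisfies the same linear differential equation as the length
  of \<open>v\<close>, so their squared quotient is constant; it starts at zero. Hence
  \<open>v\<close> stays parallel to \<open>W (\<theta> t)\<close>, with constant sense by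
  continuity.\<close>

lemma angle:
  obtains \<theta> where "\<And>t. (\<theta> has_real_derivative \<omega> t) (at t)" "\<And>t. v t = norm (v t) *\<^sub>R W (\<theta> t)"
proof -
  obtain \<theta>0 where t0: "- J (v 0) = norm (v 0) *\<^sub>R U \<theta>0" using polar_real2[of 0 "- J (v 0)"] unfolding norm_minus_cancel J_simps(6) by blast
  define \<theta> where "\<theta> t = \<theta>0 + (if 0 \<le> t then integral {0..t} \<omega> else - integral {t..0} \<omega>)" for t
  have der: "(\<theta> has_real_derivative \<omega> t) (at t)" for t
  proof -
    \<comment> \<open>\<open>b\<close> is below both 0 and \<open>t\<close>, so near
      \<open>t\<close> a single integral from \<open>b\<close> represents \<theta>, whichever case
      of its definition applies.\<close>
    define b where "b = - \<bar>t\<bar> - 1"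
    have eq: "\<theta> s = (\<theta>0 - integral {b..0} \<omega>) + integral {b..s} \<omega>" if "s \<ge> b" for s
    proof (cases "0 \<le> s")
      case True
      have "integral {b..0} \<omega> + integral {0..s} \<omega> = integral {b..s} \<omega>"
        by (rule Henstock_Kurzweil_Integration.integral_combine)
          (use True in \<open>auto simp: b_def intro: integrable_continuous_real cont_omega\<close>)
      then show ?thesis using True by (simp add: \<theta>_def)
    next
      case False
      have "integral {b..s} \<omega> + integral {s..0} \<omega> = integral {b..0} \<omega>"
        by (rule Henstock_Kurzweil_Integration.integral_combine)
          (use False that in \<open>auto intro: integrable_continuous_real cont_omega\<close>)
      then show ?thesis using False by (simp add: \<theta>_def)
    qed
    have i: "((\<lambda>s. integral {b..s} \<omega>) has_real_derivative \<omega> t) (at t)"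
    proof -
      have "((\<lambda>s. integral {b..s} \<omega>) has_real_derivative \<omega> t) (at t within {b..\<bar>t\<bar> + 1})"
        by (rule integral_has_real_derivative) (auto simp: b_def cont_omega)
      moreover have "t \<in> interior {b..\<bar>t\<bar> + 1}" by (auto simp: b_def interior_atLeastAtMost_real)
      then have "at t within {b..\<bar>t\<bar> + 1} = at t" by (rule at_within_interior)
      ultimately show ?thesis by simp
    qed
    have "((\<lambda>s. (\<theta>0 - integral {b..0} \<omega>) + integral {b..s} \<omega>) has_real_derivative \<omega> t) (at t)"
      using DERIV_add[OF DERIV_const i] by simp
    then show ?thesis
      by (rule has_field_derivative_transform_within[where d = 1]) (auto simp: eq b_def dist_real_def)
  qed
  have vd: "((\<lambda>t. v t \<bullet> z (\<theta> t)) has_real_derivative a t \<bullet> z (\<theta> t) + v t \<bullet> (\<omega> t *\<^sub>R z')) (at t)"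
    if z: "(z has_vector_derivative z') (at (\<theta> t))" for z z' t
  proof -
    have "((\<lambda>t. z (\<theta> t)) has_vector_derivative \<omega> t *\<^sub>R z') (at t)"
      using vector_diff_chain_at[of \<theta> "\<omega> t" t z z'] der z
      by (simp add: o_def has_real_derivative_iff_has_vector_derivative)
    from bounded_bilinear.has_vector_derivative[OF bounded_bilinear_inner der_v this]
    show ?thesis by (simp add: has_real_derivative_iff_has_vector_derivative add.commute)
  qed
  define \<alpha> where "\<alpha> t = (a t \<bullet> v t) / (v t \<bullet> v t)" for t
  define f where "f t = v t \<bullet> U (\<theta> t)" for t
  have f': "(f has_real_derivative \<alpha> t * f t) (at t)" for t
  proof -
    have "a t \<bullet> U (\<theta> t) + v t \<bullet> (\<omega> t *\<^sub>R W (\<theta> t)) = \<alpha> t * f t"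
      by (subst a_decomp) (simp add: inner_add_left J_simps J_U \<alpha>_def f_def)
    then show ?thesis using vd[OF U_deriv, of t] by (simp add: f_def[abs_def])
  qed
  have vv': "((\<lambda>t. v t \<bullet> v t) has_real_derivative 2 * (\<alpha> t * (v t \<bullet> v t))) (at t)" for t
    using bounded_bilinear.has_vector_derivative[OF bounded_bilinear_inner der_v der_v, of t] vv[of t]
    by (simp add: has_real_derivative_iff_has_vector_derivative \<alpha>_def inner_commute)
  have "((\<lambda>t. (f t)\<^sup>2 / (v t \<bullet> v t)) has_real_derivative 0) (at t)" for t
  proof -
    have "((\<lambda>t. (f t)\<^sup>2 / (v t \<bullet> v t)) has_real_derivative
       ((2 * f t * (\<alpha> t * f t)) * (v t \<bullet> v t) - (f t)\<^sup>2 * (2 * (\<alpha> t * (v t \<bullet> v t))))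
        / ((v t \<bullet> v t) * (v t \<bullet> v t))) (at t)"
      using vv[of t] by (auto intro!: derivative_eq_intros f' vv')
    then show ?thesis by (simp add: power2_eq_square algebra_simps)
  qed
  then have "(f t)\<^sup>2 / (v t \<bullet> v t) = (f 0)\<^sup>2 / (v 0 \<bullet> v 0)" for t
    using DERIV_isconst_all[of "\<lambda>t. (f t)\<^sup>2 / (v t \<bullet> v t)"] by blast
  have th0: "\<theta> 0 = \<theta>0" by (simp add: \<theta>_def)
  have v0: "v 0 = norm (v 0) *\<^sub>R W \<theta>0"
  proof -
    have "J (- J (v 0)) = norm (v 0) *\<^sub>R J (U \<theta>0)" unfolding t0 by (simp add: J_simps)
    then show ?thesis by (simp add: J_simps J_U)
  qed
  have "f 0 = 0" unfolding f_def th0 by (subst v0) (simp add: W_inner_U)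
  then have f0: "f t = 0" for t
    using \<open>\<And>t. (f t)\<^sup>2 / (v t \<bullet> v t) = (f 0)\<^sup>2 / (v 0 \<bullet> v 0)\<close>[of t] vv[of t] by simp
  define g where "g t = v t \<bullet> W (\<theta> t)" for t
  have vg: "v t = g t *\<^sub>R W (\<theta> t)" for t
    using U_decomp[of "v t" "\<theta> t"] f0[of t] by (simp add: g_def f_def inner_commute)
  have "g t > 0" for t
  proof (rule const_sign[where s = 0 and g = g])
    have "continuous_on UNIV \<theta>" using der by (meson DERIV_isCont continuous_at_imp_continuous_on)
    then show "continuous_on UNIV g" unfolding g_def
      by (intro continuous_intros cont_v continuous_on_compose2[OF continuous_W]) auto
    show "g t \<noteq> 0" for t using vg[of t] v_nz[of t] by auto
    show "g 0 > 0" unfolding g_def th0 by (subst v0) (simp add: W_inner_W v_nz)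
  qed
  then have "norm (v t) = g t" for t using arg_cong[OF vg[of t], of norm] by (simp add: less_imp_le)
  then show ?thesis using that der vg by metis
qed

text \<open>As \<open>\<omega>\<close> is bounded below by a positive constant, the tangent angle is
  a bijection of the line with differentiable inverse \<tau>. Composing \<gamma> with \<tau> gives
  the curve, and its radius is speed divided by angular speed.\<close>

lemma normal_param:
  obtains m r where "oval M m r"
    "\<And>\<theta>. \<exists>t. m \<theta> = \<gamma> t \<and> r \<theta> = norm (v t) ^ 3 / (J (v t) \<bullet> a t)"
proof -
  obtain \<theta> where th: "\<And>t. (\<theta> has_real_derivative \<omega> t) (at t)" "\<And>t. v t = norm (v t) *\<^sub>R W (\<theta> t)"
    using angle by blast
  obtain w where w: "w > 0" "\<And>t. w \<le> \<omega> t" using omega_lower by blast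
  have grow: "w * (t - s) \<le> \<theta> t - \<theta> s" if "s \<le> t" for s t
  proof -
    have "\<theta> s - w * s \<le> \<theta> t - w * t"
    proof (rule DERIV_nonneg_imp_nondecreasing[where f = "\<lambda>s. \<theta> s - w * s", OF that])
      fix x
      have "((\<lambda>s. \<theta> s - w * s) has_real_derivative \<omega> x - w) (at x)"
        by (auto intro!: derivative_eq_intros th)
      then show "\<exists>y. ((\<lambda>s. \<theta> s - w * s) has_real_derivative y) (at x) \<and> 0 \<le> y"
        using w(2)[of x] by auto
    qed
    then show ?thesis by (simp add: algebra_simps)
  qed
  have cont_th: "continuous_on S \<theta>" for S using th(1) by (meson DERIV_isCont continuous_at_imp_continuous_on)
  have surj: "\<exists>t. \<theta> t = y" for y
  proof -
    define d where "d = \<bar>y - \<theta> 0\<bar> / w"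
    have "w * d = \<bar>y - \<theta> 0\<bar>" using w by (simp add: d_def)
    then have "\<theta> (- d) \<le> y" "y \<le> \<theta> d" "- d \<le> d"
      using grow[of "-d" 0] grow[of 0 d] w by (auto simp: d_def)
    then show ?thesis using IVT'[of \<theta> "- d" y d] cont_th by auto
  qed
  then obtain \<tau> where tau: "\<And>y. \<theta> (\<tau> y) = y" by metis
  have lip: "w * \<bar>\<tau> x - \<tau> y\<bar> \<le> \<bar>x - y\<bar>" for x y
    using grow[of "\<tau> x" "\<tau> y"] grow[of "\<tau> y" "\<tau> x"] tau by (cases "\<tau> x \<le> \<tau> y") auto
  have inj_th: "\<tau> (\<theta> t) = t" for t
    using grow[of "\<tau> (\<theta> t)" t] grow[of t "\<tau> (\<theta> t)"] tau[of "\<theta> t"] w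
    by (cases "\<tau> (\<theta> t) \<le> t") (auto simp: mult_le_0_iff)
  have cont_tau: "isCont \<tau> x" for x
  proof -
    have "(1/w)-lipschitz_on UNIV \<tau>"
      using lip w by (intro lipschitz_onI) (auto simp: dist_real_def field_simps)
    then show ?thesis using lipschitz_on_continuous_on continuous_on_eq_continuous_at open_UNIV by blast
  qed
  have dtau: "(\<tau> has_real_derivative inverse (\<omega> (\<tau> x))) (at x)" for x
    by (rule DERIV_inverse_function[where f = \<theta> and a = "x - 1" and b = "x + 1"])
      (use th omega_pos[of "\<tau> x"] tau cont_tau in auto)
  define m where "m x = \<gamma> (\<tau> x)" for x
  define r where "r x = norm (v (\<tau> x)) ^ 3 / (J (v (\<tau> x)) \<bullet> a (\<tau> x))" for x
  have r_alt: "r x = norm (v (\<tau> x)) / \<omega> (\<tau> x)" for x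
    by (simp add: r_def \<omega>_def power3_eq_cube power2_eq_square flip: power2_norm_eq_inner)
  have Un: "U x = (- 1 / norm (v (\<tau> x))) *\<^sub>R J (v (\<tau> x))" for x
    by (subst th(2)) (simp add: J_simps J_W tau v_nz)
  have nrm: "outer_unit_normal M (m x) n \<longleftrightarrow> n = U x" for x n
    unfolding m_def normal Un ..
  have m_front: "range m = frontier M"
    unfolding front m_def using inj_th by (metis (mono_tags, lifting) rangeE rangeI subsetI subset_antisym)
  have mM: "m x \<in> M" for x using m_front closed_M by (auto simp: frontier_def)
  have m_per: "m (x + 2 * pi) = m x" for x
  proof (rule ccontr)
    assume ne: "m (x + 2 * pi) \<noteq> m x"
    have n1: "outer_unit_normal M (m x) (U x)" "outer_unit_normal M (m (x + 2 * pi)) (U x)"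
      unfolding nrm by (simp_all add: U_periodic)
    have z: "U x \<bullet> (m (x + 2 * pi) - m x) = 0"
    proof -
      have "U x \<bullet> (m (x + 2 * pi) - m x) \<le> 0" "U x \<bullet> (m x - m (x + 2 * pi)) \<le> 0"
        using n1 mM by (auto simp: outer_unit_normal_def)
      then show ?thesis by (simp add: inner_diff_right)
    qed
    \<comment> \<open>This replaces computing the turning number. Both points have outer normal
      \<open>U x\<close>, hence so has every point of the segment between them. Such points are
      values of \<open>m\<close> at angles that differ from \<open>x\<close> by full turns, which
      are countably many, whereas a nondegenerate segment is uncountable.\<close>
    have "closed_segment (m (x + 2 * pi)) (m x) \<subseteq> range (\<lambda>k::int. m (x + 2 * pi * of_int k))"
    proof
      fix y assume y: "y \<in> closed_segment (m (x + 2 * pi)) (m x)"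
      then have yM: "y \<in> M" using convex_contains_segment conv mM by blast
      obtain u where "y = (1 - u) *\<^sub>R m (x + 2 * pi) + u *\<^sub>R m x"
        using y by (auto simp: in_segment)
      then have "y - m x = (1 - u) *\<^sub>R (m (x + 2 * pi) - m x)" by (simp add: algebra_simps)
      then have y0: "U x \<bullet> (y - m x) = 0" using z by simp
      then have yle: "\<forall>z\<in>M. U x \<bullet> (z - y) \<le> 0" using n1(1) by (auto simp: outer_unit_normal_def inner_diff_right)
      have "y \<in> frontier M"
      proof (rule ccontr)
        assume "y \<notin> frontier M"
        then have "y \<in> interior M" using yM closed_M by (simp add: frontier_def)
        then have "U x \<bullet> (y - m x) < 0" using outer_unit_normal_interior n1(1) by blast
        then show False using y0 by simp
      qed
      then have "outer_unit_normal M y (U x)" using yle by (simp add: outer_unit_normal_def)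
      moreover obtain z where "y = m z" using \<open>y \<in> frontier M\<close> m_front by blast
      ultimately have "U z = U x" using nrm by auto
      then show "y \<in> range (\<lambda>k::int. m (x + 2 * pi * of_int k))" using iffD1[OF U_eq_iff] \<open>y = m z\<close> by blast
    qed
    then have "countable (closed_segment (m (x + 2 * pi)) (m x))"
      by (rule countable_subset) (rule countable_image, simp)
    then show False using uncountable_closed_segment ne by blast
  qed
  have "oval M m r"
  proof
    show "(m has_vector_derivative r s *\<^sub>R W s) (at s)" for s
    proof -
      have "(m has_vector_derivative inverse (\<omega> (\<tau> s)) *\<^sub>R v (\<tau> s)) (at s)"
        unfolding m_def[abs_def] using vector_diff_chain_at[of \<tau> "inverse (\<omega> (\<tau> s))" s \<gamma> "v (\<tau> s)"] dtau der_g
        by (simp add: o_def has_real_derivative_iff_has_vector_derivative)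
      moreover have "inverse (\<omega> (\<tau> s)) *\<^sub>R v (\<tau> s) = r s *\<^sub>R W s"
        by (subst th(2)) (simp add: r_alt tau divide_inverse mult.commute)
      ultimately show ?thesis by simp
    qed
    have ct: "continuous_on UNIV \<tau>" using cont_tau continuous_at_imp_continuous_on by blast
    have "continuous_on UNIV (\<lambda>t. norm (v t) / \<omega> t)"
      using omega_pos by (intro continuous_intros cont_v cont_omega) (metis less_irrefl)
    from continuous_on_compose2[OF this ct] show "continuous_on UNIV r" unfolding r_alt[abs_def] by simp
    show "0 < r s" for s using cross_pos[of "\<tau> s"] v_nz by (simp add: r_def)
    show "m (s + 2 * pi) = m s" for s by (rule m_per)
    show "r (s + 2 * pi) = r s" for s
    proof -
      have "\<gamma> (\<tau> (s + 2 * pi)) = \<gamma> (\<tau> s)" using m_per[of s] by (simp add: m_def)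
      then obtain k :: int where k: "\<tau> (s + 2 * pi) = \<tau> s + of_int k" using inj by blast
      have n: "v (x + real j) = v x \<and> a (x + real j) = a x" for x j
      proof (induction j)
        case (Suc j)
        then show ?case using v_per[of "x + real j"] a_per[of "x + real j"] by (simp add: algebra_simps)
      qed simp
      have "v (\<tau> (s + 2 * pi)) = v (\<tau> s) \<and> a (\<tau> (s + 2 * pi)) = a (\<tau> s)"
      proof (cases "k \<ge> 0")
        case True then show ?thesis using n[of "\<tau> s" "nat k"] k by simp
      next
        case False then show ?thesis using n[of "\<tau> (s + 2 * pi)" "nat (- k)"] k by simp
      qed
      then show ?thesis by (simp add: r_def)
    qed
    show "y \<in> M \<longleftrightarrow> (\<forall>\<theta>. U \<theta> \<bullet> (y - m \<theta>) \<le> 0)" for y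
    proof
      assume "y \<in> M"
      then show "\<forall>\<theta>. U \<theta> \<bullet> (y - m \<theta>) \<le> 0" using nrm by (auto simp: outer_unit_normal_def)
    next
      assume *: "\<forall>\<theta>. U \<theta> \<bullet> (y - m \<theta>) \<le> 0"
      show "y \<in> M"
      proof (rule ccontr)
        assume "y \<notin> M"
        then obtain z b where zb: "z \<bullet> y < b" "\<forall>x\<in>M. b < z \<bullet> x"
          using separating_hyperplane_closed_point[OF conv closed_M] by blast
        \<comment> \<open>The direction of separation is itself some \<open>U t\<close>, and the
          half-plane at \<open>m t\<close> already excludes \<open>y\<close>.\<close>
        obtain t where t: "- z = norm (- z) *\<^sub>R U t" using polar_real2 by metis
        have "(- z) \<bullet> (y - m t) > 0" using zb(1) zb(2)[rule_format, OF mM[of t]] by (simp add: inner_diff_right)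
        then have "norm (- z) * (U t \<bullet> (y - m t)) > 0" by (subst (asm) t) simp
        then have "U t \<bullet> (y - m t) > 0" by (simp add: zero_less_mult_iff)
        then show False using * by (metis not_less)
      qed
    qed
  qed
  moreover have "\<exists>t. m \<theta> = \<gamma> t \<and> r \<theta> = norm (v t) ^ 3 / (J (v t) \<bullet> a t)" for \<theta>
    unfolding m_def r_def by blast
  ultimately show ?thesis using that by blast
qed

end

text \<open>By continuity the interior point lies on the same side of all tangents. If it is the
  right side, the curve is traversed backwards, which changes the sign of the velocity but not the
  curvature.\<close>

theorem normal_parametrization:
  assumes M: "convex_disc M" and c2: "C2_plus_boundary M"
  obtains m r where "oval M m r" "\<And>\<theta>. boundary_curvature M (m \<theta>) = 1 / r \<theta>"
proof -
  obtain \<gamma> where g: "C2_boundary_param M \<gamma>" using c2 by (auto simp: C2_plus_boundary_def)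
  define v where "v t = vector_derivative \<gamma> (at t)" for t
  define a where "a t = vector_derivative v (at t)" for t
  interpret c2_curve M \<gamma> v a
    using C2_boundary_param_c2_curve[OF M g] unfolding v_def[abs_def] a_def[abs_def] .
  have curv: "boundary_curvature M (\<gamma> t) = \<bar>J (v t) \<bullet> a t\<bar> / norm (v t) ^ 3" for t
    unfolding boundary_curvature_eq[OF M g] curve_curvature_def Let_def
    by (simp add: v_def[abs_def] a_def[abs_def] inner_real2 algebra_simps)
  have nz: "J (v t) \<bullet> a t \<noteq> 0" for t
  proof -
    have "0 < boundary_curvature M (\<gamma> t)" using c2 front by (auto simp: C2_plus_boundary_def)
    then show ?thesis unfolding curv by auto
  qed
  obtain c where c: "c \<in> interior M" using int_ne by blast
  have cnz: "J (v t) \<bullet> (c - \<gamma> t) \<noteq> 0" for t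
  proof -
    have "\<gamma> t \<in> frontier M" using front by simp
    then obtain n where n: "outer_unit_normal M (\<gamma> t) n"
      using outer_unit_normal_exists[OF closed_M conv _ int_ne] by blast
    obtain s where s: "s = 1 \<or> s = - 1" "n = (s / norm (v t)) *\<^sub>R J (v t)"
      using orthogonal_real2[OF normal_orth(1)[OF n] v_nz] n by (auto simp: outer_unit_normal_def)
    have "n \<bullet> (c - \<gamma> t) < 0" by (rule outer_unit_normal_interior[OF n c])
    then show ?thesis unfolding s(2) by auto
  qed
  have cg: "continuous_on UNIV (\<lambda>t. J (v t) \<bullet> (c - \<gamma> t))"
    by (intro continuous_intros continuous_J cont_v cont_g)
  show ?thesis
  proof (cases "J (v 0) \<bullet> (c - \<gamma> 0) > 0")
    case True
    interpret p: c2_plus_curve M \<gamma> v a c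
    proof
      show "c \<in> interior M" by (rule c)
      show "J (v t) \<bullet> (c - \<gamma> t) > 0" for t by (rule const_sign[OF cg cnz True])
      show "v t $ 1 * a t $ 2 - v t $ 2 * a t $ 1 \<noteq> 0" for t
        using nz[of t] by (simp add: inner_real2 algebra_simps)
    qed
    obtain m r where mr: "oval M m r" "\<And>\<theta>. \<exists>t. m \<theta> = \<gamma> t \<and> r \<theta> = norm (v t) ^ 3 / (J (v t) \<bullet> a t)"
      using p.normal_param by blast
    moreover have "boundary_curvature M (m \<theta>) = 1 / r \<theta>" for \<theta>
    proof -
      obtain t where t: "m \<theta> = \<gamma> t" "r \<theta> = norm (v t) ^ 3 / (J (v t) \<bullet> a t)" using mr(2) by blast
      show ?thesis unfolding t curv using p.cross_pos[of t] by simp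
    qed
    ultimately show ?thesis using that by blast
  next
    case False
    then have neg: "- (J (v 0) \<bullet> (c - \<gamma> 0)) > 0" using cnz[of 0] by linarith
    have neg_t: "- (J (v t) \<bullet> (c - \<gamma> t)) > 0" for t
      by (rule const_sign[of "\<lambda>t. - (J (v t) \<bullet> (c - \<gamma> t))", OF _ _ neg]) (use cg cnz in \<open>auto intro: continuous_intros\<close>)
    interpret p: c2_plus_curve M "\<lambda>t. \<gamma> (- t)" "\<lambda>t. - v (- t)" "\<lambda>t. a (- t)" c
    proof
      have mn: "(uminus has_vector_derivative - 1) (at t)" for t :: real
        using has_vector_derivative_minus[OF has_vector_derivative_id] by simp
      show "((\<lambda>t. \<gamma> (- t)) has_vector_derivative - v (- t)) (at t)" for t
        using vector_diff_chain_at[OF mn der_g] by (simp add: o_def)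
      show "((\<lambda>t. - v (- t)) has_vector_derivative a (- t)) (at t)" for t
        using has_vector_derivative_minus[OF vector_diff_chain_at[OF mn der_v]] by (simp add: o_def)
      show "continuous_on UNIV (\<lambda>t. a (- t))"
        by (rule continuous_on_compose2[OF cont_a]) (auto intro: continuous_intros)
      show "- v (- t) \<noteq> 0" for t using v_nz by simp
      show "\<gamma> (- (t + 1)) = \<gamma> (- t)" for t using per[of "- t - 1"] by simp
      show "\<exists>k::int. s = t + of_int k" if eq: "\<gamma> (- s) = \<gamma> (- t)" for s t
      proof -
        obtain k :: int where "- s = - t + of_int k" using inj[OF eq] by blast
        then have "s = t + of_int (- k)" by simp
        then show ?thesis by blast
      qed
      show "frontier M = range (\<lambda>t. \<gamma> (- t))"
        unfolding front by (metis (no_types, lifting) image_cong minus_minus rangeE rangeI subsetI subset_antisym)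
      show "c \<in> interior M" by (rule c)
      show "J (- v (- t)) \<bullet> (c - \<gamma> (- t)) > 0" for t using neg_t[of "- t"] by (simp add: J_simps)
      show "(- v (- t)) $ 1 * a (- t) $ 2 - (- v (- t)) $ 2 * a (- t) $ 1 \<noteq> 0" for t
        using nz[of "- t"] by (simp add: inner_real2 algebra_simps)
    qed (fact conv comp int_ne)+
    obtain m r where mr: "oval M m r" "\<And>\<theta>. \<exists>t. m \<theta> = \<gamma> (- t) \<and> r \<theta> = norm (- v (- t)) ^ 3 / (J (- v (- t)) \<bullet> a (- t))"
      using p.normal_param by blast
    moreover have "boundary_curvature M (m \<theta>) = 1 / r \<theta>" for \<theta>
    proof -
      obtain t where t: "m \<theta> = \<gamma> (- t)" "r \<theta> = norm (- v (- t)) ^ 3 / (J (- v (- t)) \<bullet> a (- t))" using mr(2) by blast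
      show ?thesis unfolding t curv using p.cross_pos[of t] by (simp add: J_simps)
    qed
    ultimately show ?thesis using that by blast
  qed
qed

lemma (in oval) outer_unit_normal_iff: "outer_unit_normal M x (U t) \<longleftrightarrow> x = m t"
proof
  assume n: "outer_unit_normal M x (U t)"
  then have x: "x \<in> M" using closed_M by (auto simp: outer_unit_normal_def frontier_def)
  have "U t \<bullet> (m t - x) \<le> 0" "U t \<bullet> (x - m t) \<le> 0"
    using n x mem_iff[of x] m_in[of t] unfolding outer_unit_normal_def by blast+
  then show "x = m t" using eq_m[OF x] by (simp add: inner_diff_right)
next
  assume "x = m t"
  then show "outer_unit_normal M x (U t)"
    using frontier_eq mem_iff by (auto simp: outer_unit_normal_def)
qed

lemma (in oval) curvature_at_normal_eq:
  assumes "\<And>\<theta>. boundary_curvature M (m \<theta>) = 1 / r \<theta>"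
  shows "curvature_at_normal M (U t) = 1 / r t"
  by (simp add: curvature_at_normal_def outer_unit_normal_iff assms)

section \<open>Vertices and their successors\<close>

context oval begin

section \<open>Chords of an oval and rolling translates\<close>

lemma U_eq_iff_m: "U s = U t \<longleftrightarrow> m s = m t"
  unfolding U_eq_iff m_eq_iff ..

lemma support_increasing:
  assumes "b - pi \<le> s" "s < t" "t \<le> b"
  shows "U b \<bullet> m s < U b \<bullet> m t"
proof (rule DERIV_pos_imp_increasing_open[where f = "\<lambda>s. U b \<bullet> m s", OF assms(2)])
  fix x assume x: "s < x" "x < t"
  have "((\<lambda>s. U b \<bullet> m s) has_vector_derivative U b \<bullet> (r x *\<^sub>R W x)) (at x)"
    by (intro bounded_linear.has_vector_derivative[OF bounded_linear_inner_right] der)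
  then have "((\<lambda>s. U b \<bullet> m s) has_real_derivative r x * sin (b - x)) (at x)"
    by (simp add: has_real_derivative_iff_has_vector_derivative U_inner_W)
  moreover have "sin (b - x) > 0" using x assms by (intro sin_gt_zero) auto
  ultimately show "\<exists>y. ((\<lambda>s. U b \<bullet> m s) has_real_derivative y) (at x) \<and> 0 < y"
    using r_pos by fastforce
qed (auto intro!: continuous_intros cont_m)

text \<open>Sliding a chord of less than half a turn counterclockwise along the boundary, with its
  vector fixed, moves its far end out of \<open>M\<close>. The violated half-plane is the one at
  \<open>b\<close> while the start has not passed \<open>b\<close>, and the one at the new start
  afterwards.\<close>

lemma rotated_chord_outside:
  assumes "a < b" "b < a + pi" "a < a'" "a' \<le> a + pi"
  shows "m b - m a + m a' \<notin> M"
proof -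
  consider "a' \<le> b" | "b \<le> a'" by linarith
  then obtain \<theta> where "U \<theta> \<bullet> (m b - m a + m a' - m \<theta>) > 0"
  proof cases
    case 1
    then have "U b \<bullet> m a < U b \<bullet> m a'" using assms by (intro support_increasing) auto
    then show ?thesis using that[of b] by (simp add: inner_diff_right inner_add_right)
  next
    case 2
    then have "U a' \<bullet> m a < U a' \<bullet> m b" using assms by (intro support_increasing) auto
    then show ?thesis using that[of a'] by (simp add: inner_diff_right inner_add_right)
  qed
  then show ?thesis using mem_iff by (meson not_le)
qed

text \<open>Up to full turns the two starts are at most half a turn apart. If they differed, one
  chord would be the other one slid along the boundary, with its end outside.\<close>

lemma chord_unique:
  assumes "a < b" "b < a + pi" "a' < b'" "b' < a' + pi" and eq: "m b - m a = m b' - m a'"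
  shows "m a = m a' \<and> m b = m b'"
proof -
  obtain k where k: "a' + 2 * pi * of_int k \<in> {a - pi..<a - pi + 2 * pi}" using shift_into by blast
  define a2 b2 where "a2 = a' + 2 * pi * of_int k" and "b2 = b' + 2 * pi * of_int k"
  have m2: "m a2 = m a'" "m b2 = m b'" unfolding a2_def b2_def by simp_all
  have ab: "a2 < b2" "b2 < a2 + pi" using assms by (auto simp: a2_def b2_def)
  have "\<not> a < a2"
    using rotated_chord_outside[of a b a2] assms(1,2) k m_in[of b2] eq m2 by (auto simp: a2_def)
  moreover have "\<not> a2 < a"
    using rotated_chord_outside[OF ab, of a] k m_in[of b] eq[symmetric] m2 by (auto simp: a2_def)
  ultimately have "a2 = a" by linarith
  then show ?thesis using eq m2 by auto
qed

text \<open>The chord joins the two parallel tangents with normals \<open>U a\<close> and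
  \<open>- U a\<close>. A start strictly behind the first tangent pushes the end beyond the
  second.\<close>

lemma antipodal_chord:
  assumes "m (a + pi) - m a + m a' \<in> M" shows "m a' = m a"
proof (rule ccontr)
  assume ne: "m a' \<noteq> m a"
  obtain k where k: "a' + 2 * pi * of_int k \<in> {a..<a + 2 * pi}" using shift_into by blast
  have "a' + 2 * pi * of_int k \<noteq> a" using ne m_int[of a' k] by metis
  then have "U a \<bullet> (m (a' + 2 * pi * of_int k) - m a) < 0" using k by (intro strict) auto
  moreover have "U (a + pi) = - U a" by (simp add: vec_eq_iff forall_2)
  moreover have "U (a + pi) \<bullet> (m (a + pi) - m a + m a' - m (a + pi)) \<le> 0" using assms mem_iff by blast
  ultimately show False by (simp add: inner_diff_right inner_add_right)
qed

text \<open>A point leaving \<open>m b\<close> with inward velocity enters the disc that touches the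
  boundary from inside at \<open>m b\<close>, since the first order term beats the quadratic
  one.\<close>

lemma eventually_pushed_inside:
  assumes w: "((\<lambda>s. (f s - m b) /\<^sub>R s) \<longlongrightarrow> w) (at_right 0)" and neg: "U b \<bullet> w < 0"
  shows "\<forall>\<^sub>F s in at_right 0. f s \<in> M"
proof -
  obtain c where c: "0 < c" "\<And>s. c \<le> r s" by (rule r_lower) blast
  define q where "q s = (f s - m b) /\<^sub>R s" for s
  have "((\<lambda>s. s * (norm (q s))\<^sup>2 + 2 * c * (U b \<bullet> q s)) \<longlongrightarrow> 0 * (norm w)\<^sup>2 + 2 * c * (U b \<bullet> w)) (at_right 0)"
    using w unfolding q_def[symmetric] by (intro tendsto_intros)
  moreover have "0 * (norm w)\<^sup>2 + 2 * c * (U b \<bullet> w) < 0" using neg c by (simp add: mult_pos_neg)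
  ultimately have "\<forall>\<^sub>F s in at_right 0. s * (norm (q s))\<^sup>2 + 2 * c * (U b \<bullet> q s) < 0"
    using order_tendstoD(2) by blast
  moreover have "\<forall>\<^sub>F s in at_right (0::real). s > 0" by (simp add: eventually_at_right_less)
  ultimately show ?thesis
  proof eventually_elim
    case (elim s)
    have e: "f s - (m b - c *\<^sub>R U b) = s *\<^sub>R q s + c *\<^sub>R U b" using elim by (simp add: q_def)
    have "(norm (s *\<^sub>R q s + c *\<^sub>R U b))\<^sup>2 = c\<^sup>2 + s * (s * (norm (q s))\<^sup>2 + 2 * c * (U b \<bullet> q s))"
      unfolding power2_norm_eq_inner
      by (simp add: inner_add_left inner_add_right U_inner_U inner_commute power2_eq_square algebra_simps)
    also have "\<dots> \<le> c\<^sup>2" using elim by (simp add: mult_nonneg_nonpos)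
    finally have "norm (f s - (m b - c *\<^sub>R U b)) \<le> c" unfolding e using c by (simp add: power2_le_iff_abs_le)
    then show ?case using inner_ball c by blast
  qed
qed

text \<open>The velocity of any point relative to a translate that rolls through a fixed boundary
  point; \<sigma> is the sense of rolling. \<open>y\<close> is added and subtracted to match the
  difference quotient in \<open>eventually_pushed_inside\<close>.\<close>

lemma rotation_quotient:
  assumes "\<sigma> = 1 \<or> \<sigma> = -1"
  shows "((\<lambda>s. (y + (m (a + \<sigma> * s) - m a) - y) /\<^sub>R s) \<longlongrightarrow> (\<sigma> * r a) *\<^sub>R W a) (at_right 0)"
proof -
  have "((\<lambda>s. a + \<sigma> * s) has_vector_derivative \<sigma>) (at 0)"
    unfolding has_real_derivative_iff_has_vector_derivative[symmetric] by (auto intro!: derivative_eq_intros)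
  from vector_diff_chain_at[OF this, of m "r a *\<^sub>R W a"] der[of a]
  have "((\<lambda>s. m (a + \<sigma> * s)) has_vector_derivative \<sigma> *\<^sub>R r a *\<^sub>R W a) (at 0 within {0<..})"
    by (simp add: o_def has_vector_derivative_at_within)
  then have "((\<lambda>s. norm (m (a + \<sigma> * s) - m a - s *\<^sub>R \<sigma> *\<^sub>R r a *\<^sub>R W a) / norm s) \<longlongrightarrow> 0) (at_right 0)"
    by (simp add: has_vector_derivative_def has_derivative_iff_norm)
  moreover have "\<forall>\<^sub>F s in at_right 0. norm (m (a + \<sigma> * s) - m a - s *\<^sub>R \<sigma> *\<^sub>R r a *\<^sub>R W a) / norm s
    = norm ((m (a + \<sigma> * s) - m a) /\<^sub>R s - (\<sigma> * r a) *\<^sub>R W a)"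
    using eventually_at_right_less[of 0]
  proof eventually_elim
    case (elim s)
    then have "(m (a + \<sigma> * s) - m a) /\<^sub>R s - (\<sigma> * r a) *\<^sub>R W a
      = (m (a + \<sigma> * s) - m a - s *\<^sub>R \<sigma> *\<^sub>R r a *\<^sub>R W a) /\<^sub>R s"
      by (simp add: scaleR_right_diff_distrib)
    then show ?case by (simp add: divide_inverse_commute)
  qed
  ultimately have "((\<lambda>s. norm ((m (a + \<sigma> * s) - m a) /\<^sub>R s - (\<sigma> * r a) *\<^sub>R W a)) \<longlongrightarrow> 0) (at_right 0)"
    by (rule Lim_transform_eventually)
  then have "((\<lambda>s. (m (a + \<sigma> * s) - m a) /\<^sub>R s) \<longlongrightarrow> (\<sigma> * r a) *\<^sub>R W a) (at_right 0)"
    unfolding Lim_null[of _ "(\<sigma> * r a) *\<^sub>R W a"] by (rule tendsto_norm_zero_cancel)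
  then show ?thesis by simp
qed

text \<open>The translate \<^term>\<open>(+) (x - m a) ` M\<close> has \<^term>\<open>x\<close> on its boundary, with outer normal
  \<^term>\<open>U a\<close>; \<open>allowed X x a\<close> says that it contains \<^term>\<open>X\<close>, and \<open>succ X x y\<close> that
  \<^term>\<open>y\<close> lies on its boundary counterclockwise from \<^term>\<open>x\<close>.\<close>

definition allowed :: "(real^2) set \<Rightarrow> real^2 \<Rightarrow> real \<Rightarrow> bool" where
  "allowed X x a \<longleftrightarrow> (\<forall>z\<in>X. z - x + m a \<in> M)"

definition succ :: "(real^2) set \<Rightarrow> real^2 \<Rightarrow> real^2 \<Rightarrow> bool" where
  "succ X x y \<longleftrightarrow> (\<exists>a b. a < b \<and> b < a + pi \<and> y - x = m b - m a \<and> allowed X x a)"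

definition vertex :: "(real^2) set \<Rightarrow> real^2 \<Rightarrow> bool" where
  "vertex X x \<longleftrightarrow> (\<exists>a a'. m a \<noteq> m a' \<and> allowed X x a \<and> allowed X x a')"

text \<open>The degenerate position: a third point, anywhere on the boundary of the translate that
  the chord from \<open>x\<close> to \<open>y\<close> determines.\<close>

definition cocircular :: "real^2 \<Rightarrow> real^2 \<Rightarrow> real^2 \<Rightarrow> bool" where
  "cocircular x y z \<longleftrightarrow> (\<exists>a b c. a < b \<and> b < a + pi \<and> y - x = m b - m a \<and> z - x = m c - m a)"

section \<open>Vertices as contact points of several translates\<close>

lemma L_hull_eq: "L_hull M X = {y. \<forall>t. (\<forall>z\<in>X. z - t \<in> M) \<longrightarrow> y - t \<in> M}"
proof -
  have e: "(+) t ` M = {y. y - t \<in> M}" for t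
    by (auto simp: image_iff) (metis add.commute diff_add_cancel)
  show ?thesis unfolding L_hull_def by (auto simp: e subset_iff)
qed

lemma allowed_normal:
  assumes "x \<in> X" "allowed X x a"
  shows "outer_unit_normal (L_hull M X) x (U a)"
proof -
  have le: "U a \<bullet> (y - x) \<le> 0" if "y \<in> L_hull M X" for y
  proof -
    have "\<forall>z\<in>X. z - (x - m a) \<in> M"
      using assms(2) by (simp add: allowed_def algebra_simps)
    then have "y - (x - m a) \<in> M" using that unfolding L_hull_eq by blast
    then have "U a \<bullet> (y - (x - m a) - m a) \<le> 0" using mem_iff by blast
    then show ?thesis by (simp add: algebra_simps)
  qed
  have xH: "x \<in> L_hull M X" using assms(1) by (auto simp: L_hull_eq)
  have "x \<notin> interior (L_hull M X)"
  proof
    assume "x \<in> interior (L_hull M X)"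
    then obtain e where e: "e > 0" "cball x e \<subseteq> L_hull M X" using mem_interior_cball by blast
    then have "x + e *\<^sub>R U a \<in> L_hull M X" by (auto simp: subset_iff dist_norm)
    from le[OF this] show False using e by (simp add: U_inner_U)
  qed
  then have "x \<in> frontier (L_hull M X)" using xH closure_subset by (auto simp: frontier_def)
  then show ?thesis using le by (auto simp: outer_unit_normal_def)
qed

text \<open>Each \<open>p n\<close> is cut off by a translate containing \<open>X\<close> together
  with one of its half-planes. Position and normal angle range over a compact set, and a limit of
  them is a translate that contains \<open>X\<close> and touches \<open>x\<close>. If the points
  approach along a ray, the limiting normal does not point away from it.\<close>

lemma exit_direction:
  assumes x: "x \<in> X" and lim: "p \<longlonglongrightarrow> x" and out: "\<And>n. p n \<notin> L_hull M X"
  obtains \<theta> where "allowed X x \<theta>"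
    "\<And>w \<delta>. (\<And>n. \<delta> n > 0 \<and> p n = x + \<delta> n *\<^sub>R w) \<Longrightarrow> 0 \<le> U \<theta> \<bullet> w"
proof -
  have "\<exists>t \<theta>. \<theta> \<in> {0..2*pi} \<and> (\<forall>z\<in>X. z - t \<in> M) \<and> U \<theta> \<bullet> (p n - t - m \<theta>) > 0" for n
  proof -
    obtain t where t: "\<forall>z\<in>X. z - t \<in> M" "p n - t \<notin> M" using out[of n] by (auto simp: L_hull_eq)
    then obtain \<theta> where th: "\<bar>\<theta> - pi\<bar> \<le> pi" "\<not> U \<theta> \<bullet> (p n - t - m \<theta>) \<le> 0" using mem_local[of _ pi] by blast
    then have "\<theta> \<in> {0..2*pi}" by auto
    then show ?thesis using t th by (meson not_le)
  qed
  then obtain t \<theta> where th: "\<And>n. \<theta> n \<in> {0..2*pi}" "\<And>n z. z \<in> X \<Longrightarrow> z - t n \<in> M"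
    "\<And>n. U (\<theta> n) \<bullet> (p n - t n - m (\<theta> n)) > 0" by metis
  define q where "q n = (x - t n, \<theta> n)" for n
  have "compact (M \<times> {0..2*pi})" using compact_M by (intro compact_Times) auto
  moreover have "\<forall>n. q n \<in> M \<times> {0..2*pi}" using th(1,2) x by (auto simp: q_def)
  ultimately obtain l \<rho> where l: "l \<in> M \<times> {0..2*pi}" "strict_mono \<rho>" "(q \<circ> \<rho>) \<longlonglongrightarrow> l"
    unfolding compact_def by metis
  obtain y \<theta>' where l': "l = (y, \<theta>')" by force
  have ly: "(\<lambda>n. x - t (\<rho> n)) \<longlonglongrightarrow> y" and lth: "(\<lambda>n. \<theta> (\<rho> n)) \<longlonglongrightarrow> \<theta>'"
    using tendsto_fst[OF l(3)] tendsto_snd[OF l(3)] by (auto simp: q_def o_def l')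
  have lp: "(\<lambda>n. p (\<rho> n)) \<longlonglongrightarrow> x" using LIMSEQ_subseq_LIMSEQ[OF lim l(2)] by (simp add: o_def)
  have lU: "(\<lambda>n. U (\<theta> (\<rho> n))) \<longlonglongrightarrow> U \<theta>'" and lm: "(\<lambda>n. m (\<theta> (\<rho> n))) \<longlonglongrightarrow> m \<theta>'"
    by (rule continuous_on_tendsto_compose[OF continuous_U[of UNIV] lth] continuous_on_tendsto_compose[OF cont_m[of UNIV] lth]; simp)+
  have "(\<lambda>n. U (\<theta> (\<rho> n)) \<bullet> ((p (\<rho> n) - x) + (x - t (\<rho> n)) - m (\<theta> (\<rho> n)))) \<longlonglongrightarrow> U \<theta>' \<bullet> ((x - x) + y - m \<theta>')"
    by (intro tendsto_intros lU lm lp ly)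
  moreover have "0 \<le> U (\<theta> (\<rho> n)) \<bullet> ((p (\<rho> n) - x) + (x - t (\<rho> n)) - m (\<theta> (\<rho> n)))" for n
    using th(3)[of "\<rho> n"] by (simp add: algebra_simps)
  ultimately have "0 \<le> U \<theta>' \<bullet> ((x - x) + y - m \<theta>')"
    by (intro LIMSEQ_le_const) auto
  moreover have yM: "y \<in> M" using l(1) l' by simp
  \<comment> \<open>The limit belongs to \<open>M\<close>, so it also satisfies the opposite
    inequality; \<open>eq_m\<close> then identifies it with the contact point.\<close>
  ultimately have y: "y = m \<theta>'" using eq_m[OF yM, of \<theta>'] mem_iff[of y] by (simp add: antisym)
  have "allowed X x \<theta>'"
    unfolding allowed_def
  proof
    fix z assume "z \<in> X"
    then have "(z - x) + (x - t (\<rho> n)) \<in> M" for n using th(2) by simp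
    moreover have "(\<lambda>n. (z - x) + (x - t (\<rho> n))) \<longlonglongrightarrow> (z - x) + y" by (intro tendsto_intros ly)
    ultimately show "z - x + m \<theta>' \<in> M" unfolding y[symmetric] by (rule closed_sequentially[OF closed_M])
  qed
  moreover have "0 \<le> U \<theta>' \<bullet> w" if w: "\<And>n. \<delta> n > 0 \<and> p n = x + \<delta> n *\<^sub>R w" for w \<delta>
  proof -
    have "0 \<le> U (\<theta> n) \<bullet> w" for n
    proof -
      have "U (\<theta> n) \<bullet> (x - t n - m (\<theta> n)) \<le> 0" using th(2)[OF x, of n] mem_iff by blast
      moreover have "U (\<theta> n) \<bullet> (x + \<delta> n *\<^sub>R w - t n - m (\<theta> n)) > 0" using th(3)[of n] w[of n] by simp
      ultimately have "0 < \<delta> n * (U (\<theta> n) \<bullet> w)" by (simp add: inner_diff_right inner_add_right)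
      then show ?thesis using w[of n] by (simp add: zero_less_mult_iff)
    qed
    moreover have "(\<lambda>n. U (\<theta> (\<rho> n)) \<bullet> w) \<longlonglongrightarrow> U \<theta>' \<bullet> w" by (intro tendsto_intros lU)
    ultimately show ?thesis by (intro LIMSEQ_le_const) auto
  qed
  ultimately show ?thesis using that by blast
qed

text \<open>A second touching translate gives a second normal of the hull at once. Conversely the
  second normal need not come from a translate, so a suitable direction of exit is used to produce a
  translate different from the first.\<close>

lemma vertex_iff:
  assumes x: "x \<in> X"
  shows "x \<in> frontier (L_hull M X) \<and> \<not> smooth_boundary_point (L_hull M X) x \<longleftrightarrow> vertex X x"
proof
  assume "vertex X x"
  then obtain a a' where a: "m a \<noteq> m a'" "allowed X x a" "allowed X x a'" by (auto simp: vertex_def)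
  have "U a \<noteq> U a'" using a(1) U_eq_iff_m by simp
  moreover have n: "outer_unit_normal (L_hull M X) x (U a)" "outer_unit_normal (L_hull M X) x (U a')"
    using allowed_normal x a by blast+
  ultimately show "x \<in> frontier (L_hull M X) \<and> \<not> smooth_boundary_point (L_hull M X) x"
    unfolding smooth_boundary_point_def by (metis outer_unit_normal_def)
next
  assume *: "x \<in> frontier (L_hull M X) \<and> \<not> smooth_boundary_point (L_hull M X) x"
  then have "x \<notin> interior (L_hull M X)" by (auto simp: frontier_def)
  then have "\<not> ball x (inverse (real (Suc n))) \<subseteq> L_hull M X" for n
    unfolding mem_interior by (meson inverse_positive_iff_positive of_nat_0_less_iff zero_less_Suc)
  then obtain p where p: "\<And>n. p n \<notin> L_hull M X" "\<And>n. dist x (p n) < inverse (real (Suc n))"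
    by (simp add: subset_iff) metis
  have "p \<longlonglongrightarrow> x"
  proof (rule metric_tendsto_imp_tendsto[OF LIMSEQ_inverse_real_of_nat])
    show "\<forall>\<^sub>F n in sequentially. dist (p n) x \<le> dist (inverse (real (Suc n))) 0"
      using p(2) by (intro always_eventually allI) (simp add: dist_commute less_imp_le)
  qed
  from exit_direction[OF x this p(1)] obtain a where a: "allowed X x a" by blast
  have na: "outer_unit_normal (L_hull M X) x (U a)" by (rule allowed_normal[OF x a])
  then obtain v where v: "outer_unit_normal (L_hull M X) x v" "v \<noteq> U a"
    using * unfolding smooth_boundary_point_def by blast
  \<comment> \<open>Along \<open>w\<close> the functional of \<open>v\<close> increases, so the ray
    leaves the hull at once, while that of \<open>U a\<close> decreases, so the translate found is a
    new one.\<close>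
  define w where "w = v - U a"
  have nv: "v \<bullet> v = 1" "U a \<bullet> U a = 1" using v by (auto simp: outer_unit_normal_def norm_eq_1 U_inner_U)
  have "w \<bullet> w > 0" using v by (simp add: w_def)
  then have c: "v \<bullet> U a < 1" by (simp add: w_def inner_diff_left inner_diff_right nv inner_commute)
  define \<delta> where "\<delta> n = inverse (real (Suc n))" for n
  have "(\<lambda>n. x + \<delta> n *\<^sub>R w) \<longlonglongrightarrow> x + 0 *\<^sub>R w"
    unfolding \<delta>_def by (intro tendsto_intros LIMSEQ_inverse_real_of_nat)
  then have l: "(\<lambda>n. x + \<delta> n *\<^sub>R w) \<longlonglongrightarrow> x" by simp
  have out: "x + \<delta> n *\<^sub>R w \<notin> L_hull M X" for n
  proof
    assume "x + \<delta> n *\<^sub>R w \<in> L_hull M X"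
    then have "v \<bullet> (x + \<delta> n *\<^sub>R w - x) \<le> 0" using v by (auto simp: outer_unit_normal_def)
    then have "\<delta> n * (1 - v \<bullet> U a) \<le> 0" by (simp add: w_def inner_diff_right nv)
    moreover have "0 < \<delta> n * (1 - v \<bullet> U a)" using c by (simp add: \<delta>_def)
    ultimately show False by simp
  qed
  obtain \<theta> where th: "allowed X x \<theta>"
    "\<And>w' \<delta>'. (\<And>n. \<delta>' n > 0 \<and> x + \<delta> n *\<^sub>R w = x + \<delta>' n *\<^sub>R w') \<Longrightarrow> 0 \<le> U \<theta> \<bullet> w'"
    using exit_direction[OF x l out] by metis
  have "0 \<le> U \<theta> \<bullet> w" by (rule th(2)[of \<delta>]) (simp add: \<delta>_def)
  moreover have "U a \<bullet> w < 0" using c by (simp add: w_def inner_diff_right nv inner_commute)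
  ultimately have "U \<theta> \<noteq> U a" by auto
  then show "vertex X x" using U_eq_iff_m th a by (auto simp: vertex_def)
qed

text \<open>A translate can be rolled slightly about \<open>x\<close>: the point \<open>x\<close>
  stays on it, interior points stay inside, and a contact at angle \<open>b\<close> moves relative
  to it with normal velocity of the sign of \<open>\<sigma> * sin (b - a)\<close>.\<close>

lemma allowed_eventually:
  assumes fin: "finite X" and s: "\<sigma> = 1 \<or> \<sigma> = -1"
    and cases: "\<And>z. z \<in> X \<Longrightarrow> z = x \<or> z - x + m a \<in> interior M \<or>
      (\<exists>b. z - x + m a = m b \<and> \<sigma> * sin (b - a) < 0)"
  shows "\<forall>\<^sub>F s in at_right 0. allowed X x (a + \<sigma> * s)"
  unfolding allowed_def
proof (rule eventually_ball_finite[OF fin], intro ballI)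
  fix z assume z: "z \<in> X"
  show "\<forall>\<^sub>F s in at_right 0. z - x + m (a + \<sigma> * s) \<in> M"
    using cases[OF z]
  proof (elim disjE exE conjE)
    assume "z = x" then show ?thesis by simp
  next
    assume i: "z - x + m a \<in> interior M"
    have "((\<lambda>s. z - x + m (a + \<sigma> * s)) \<longlongrightarrow> z - x + m (a + \<sigma> * 0)) (at_right 0)"
      by (intro tendsto_intros continuous_on_tendsto_compose[OF cont_m[of UNIV]]) auto
    then have "\<forall>\<^sub>F s in at_right 0. z - x + m (a + \<sigma> * s) \<in> interior M"
      using i by (intro topological_tendstoD) auto
    then show ?thesis by (rule eventually_mono) (use interior_subset in blast)
  next
    fix b assume b: "z - x + m a = m b" "\<sigma> * sin (b - a) < 0"
    have e: "m b + (m (a + \<sigma> * s) - m a) = z - x + m (a + \<sigma> * s)" for s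
      unfolding b(1)[symmetric] by simp
    have "\<forall>\<^sub>F s in at_right 0. m b + (m (a + \<sigma> * s) - m a) \<in> M"
    proof (rule eventually_pushed_inside[OF rotation_quotient[OF s]])
      have "0 < r a * (- (\<sigma> * sin (b - a)))" using b(2) r_pos by (intro mult_pos_pos) auto
      then show "U b \<bullet> ((\<sigma> * r a) *\<^sub>R W a) < 0" by (simp add: U_inner_W algebra_simps)
    qed
    then show ?thesis unfolding e .
  qed
qed

lemma closed_allowed: "closed {a. allowed X x a}"
proof -
  have "closed ((\<lambda>a. z - x + m a) -` M)" for z
    by (intro continuous_closed_vimage closed_M continuous_intros)
      (use cont_m[of UNIV] continuous_on_eq_continuous_at in blast)
  then have "closed (\<Inter>z\<in>X. (\<lambda>a. z - x + m a) -` M)" by blast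
  moreover have "(\<Inter>z\<in>X. (\<lambda>a. z - x + m a) -` M) = {a. allowed X x a}" by (auto simp: allowed_def)
  ultimately show ?thesis by simp
qed

section \<open>The successor of a vertex\<close>

text \<open>The translate is rolled counterclockwise about \<open>x\<close> as far as possible. If
  no contact lay within the next half turn, all other contacts would be pushed inside and the
  rolling could go on.\<close>

lemma vertex_has_succ:
  assumes fin: "finite X" and x: "x \<in> X" and y0: "y0 \<in> X" "y0 \<noteq> x" and v: "vertex X x"
  obtains y where "y \<in> X" "succ X x y"
proof (rule ccontr)
  note found = that
  assume nt: "\<not> thesis"
  have no: "\<not> succ X x y" if "y \<in> X" for y using found[OF that] nt by blast
  obtain a1 a2 where a12: "m a1 \<noteq> m a2" "allowed X x a1" "allowed X x a2" using v by (auto simp: vertex_def)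
  \<comment> \<open>A translate whose normal at \<open>x\<close> points to another sample point
    cannot contain that point; thus \<alpha> is a barrier and a last allowed angle before it
    exists.\<close>
  obtain \<alpha> where al: "\<alpha> \<in> {a1..<a1 + 2 * pi}" "y0 - x = norm (y0 - x) *\<^sub>R U \<alpha>" using polar_real2 by metis
  have na: "\<not> allowed X x \<alpha>"
  proof
    assume "allowed X x \<alpha>"
    then have "y0 - x + m \<alpha> \<in> M" using y0 by (auto simp: allowed_def)
    then have "U \<alpha> \<bullet> (y0 - x + m \<alpha> - m \<alpha>) \<le> 0" unfolding mem_iff by blast
    then have "U \<alpha> \<bullet> (y0 - x) \<le> 0" by simp
    then have "norm (y0 - x) \<le> 0" by (subst (asm) al(2)) (simp add: U_inner_U)
    then show False using y0 by simp
  qed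
  have "compact ({a. allowed X x a} \<inter> {a1..\<alpha>})"
    using closed_allowed compact_Icc by (metis Int_commute compact_Int_closed)
  moreover have "a1 \<in> {a. allowed X x a} \<inter> {a1..\<alpha>}" using a12 al by auto
  ultimately obtain a0 where a0: "a0 \<in> {a. allowed X x a} \<inter> {a1..\<alpha>}"
    "\<And>a. a \<in> {a. allowed X x a} \<inter> {a1..\<alpha>} \<Longrightarrow> a \<le> a0"
    using compact_attains_sup by (metis empty_iff)
  have lt: "a0 < \<alpha>" using a0 na by (metis IntD1 IntD2 atLeastAtMost_iff mem_Collect_eq order_le_less)
  have al0: "allowed X x a0" using a0 by blast
  have "\<forall>\<^sub>F s in at_right 0. allowed X x (a0 + 1 * s)"
  proof (rule allowed_eventually[OF fin])
    fix z assume z: "z \<in> X"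
    show "z = x \<or> z - x + m a0 \<in> interior M \<or> (\<exists>b. z - x + m a0 = m b \<and> 1 * sin (b - a0) < 0)"
    proof (cases "z - x + m a0 \<in> range m")
      case False
      then show ?thesis using al0 z interior_if by (auto simp: allowed_def)
    next
      case True
      then obtain b0 where b0: "z - x + m a0 = m b0" by blast
      obtain k where k: "b0 + 2 * pi * of_int k \<in> {a0..<a0 + 2 * pi}" using shift_into by blast
      define b where "b = b0 + 2 * pi * of_int k"
      have b: "z - x + m a0 = m b" "a0 \<le> b" "b < a0 + 2 * pi" using b0 k by (auto simp: b_def)
      consider "b = a0" | "a0 < b" "b < a0 + pi" | "b = a0 + pi" | "a0 + pi < b" using b by linarith
      then show ?thesis
      proof cases
        case 1 then show ?thesis using b by simp
      next
        case 2
        then have "succ X x z" using b al0 unfolding succ_def by (metis add_diff_cancel_right')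
        then show ?thesis using no z by blast
      next
        \<comment> \<open>A contact exactly half a turn away pins the translate by
          \<open>antipodal_chord\<close>, contrary to the two different positions that
          \<open>vertex\<close> provides.\<close>
        case 3
        have e: "z - x = m (a0 + pi) - m a0" using b(1) 3 by (metis add_diff_cancel_right')
        have "m a1 = m a0" "m a2 = m a0"
          using a12(2,3) z unfolding allowed_def e[symmetric] by (auto intro!: antipodal_chord simp: e[symmetric])
        then show ?thesis using a12 by simp
      next
        case 4
        have "sin (b - a0 - pi) > 0" using 4 b by (intro sin_gt_zero) auto
        then have "sin (b - a0) < 0" by (simp add: sin_diff)
        then show ?thesis using b by auto
      qed
    qed
  qed simp
  moreover have "\<forall>\<^sub>F s in at_right 0. s < \<alpha> - a0 \<and> s > 0"
    using lt by (auto simp: eventually_at_right_field intro!: exI[of _ "\<alpha> - a0"])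
  ultimately have "\<forall>\<^sub>F s in at_right (0::real). False"
  proof eventually_elim
    case (elim s)
    then have "a0 + s \<in> {a. allowed X x a} \<inter> {a1..\<alpha>}" using a0(1) by auto
    from a0(2)[OF this] elim show False by simp
  qed
  then show False by simp
qed

lemma succ_ne: assumes "succ X x y" shows "x \<noteq> y"
proof
  assume "x = y"
  then obtain a b where "a < b" "b < a + pi" "m b = m a" using assms by (auto simp: succ_def)
  moreover then have "U a \<bullet> (m b - m a) < 0" by (intro strict) auto
  ultimately show False by simp
qed

text \<open>If the two touching translates differed, one chord would be slid counterclockwise
  relative to the other, and an end point in \<open>X\<close> would lie outside. So both successors
  lie on the boundary of one translate.\<close>

lemma succ_unique:
  assumes "succ X x y" "succ X x y'" "y \<in> X" "y' \<in> X"
  shows "cocircular x y y'"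
proof -
  obtain a b where ab: "a < b" "b < a + pi" "y - x = m b - m a" "allowed X x a" using assms by (auto simp: succ_def)
  obtain a' b' where ab': "a' < b'" "b' < a' + pi" "y' - x = m b' - m a'" "allowed X x a'" using assms by (auto simp: succ_def)
  obtain k where k: "a' + 2 * pi * of_int k \<in> {a - pi..<a - pi + 2 * pi}" using shift_into by blast
  define a2 b2 where "a2 = a' + 2 * pi * of_int k" and "b2 = b' + 2 * pi * of_int k"
  have m2: "m a2 = m a'" "m b2 = m b'" unfolding a2_def b2_def by simp_all
  have ab2: "a2 < b2" "b2 < a2 + pi" using ab' by (auto simp: a2_def b2_def)
  have "m b - m a + m a2 \<in> M" using ab'(4) assms(3) unfolding allowed_def ab(3)[symmetric] m2 by blast
  then have "\<not> a < a2" using rotated_chord_outside[OF ab(1,2), of a2] k by (auto simp: a2_def)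
  moreover have "m b2 - m a2 + m a \<in> M" using ab(4) assms(4) unfolding allowed_def m2 ab'(3)[symmetric] by blast
  then have "\<not> a2 < a" using rotated_chord_outside[OF ab2, of a] k by (auto simp: a2_def)
  ultimately have "a2 = a" by linarith
  then have "y' - x = m b' - m a" using ab' m2 by simp
  then show ?thesis using ab unfolding cocircular_def by blast
qed

text \<open>Rolling backwards pushes the contact at \<open>y\<close> inside; by genericity there is
  no further contact except \<open>x\<close>, so a second touching translate appears.\<close>

lemma succ_vertex:
  assumes fin: "finite X" and y: "y \<in> X" and s: "succ X x y"
    and gen: "\<And>z. z \<in> X \<Longrightarrow> z \<noteq> x \<Longrightarrow> z \<noteq> y \<Longrightarrow> \<not> cocircular x y z"
  shows "vertex X x"
proof -
  obtain a b where ab: "a < b" "b < a + pi" "y - x = m b - m a" "allowed X x a" using s by (auto simp: succ_def)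
  have "\<forall>\<^sub>F s in at_right 0. allowed X x (a + (- 1) * s)"
  proof (rule allowed_eventually[OF fin])
    fix z assume z: "z \<in> X"
    consider "z = x" | "z = y" | "z \<noteq> x" "z \<noteq> y" by blast
    then show "z = x \<or> z - x + m a \<in> interior M \<or> (\<exists>b. z - x + m a = m b \<and> (- 1) * sin (b - a) < 0)"
    proof cases
      case 2
      have "sin (b - a) > 0" using ab by (intro sin_gt_zero) auto
      then show ?thesis using 2 ab by auto
    next
      case 3
      have "z - x + m a \<notin> range m"
      proof
        assume "z - x + m a \<in> range m"
        then obtain c where "z - x = m c - m a" by (metis add_diff_cancel_right' rangeE)
        then show False using gen[OF z 3] ab unfolding cocircular_def by blast
      qed
      then show ?thesis using ab(4) z interior_if by (auto simp: allowed_def)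
    qed simp
  qed simp
  moreover have "\<forall>\<^sub>F s in at_right (0::real). s < pi \<and> s > 0"
    by (auto simp: eventually_at_right_field intro!: exI[of _ pi])
  ultimately have "\<forall>\<^sub>F s in at_right (0::real). s < pi \<and> s > 0 \<and> allowed X x (a - s)"
    by eventually_elim auto
  then obtain s where s: "s < pi" "s > 0" "allowed X x (a - s)"
    using eventually_happens[of _ "at_right (0::real)"] by fastforce
  have "U a \<bullet> (m (a - s) - m a) < 0" using s by (intro strict) auto
  then have "m (a - s) \<noteq> m a" by auto
  then show ?thesis using s ab by (auto simp: vertex_def)
qed

text \<open>The first projection is a bijection from the pairs onto the vertices. A single point
  would be a vertex without successor, hence the bound on the cardinality.\<close>

lemma card_vertices:
  assumes fin: "finite X" and two: "card X \<ge> 2"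
    and gen: "\<And>x y z. x \<in> X \<Longrightarrow> y \<in> X \<Longrightarrow> z \<in> X \<Longrightarrow> z \<noteq> x \<Longrightarrow> z \<noteq> y \<Longrightarrow> x \<noteq> y \<Longrightarrow> \<not> cocircular x y z"
  shows "f0 M X = card {(x, y). x \<in> X \<and> y \<in> X \<and> succ X x y}"
proof -
  have 1: "L_polygon_vertices M X = {x \<in> X. vertex X x}"
    unfolding L_polygon_vertices_def using vertex_iff by auto
  have 2: "fst ` {(x, y). x \<in> X \<and> y \<in> X \<and> succ X x y} = {x \<in> X. vertex X x}"
  proof (intro equalityI subsetI)
    fix x assume "x \<in> fst ` {(x, y). x \<in> X \<and> y \<in> X \<and> succ X x y}"
    then obtain y where y: "x \<in> X" "y \<in> X" "succ X x y" by auto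
    have "vertex X x" by (rule succ_vertex[OF fin y(2,3)]) (use gen y succ_ne in blast)
    then show "x \<in> {x \<in> X. vertex X x}" using y by blast
  next
    fix x assume "x \<in> {x \<in> X. vertex X x}"
    then have x: "x \<in> X" "vertex X x" by auto
    have "X \<noteq> {x}" using two by auto
    then obtain y0 where "y0 \<in> X" "y0 \<noteq> x" using x by blast
    then obtain y where "y \<in> X" "succ X x y" using vertex_has_succ[OF fin x(1) _ _ x(2)] by blast
    then show "x \<in> fst ` {(x, y). x \<in> X \<and> y \<in> X \<and> succ X x y}" using x by force
  qed
  have "inj_on fst {(x, y). x \<in> X \<and> y \<in> X \<and> succ X x y}"
  proof (rule inj_onI, clarify)
    fix x y x' y' assume h: "x \<in> X" "y \<in> X" "succ X x y" "x' \<in> X" "y' \<in> X" "succ X x' y'" "fst (x, y) = fst (x', y')"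
    then have "x' = x" by simp
    moreover have "y = y'"
    proof (rule ccontr)
      assume "y \<noteq> y'"
      moreover have "cocircular x y y'" using succ_unique h by simp
      ultimately show False using gen[of x y y'] h succ_ne by auto
    qed
    ultimately show "x = x' \<and> y = y'" by simp
  qed
  then show ?thesis unfolding f0_def 1 2[symmetric] by (rule card_image)
qed

end

section \<open>Measurability and change of variables\<close>

text \<open>The predicates on samples quantify over uncountably many angles. By compactness a
  nonnegative continuous function has a zero exactly if it takes arbitrarily small values, and these
  can be sought on a countable dense set.\<close>

lemma sets_ex_compact_zero:
  fixes G :: "'p::euclidean_space \<Rightarrow> 'w \<Rightarrow> real"
  assumes C: "compact C"
    and meas: "\<And>p. p \<in> C \<Longrightarrow> G p \<in> borel_measurable N"
    and cont: "\<And>\<omega>. \<omega> \<in> space N \<Longrightarrow> continuous_on C (\<lambda>p. G p \<omega>)"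
    and nonneg: "\<And>p \<omega>. p \<in> C \<Longrightarrow> \<omega> \<in> space N \<Longrightarrow> 0 \<le> G p \<omega>"
  shows "{\<omega> \<in> space N. \<exists>p\<in>C. G p \<omega> = 0} \<in> sets N"
proof -
  obtain D where D: "countable D" "D \<subseteq> C" "C \<subseteq> closure D" using separable[of C] .
  have "{\<omega> \<in> space N. \<exists>p\<in>C. G p \<omega> = 0} = (\<Inter>n::nat. \<Union>p\<in>D. {\<omega> \<in> space N. G p \<omega> < inverse (real (Suc n))})"
  proof (intro equalityI subsetI)
    fix \<omega> assume "\<omega> \<in> {\<omega> \<in> space N. \<exists>p\<in>C. G p \<omega> = 0}"
    then obtain p where p: "\<omega> \<in> space N" "p \<in> C" "G p \<omega> = 0" by blast
    show "\<omega> \<in> (\<Inter>n::nat. \<Union>p\<in>D. {\<omega> \<in> space N. G p \<omega> < inverse (real (Suc n))})"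
    proof
      fix n :: nat
      obtain d where d: "d > 0" "\<And>q. q \<in> C \<Longrightarrow> dist q p < d \<Longrightarrow> dist (G q \<omega>) (G p \<omega>) < inverse (real (Suc n))"
        using cont[OF p(1)] p(2) unfolding continuous_on_iff
        by (metis inverse_positive_iff_positive of_nat_0_less_iff zero_less_Suc)
      obtain q where q: "q \<in> D" "dist q p < d" using D(3) p(2) d(1) closure_approachable by blast
      then have "G q \<omega> < inverse (real (Suc n))" using d(2)[of q] D(2) p(3) by (auto simp: dist_real_def)
      then show "\<omega> \<in> (\<Union>p\<in>D. {\<omega> \<in> space N. G p \<omega> < inverse (real (Suc n))})" using q p by blast
    qed
  next
    fix \<omega> assume *: "\<omega> \<in> (\<Inter>n::nat. \<Union>p\<in>D. {\<omega> \<in> space N. G p \<omega> < inverse (real (Suc n))})"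
    then have w: "\<omega> \<in> space N" by blast
    have "\<forall>n::nat. \<exists>p. p \<in> C \<and> G p \<omega> < inverse (real (Suc n))" using * D(2) by blast
    then obtain p where p: "\<And>n. p n \<in> C" "\<And>n. G (p n) \<omega> < inverse (real (Suc n))" by metis
    then obtain l q where l: "l \<in> C" "strict_mono q" "(p \<circ> q) \<longlonglongrightarrow> l"
      using C unfolding compact_def by metis
    have "(\<lambda>n. G (p (q n)) \<omega>) \<longlonglongrightarrow> G l \<omega>"
      using continuous_on_tendsto_compose[OF cont[OF w] l(3,1)] p(1) by (simp add: o_def)
    moreover have "(\<lambda>n. inverse (real (Suc (q n)))) \<longlonglongrightarrow> 0"
      using LIMSEQ_subseq_LIMSEQ[OF LIMSEQ_inverse_real_of_nat l(2)] by (simp add: o_def)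
    ultimately have "G l \<omega> \<le> 0"
      by (rule LIMSEQ_le) (use p(2) less_imp_le in blast)
    then have "G l \<omega> = 0" using nonneg[OF l(1) w] by simp
    then show "\<omega> \<in> {\<omega> \<in> space N. \<exists>p\<in>C. G p \<omega> = 0}" using w l(1) by blast
  qed
  also have "\<dots> \<in> sets N"
  proof -
    have "{\<omega> \<in> space N. G p \<omega> < inverse (real (Suc n))} \<in> sets N" if "p \<in> D" for p n
    proof -
      have "G p \<in> borel_measurable N" using meas D(2) that by blast
      then show ?thesis by measurable
    qed
    then have "(\<Union>p\<in>D. {\<omega> \<in> space N. G p \<omega> < inverse (real (Suc n))}) \<in> sets N" for n
      using D(1) by (intro sets.countable_UN'') auto
    then show ?thesis by (intro sets.countable_INT) auto
  qed
  finally show ?thesis .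
qed

lemma measurable_vector2 [measurable]:
  "f \<in> borel_measurable N \<Longrightarrow> g \<in> borel_measurable N \<Longrightarrow> (\<lambda>x. vector [f x, g x] :: real^2) \<in> borel_measurable N"
proof -
  assume [measurable]: "f \<in> borel_measurable N" "g \<in> borel_measurable N"
  have "(\<lambda>x. vector [f x, g x] :: real^2) = (\<lambda>x. f x *\<^sub>R axis 1 1 + g x *\<^sub>R axis 2 1)"
    by (simp add: fun_eq_iff vec_eq_iff forall_2 axis_def)
  then show ?thesis by simp
qed

section \<open>Change of variables in the plane\<close>

lemma lborel_real2:
  "(lborel :: (real^2) measure) = distr (lborel \<Otimes>\<^sub>M lborel) borel (\<lambda>(a, b). vector [a, b])"
proof (rule lborel_eqI)
  fix l u :: "real^2" assume le: "\<And>b. b \<in> Basis \<Longrightarrow> l \<bullet> b \<le> u \<bullet> b"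
  have le12: "l$1 \<le> u$1" "l$2 \<le> u$2"
    using le[of "axis 1 1"] le[of "axis 2 1"] by (auto simp: inner_axis)
  have "(\<lambda>(a, b). vector [a, b] :: real^2) -` box l u = {l$1<..<u$1} \<times> {l$2<..<u$2}"
    by (auto simp: mem_box_cart forall_2)
  then have "emeasure (distr (lborel \<Otimes>\<^sub>M lborel) borel (\<lambda>(a, b). vector [a, b] :: real^2)) (box l u)
    = emeasure (lborel \<Otimes>\<^sub>M lborel) ({l$1<..<u$1} \<times> {l$2<..<u$2})"
    by (subst emeasure_distr) (auto simp: space_pair_measure split_beta')
  also have "\<dots> = ennreal ((u - l)$1 * (u - l)$2)"
    using le12 by (simp add: lborel.emeasure_pair_measure_Times ennreal_mult)
  also have "(u - l)$1 * (u - l)$2 = (\<Prod>b\<in>Basis. (u - l) \<bullet> b)"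
  proof -
    have B: "(Basis :: (real^2) set) = (\<lambda>i. axis i 1) ` {1, 2}"
      by (auto simp: Basis_vec_def) (metis exhaust_2)
    have inj: "inj_on (\<lambda>i::2. axis i (1::real)) {1, 2}" by (auto simp: inj_on_def axis_eq_axis)
    show ?thesis unfolding B by (subst prod.reindex[OF inj]) (simp add: inner_axis)
  qed
  finally show "emeasure (distr (lborel \<Otimes>\<^sub>M lborel) borel (\<lambda>(a, b). vector [a, b] :: real^2)) (box l u)
    = ennreal (\<Prod>b\<in>Basis. (u - l) \<bullet> b)" .
qed simp

lemma nn_integral_real2:
  assumes [measurable]: "f \<in> borel_measurable borel"
  shows "(\<integral>\<^sup>+x. f x \<partial>(lborel :: (real^2) measure)) = (\<integral>\<^sup>+a. \<integral>\<^sup>+b. f (vector [a, b]) \<partial>lborel \<partial>lborel)"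
proof -
  have "(\<integral>\<^sup>+x. f x \<partial>(lborel :: (real^2) measure)) = (\<integral>\<^sup>+p. f (vector [fst p, snd p]) \<partial>(lborel \<Otimes>\<^sub>M lborel))"
    by (subst lborel_real2, subst nn_integral_distr) (simp_all add: split_beta')
  also have "\<dots> = (\<integral>\<^sup>+a. \<integral>\<^sup>+b. f (vector [a, b]) \<partial>lborel \<partial>lborel)"
    by (subst lborel.nn_integral_fst[symmetric]) simp_all
  finally show ?thesis .
qed

text \<open>\<open>g1\<close> and \<open>g2\<close> are the partial derivatives. The bounds on the
  domain, the Jacobian and \<open>f\<close> make all integrals finite, so that the theorem for
  absolutely integrable functions yields the statement for \<open>ennreal\<close>.\<close>

lemma nn_integral_change_real2:
  fixes g g1 g2 :: "real \<Rightarrow> real \<Rightarrow> real^2" and f :: "real^2 \<Rightarrow> ennreal"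
  defines "Jac \<equiv> \<lambda>a b. \<bar>g1 a b $ 1 * g2 a b $ 2 - g2 a b $ 1 * g1 a b $ 2\<bar>"
  assumes D: "D \<in> sets borel" "bounded D"
    and der: "\<And>a b. ((\<lambda>p::real^2. g (p$1) (p$2)) has_derivative (\<lambda>h. h$1 *\<^sub>R g1 a b + h$2 *\<^sub>R g2 a b)) (at (vector [a, b]))"
    and inj: "inj_on (\<lambda>(a, b). g a b) D"
    and JB: "\<And>a b. (a, b) \<in> D \<Longrightarrow> Jac a b \<le> B"
    and Jm: "(\<lambda>(a, b). Jac a b) \<in> borel_measurable borel"
    and fm [measurable]: "f \<in> borel_measurable borel"
    and f1: "\<And>y. f y \<le> 1"
    and f0: "\<And>y. y \<notin> (\<lambda>(a, b). g a b) ` D \<Longrightarrow> f y = 0"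
  shows "(\<integral>\<^sup>+y. f y \<partial>lborel) = (\<integral>\<^sup>+a. \<integral>\<^sup>+b. indicator D (a, b) * (ennreal (Jac a b) * f (g a b)) \<partial>lborel \<partial>lborel)"
proof -
  define G where "G p = g (p$1) (p$2)" for p :: "real^2"
  define S where "S = {p :: real^2. (p$1, p$2) \<in> D}"
  define F where "F y = enn2real (f y)" for y
  have fF: "f y = ennreal (F y)" for y
    using f1[of y] by (simp add: F_def less_le_trans[of _ 1 top] le_less_trans[of "f y" 1 top])
  have F01: "0 \<le> F y" "F y \<le> 1" for y
    using enn2real_mono[OF f1[of y]] by (auto simp: F_def)
  have Fm [measurable]: "F \<in> borel_measurable borel" unfolding F_def by measurable
  have cG: "continuous_on UNIV G"
  proof (intro continuous_at_imp_continuous_on ballI)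
    fix p :: "real^2"
    have "vector [p$1, p$2] = p" by (simp add: vec_eq_iff forall_2)
    then show "isCont G p" using has_derivative_continuous[OF der[of "p$1" "p$2"]] by (simp add: G_def[abs_def])
  qed
  have Gm [measurable]: "G \<in> borel_measurable borel" by (rule borel_measurable_continuous_onI[OF cG])
  have pm [measurable]: "(\<lambda>p::real^2. (p$1, p$2)) \<in> borel \<rightarrow>\<^sub>M borel"
    by (intro borel_measurable_continuous_onI continuous_intros)
  have S [measurable]: "S \<in> sets borel"
    using measurable_sets[OF pm D(1)] by (simp add: S_def vimage_def)
  have Sl: "S \<in> sets lebesgue" using S by simp
  have "bounded S"
  proof -
    obtain c where c: "\<And>p. p \<in> D \<Longrightarrow> norm p \<le> c" using D(2) by (auto simp: bounded_iff)
    have "norm p \<le> 2 * c" if "p \<in> S" for p :: "real^2"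
    proof -
      have "norm p \<le> \<bar>p$1\<bar> + \<bar>p$2\<bar>" using norm_le_l1_cart[of p] by (simp add: sum_2)
      moreover have "\<bar>p$1\<bar> \<le> norm (p$1, p$2)" "\<bar>p$2\<bar> \<le> norm (p$1, p$2)"
        using norm_fst_le[of "p$1" "p$2"] norm_snd_le[of "p$2" "p$1"] by auto
      moreover have "norm (p$1, p$2) \<le> c" using that c by (simp add: S_def)
      ultimately show ?thesis by linarith
    qed
    then show ?thesis by (auto simp: bounded_iff)
  qed
  then obtain R where "\<forall>x\<in>S. norm x \<le> R" unfolding bounded_iff by blast
  then have R: "S \<subseteq> cball 0 R" by auto
  define JJ where "JJ p = Jac (p$1) (p$2)" for p :: "real^2"
  have JJm [measurable]: "JJ \<in> borel_measurable borel"
    using measurable_compose[OF pm Jm] by (simp add: JJ_def[abs_def])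
  have det: "\<bar>det (matrix (\<lambda>h::real^2. h$1 *\<^sub>R g1 a b + h$2 *\<^sub>R g2 a b))\<bar> = Jac a b" for a b
    by (simp add: det_2 matrix_def axis_def Jac_def)
  have derS: "(G has_derivative (\<lambda>h. h$1 *\<^sub>R g1 (p$1) (p$2) + h$2 *\<^sub>R g2 (p$1) (p$2))) (at p within S)" for p
  proof -
    have "vector [p$1, p$2] = p" by (simp add: vec_eq_iff forall_2)
    then show ?thesis using der[of "p$1" "p$2"] by (simp add: G_def[abs_def] has_derivative_at_withinI)
  qed
  have injS: "inj_on G S"
    using inj by (auto simp: inj_on_def G_def S_def vec_eq_iff forall_2)
  \<comment> \<open>The change of variables theorem is about vector valued functions;
    \<open>real^1\<close> carries the scalar integrand through it.\<close>
  have vec_scale: "JJ p *\<^sub>R (vec (F (G p)) :: real^1) = vec (JJ p * F (G p))" for p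
    by (simp add: vec_eq_iff)
  have JJ0: "0 \<le> JJ p" for p by (simp add: JJ_def Jac_def)
  have JFm: "(\<lambda>p. JJ p * F (G p) * indicator S p) \<in> borel_measurable borel" by measurable
  have nnfin: "(\<integral>\<^sup>+p. ennreal (JJ p * F (G p) * indicator S p) \<partial>lborel) < \<infinity>"
  proof -
    have "(\<integral>\<^sup>+p. ennreal (JJ p * F (G p) * indicator S p) \<partial>lborel)
      \<le> (\<integral>\<^sup>+p. ennreal \<bar>B\<bar> * indicator (cball (0::real^2) R) p \<partial>lborel)"
    proof (rule nn_integral_mono)
      fix p :: "real^2"
      show "ennreal (JJ p * F (G p) * indicator S p) \<le> ennreal \<bar>B\<bar> * indicator (cball 0 R) p"
      proof (cases "p \<in> S")
        case True
        then have "JJ p \<le> \<bar>B\<bar>" using JB[of "p$1" "p$2"] by (simp add: JJ_def S_def)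
        then have "JJ p * F (G p) \<le> \<bar>B\<bar> * 1" using JJ0 F01 by (intro mult_mono) auto
        then show ?thesis using True R by (auto simp: indicator_def intro!: ennreal_leI)
      qed simp
    qed
    also have "\<dots> < \<infinity>"
      using emeasure_bounded_finite[OF bounded_cball[of "0::real^2" R]]
      by (simp add: nn_integral_cmult_indicator ennreal_mult_less_top)
    finally show ?thesis .
  qed
  define I where "I = enn2real (\<integral>\<^sup>+p. ennreal (JJ p * F (G p) * indicator S p) \<partial>lborel)"
  have Inn: "(\<integral>\<^sup>+p. ennreal (JJ p * F (G p) * indicator S p) \<partial>lborel) = ennreal I" "0 \<le> I"
    using nnfin by (auto simp: I_def less_top)
  have hi: "((\<lambda>p. JJ p * F (G p) * indicator S p) has_integral I) UNIV"
    by (rule nn_integral_has_integral[OF JFm _ Inn]) (use JJ0 F01 in auto)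
  have "((\<lambda>p. if p \<in> S then JJ p * F (G p) else 0) has_integral I) UNIV"
    using hi by (rule has_integral_eq[rotated]) (auto simp: indicator_def)
  then have hiS: "((\<lambda>p. JJ p * F (G p)) has_integral I) S" by (simp add: has_integral_restrict_UNIV)
  have "(\<lambda>p. JJ p * F (G p)) absolutely_integrable_on S"
    using hiS JJ0 F01 by (intro nonnegative_absolutely_integrable_1) (auto simp: integrable_on_def)
  then have "((\<lambda>p. vec (JJ p * F (G p)) :: real^1)) absolutely_integrable_on S
    \<and> integral S (\<lambda>p. vec (JJ p * F (G p)) :: real^1) = vec I"
    using hiS unfolding absolutely_integrable_on_1_iff integral_on_1_eq by (simp add: has_integral_iff)
  then have "(\<lambda>p. \<bar>det (matrix (\<lambda>h::real^2. h$1 *\<^sub>R g1 (p$1) (p$2) + h$2 *\<^sub>R g2 (p$1) (p$2)))\<bar> *\<^sub>R (vec (F (G p)) :: real^1)) absolutely_integrable_on S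
    \<and> integral S (\<lambda>p. \<bar>det (matrix (\<lambda>h::real^2. h$1 *\<^sub>R g1 (p$1) (p$2) + h$2 *\<^sub>R g2 (p$1) (p$2)))\<bar> *\<^sub>R (vec (F (G p)) :: real^1)) = vec I"
    unfolding det JJ_def[symmetric] vec_scale .
  then have "(\<lambda>y. vec (F y) :: real^1) absolutely_integrable_on (G ` S) \<and> integral (G ` S) (\<lambda>y. vec (F y) :: real^1) = vec I"
    by (subst (asm) has_absolute_integral_change_of_variables[OF Sl derS injS])
  then have "F absolutely_integrable_on (G ` S)" "integral (G ` S) F = I"
    unfolding absolutely_integrable_on_1_iff integral_on_1_eq by simp_all
  then have "(F has_integral I) (G ` S)"
    by (auto simp: has_integral_iff absolutely_integrable_on_def)
  then have "((\<lambda>y. if y \<in> G ` S then F y else 0) has_integral I) UNIV" by (simp add: has_integral_restrict_UNIV)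
  moreover have "(if y \<in> G ` S then F y else 0) = F y" for y
  proof (cases "y \<in> G ` S")
    case False
    have "y \<notin> (\<lambda>(a, b). g a b) ` D"
    proof
      assume "y \<in> (\<lambda>(a, b). g a b) ` D"
      then obtain a b where "(a, b) \<in> D" "y = g a b" by auto
      then have "vector [a, b] \<in> S" "y = G (vector [a, b])" by (simp_all add: S_def G_def)
      then show False using False by blast
    qed
    then show ?thesis using f0 False by (simp add: F_def)
  qed simp
  ultimately have Fi: "(F has_integral I) UNIV" by simp
  have "(\<integral>\<^sup>+y. f y \<partial>lborel) = ennreal I"
    unfolding fF by (rule nn_integral_has_integral_lborel[OF Fm F01(1) Fi])
  also have "\<dots> = (\<integral>\<^sup>+p. ennreal (JJ p * F (G p) * indicator S p) \<partial>lborel)" by (rule Inn(1)[symmetric])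
  also have "\<dots> = (\<integral>\<^sup>+a. \<integral>\<^sup>+b. ennreal (JJ (vector [a, b]) * F (G (vector [a, b])) * indicator S (vector [a, b])) \<partial>lborel \<partial>lborel)"
    by (rule nn_integral_real2) simp
  also have "\<dots> = (\<integral>\<^sup>+a. \<integral>\<^sup>+b. indicator D (a, b) * (ennreal (Jac a b) * f (g a b)) \<partial>lborel \<partial>lborel)"
  proof (intro nn_integral_cong)
    fix a b
    have "indicator S (vector [a, b] :: real^2) = (indicator D (a, b) :: real)" by (simp add: S_def indicator_def)
    then show "ennreal (JJ (vector [a, b]) * F (G (vector [a, b])) * indicator S (vector [a, b]))
      = indicator D (a, b) * (ennreal (Jac a b) * f (g a b))"
      using JJ0[of "vector [a, b]"] by (simp add: JJ_def G_def fF ennreal_mult F01 indicator_def)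
  qed
  finally show ?thesis .
qed

lemma compact_if_closed_subset:
  fixes C :: "'a::metric_space set"
  shows "closed C \<Longrightarrow> C \<subseteq> D \<Longrightarrow> compact D \<Longrightarrow> compact C"
  using compact_Int_closed[of D C] by (simp add: Int_absorb1)

lemma measurable_infdist [measurable (raw)]:
  "f \<in> borel_measurable N \<Longrightarrow> (\<lambda>\<omega>. infdist (f \<omega>) A) \<in> borel_measurable N"
  for f :: "_ \<Rightarrow> 'a::metric_space"
  by (rule measurable_compose[OF _ borel_measurable_continuous_onI])
    (auto intro!: continuous_on_infdist continuous_on_id)

text \<open>Equal sample points form one element of the image, so each value is counted at its least
  index. The count becomes a sum of indicators without assuming injectivity.\<close>

lemma card_image_eq_sum:
  fixes I :: "'i::wellorder set"
  assumes "finite I"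
  shows "card {z \<in> x ` I. P z} = (\<Sum>i\<in>I. of_bool (P (x i) \<and> (\<forall>j\<in>I. j < i \<longrightarrow> x j \<noteq> x i)))"
proof -
  let ?S = "{i \<in> I. P (x i) \<and> (\<forall>j\<in>I. j < i \<longrightarrow> x j \<noteq> x i)}"
  have "{z \<in> x ` I. P z} = x ` ?S"
  proof (intro equalityI subsetI)
    fix z assume z: "z \<in> {z \<in> x ` I. P z}"
    then have ex: "\<exists>i. i \<in> I \<and> x i = z" by auto
    define i where "i = (LEAST i. i \<in> I \<and> x i = z)"
    have "i \<in> I" "x i = z" using LeastI_ex[OF ex] by (auto simp: i_def)
    moreover have "x j \<noteq> z" if "j \<in> I" "j < i" for j
      using not_less_Least[of j "\<lambda>i. i \<in> I \<and> x i = z"] that by (auto simp: i_def)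
    ultimately show "z \<in> x ` ?S" using z by auto
  qed auto
  moreover have "inj_on x ?S" by (auto simp: inj_on_def) (metis linorder_less_linear)
  ultimately have "card {z \<in> x ` I. P z} = card ?S" by (simp add: card_image)
  also have "\<dots> = (\<Sum>i\<in>I. of_bool (P (x i) \<and> (\<forall>j\<in>I. j < i \<longrightarrow> x j \<noteq> x i)))"
    using assms by (simp add: of_bool_def sum.If_cases Int_def)
  finally show ?thesis .
qed

context oval begin

lemma M_ne: "M \<noteq> {}" using m_in by blast

lemma infdist_M: "infdist y M = 0 \<longleftrightarrow> y \<in> M"
  using in_closed_iff_infdist_zero[OF closed_M M_ne] by simp

lemma shift_pair:
  obtains a' b' where "a' \<in> {0..<2*pi}" "m a' = m a" "m b' = m b" "b' - a' = b - a"
proof -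
  obtain k where k: "a + 2 * pi * of_int k \<in> {0..<0 + 2 * pi}" using shift_into by blast
  show ?thesis
    by (rule that[of "a + 2 * pi * of_int k" "b + 2 * pi * of_int k"]) (use k in auto)
qed

section \<open>Measurability of the predicates on samples\<close>

text \<open>\<open>G\<close> adds up the violations of all conditions and vanishes exactly if they
  hold. The strict inequalities between the angles are exhausted by the compact sets
  \<open>C n\<close> with margin \<open>1 / real (Suc n)\<close>; the end angle stays below
  \<open>3 * pi\<close> when the start is in one period.\<close>

lemma succ_measurable:
  fixes x :: "'i \<Rightarrow> 'w \<Rightarrow> real^2"
  assumes I: "finite I" "i \<in> I" "j \<in> I" and x: "\<And>k. k \<in> I \<Longrightarrow> x k \<in> borel_measurable N"
  shows "{\<omega> \<in> space N. succ ((\<lambda>k. x k \<omega>) ` I) (x i \<omega>) (x j \<omega>)} \<in> sets N"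
proof -
  define G where "G p \<omega> = norm (x j \<omega> - x i \<omega> - (m (snd p) - m (fst p))) +
    (\<Sum>k\<in>I. infdist (x k \<omega> - x i \<omega> + m (fst p)) M)" for p \<omega>
  define C where "C n = {p \<in> {0..2*pi} \<times> {0..3*pi}. fst p + 1 / real (Suc n) \<le> snd p \<and> snd p \<le> fst p + pi - 1 / real (Suc n)}" for n
  have G0: "G p \<omega> = 0 \<longleftrightarrow> x j \<omega> - x i \<omega> = m (snd p) - m (fst p) \<and> allowed ((\<lambda>k. x k \<omega>) ` I) (x i \<omega>) (fst p)" for p \<omega>
  proof -
    have "G p \<omega> = 0 \<longleftrightarrow> norm (x j \<omega> - x i \<omega> - (m (snd p) - m (fst p))) = 0 \<and>
      (\<Sum>k\<in>I. infdist (x k \<omega> - x i \<omega> + m (fst p)) M) = 0"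
      unfolding G_def by (intro add_nonneg_eq_0_iff sum_nonneg infdist_nonneg norm_ge_zero)
    also have "(\<Sum>k\<in>I. infdist (x k \<omega> - x i \<omega> + m (fst p)) M) = 0 \<longleftrightarrow> allowed ((\<lambda>k. x k \<omega>) ` I) (x i \<omega>) (fst p)"
      using I by (subst sum_nonneg_eq_0_iff) (auto simp: infdist_nonneg infdist_M allowed_def)
    finally show ?thesis by simp
  qed
  have "{\<omega> \<in> space N. \<exists>p\<in>C n. G p \<omega> = 0} \<in> sets N" for n
  proof (rule sets_ex_compact_zero)
    have "closed (C n)" unfolding C_def
      by (intro closed_Collect_conj closed_Collect_le continuous_intros | simp add: closed_Times)+
    moreover have "C n \<subseteq> {0..2*pi} \<times> {0..3*pi}" by (auto simp: C_def)
    ultimately show "compact (C n)"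
      by (rule compact_if_closed_subset) (intro compact_Times compact_Icc)
    show "G p \<in> borel_measurable N" if "p \<in> C n" for p
      unfolding G_def[abs_def] using x I by measurable
    show "continuous_on (C n) (\<lambda>p. G p \<omega>)" for \<omega> unfolding G_def
      by (intro continuous_intros continuous_on_infdist continuous_on_compose2[OF cont_m[of UNIV]]) auto
    show "0 \<le> G p \<omega>" for p \<omega> unfolding G_def by (intro add_nonneg_nonneg sum_nonneg infdist_nonneg norm_ge_zero)
  qed
  then have "(\<Union>n. {\<omega> \<in> space N. \<exists>p\<in>C n. G p \<omega> = 0}) \<in> sets N" by blast
  also have "(\<Union>n. {\<omega> \<in> space N. \<exists>p\<in>C n. G p \<omega> = 0}) = {\<omega> \<in> space N. succ ((\<lambda>k. x k \<omega>) ` I) (x i \<omega>) (x j \<omega>)}"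
  proof (intro equalityI subsetI)
    fix \<omega> assume "\<omega> \<in> (\<Union>n. {\<omega> \<in> space N. \<exists>p\<in>C n. G p \<omega> = 0})"
    then obtain n p where p: "\<omega> \<in> space N" "p \<in> C n" "G p \<omega> = 0" by blast
    have zero_less: "0 < 1 / real (Suc n)" by simp
    have "fst p < snd p" "snd p < fst p + pi" using p(2) zero_less unfolding C_def mem_Collect_eq by linarith+
    then show "\<omega> \<in> {\<omega> \<in> space N. succ ((\<lambda>k. x k \<omega>) ` I) (x i \<omega>) (x j \<omega>)}"
      using p(1,3) unfolding G0 succ_def by blast
  next
    fix \<omega> assume w: "\<omega> \<in> {\<omega> \<in> space N. succ ((\<lambda>k. x k \<omega>) ` I) (x i \<omega>) (x j \<omega>)}"
    then obtain a b where ab: "a < b" "b < a + pi" "x j \<omega> - x i \<omega> = m b - m a" "allowed ((\<lambda>k. x k \<omega>) ` I) (x i \<omega>) a"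
      by (auto simp: succ_def)
    obtain a' b' where ab': "a' \<in> {0..<2*pi}" "m a' = m a" "m b' = m b" "b' - a' = b - a"
      by (rule shift_pair)
    obtain n where n: "1 / real (Suc n) < min (b - a) (a + pi - b)"
      using ab(1,2) nat_approx_posE[of "min (b - a) (a + pi - b)"] by auto
    have "(a', b') \<in> C n" using ab' n ab by (auto simp: C_def)
    moreover have "G (a', b') \<omega> = 0" unfolding G0 using ab ab' by (simp add: allowed_def)
    ultimately show "\<omega> \<in> (\<Union>n. {\<omega> \<in> space N. \<exists>p\<in>C n. G p \<omega> = 0})" using w by blast
  qed
  finally show ?thesis .
qed

text \<open>As for \<open>succ_measurable\<close>, with the condition that the two contact points
  differ exhausted by positive lower bounds on their distance.\<close>

lemma vertex_measurable:
  fixes x :: "'i \<Rightarrow> 'w \<Rightarrow> real^2"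
  assumes I: "finite I" "i \<in> I" and x: "\<And>k. k \<in> I \<Longrightarrow> x k \<in> borel_measurable N"
  shows "{\<omega> \<in> space N. vertex ((\<lambda>k. x k \<omega>) ` I) (x i \<omega>)} \<in> sets N"
proof -
  define G where "G p \<omega> = (\<Sum>k\<in>I. infdist (x k \<omega> - x i \<omega> + m (fst p)) M + infdist (x k \<omega> - x i \<omega> + m (snd p)) M)" for p \<omega>
  define C where "C n = {p \<in> {0..2*pi} \<times> {0..2*pi}. 1 / real (Suc n) \<le> norm (m (fst p) - m (snd p))}" for n
  have G0: "G p \<omega> = 0 \<longleftrightarrow> allowed ((\<lambda>k. x k \<omega>) ` I) (x i \<omega>) (fst p) \<and> allowed ((\<lambda>k. x k \<omega>) ` I) (x i \<omega>) (snd p)" for p \<omega>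
    unfolding G_def using I
    by (subst sum_nonneg_eq_0_iff) (auto simp: infdist_nonneg infdist_M allowed_def add_nonneg_eq_0_iff)
  have "{\<omega> \<in> space N. \<exists>p\<in>C n. G p \<omega> = 0} \<in> sets N" for n
  proof (rule sets_ex_compact_zero)
    have "closed (C n)" unfolding C_def
      by (intro closed_Collect_conj closed_Collect_le continuous_intros continuous_on_compose2[OF cont_m[of UNIV]] | simp add: closed_Times)+
    moreover have "C n \<subseteq> {0..2*pi} \<times> {0..2*pi}" by (auto simp: C_def)
    ultimately show "compact (C n)"
      by (rule compact_if_closed_subset) (intro compact_Times compact_Icc)
    show "G p \<in> borel_measurable N" if "p \<in> C n" for p
      unfolding G_def[abs_def] using x I by measurable
    show "continuous_on (C n) (\<lambda>p. G p \<omega>)" for \<omega> unfolding G_def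
      by (intro continuous_intros continuous_on_infdist continuous_on_compose2[OF cont_m[of UNIV]]) auto
    show "0 \<le> G p \<omega>" for p \<omega> unfolding G_def by (intro add_nonneg_nonneg sum_nonneg infdist_nonneg)
  qed
  then have "(\<Union>n. {\<omega> \<in> space N. \<exists>p\<in>C n. G p \<omega> = 0}) \<in> sets N" by blast
  also have "(\<Union>n. {\<omega> \<in> space N. \<exists>p\<in>C n. G p \<omega> = 0}) = {\<omega> \<in> space N. vertex ((\<lambda>k. x k \<omega>) ` I) (x i \<omega>)}"
  proof (intro equalityI subsetI)
    fix \<omega> assume "\<omega> \<in> (\<Union>n. {\<omega> \<in> space N. \<exists>p\<in>C n. G p \<omega> = 0})"
    then obtain n p where p: "\<omega> \<in> space N" "p \<in> C n" "G p \<omega> = 0" by blast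
    have "0 < 1 / real (Suc n)" by simp
    then have "0 < norm (m (fst p) - m (snd p))" using p(2) unfolding C_def mem_Collect_eq by linarith
    then have "m (fst p) \<noteq> m (snd p)" by simp
    then show "\<omega> \<in> {\<omega> \<in> space N. vertex ((\<lambda>k. x k \<omega>) ` I) (x i \<omega>)}"
      using p(1,3) unfolding G0 vertex_def by blast
  next
    fix \<omega> assume w: "\<omega> \<in> {\<omega> \<in> space N. vertex ((\<lambda>k. x k \<omega>) ` I) (x i \<omega>)}"
    then obtain a b where ab: "m a \<noteq> m b" "allowed ((\<lambda>k. x k \<omega>) ` I) (x i \<omega>) a" "allowed ((\<lambda>k. x k \<omega>) ` I) (x i \<omega>) b"
      by (auto simp: vertex_def)
    obtain a' where a': "a' \<in> {0..<2*pi}" "m a' = m a" by (rule shift_pair[of a a])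
    obtain b' where b': "b' \<in> {0..<2*pi}" "m b' = m b" by (rule shift_pair[of b b])
    obtain n where n: "1 / real (Suc n) < norm (m a - m b)"
      using ab(1) nat_approx_posE[of "norm (m a - m b)"] by auto
    have "(a', b') \<in> C n" using a' b' n by (auto simp: C_def)
    moreover have "G (a', b') \<omega> = 0" unfolding G0 using ab a' b' by (simp add: allowed_def)
    ultimately show "\<omega> \<in> (\<Union>n. {\<omega> \<in> space N. \<exists>p\<in>C n. G p \<omega> = 0})" using w by blast
  qed
  finally show ?thesis .
qed

lemma cocircular_measurable:
  assumes [measurable]: "x \<in> borel_measurable N" "y \<in> borel_measurable N" "z \<in> borel_measurable N"
  shows "{\<omega> \<in> space N. cocircular (x \<omega>) (y \<omega>) (z \<omega>)} \<in> sets N"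
proof -
  define G where "G p \<omega> = norm (y \<omega> - x \<omega> - (m (fst (snd p)) - m (fst p))) +
    norm (z \<omega> - x \<omega> - (m (snd (snd p)) - m (fst p)))" for p \<omega>
  define C where "C n = {p \<in> {0..2*pi} \<times> {0..3*pi} \<times> {0..2*pi}.
    fst p + 1 / real (Suc n) \<le> fst (snd p) \<and> fst (snd p) \<le> fst p + pi - 1 / real (Suc n)}" for n
  have G0: "G p \<omega> = 0 \<longleftrightarrow> y \<omega> - x \<omega> = m (fst (snd p)) - m (fst p) \<and> z \<omega> - x \<omega> = m (snd (snd p)) - m (fst p)" for p \<omega>
    unfolding G_def by (subst add_nonneg_eq_0_iff) auto
  have "{\<omega> \<in> space N. \<exists>p\<in>C n. G p \<omega> = 0} \<in> sets N" for n
  proof (rule sets_ex_compact_zero)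
    have "closed (C n)" unfolding C_def
      by (intro closed_Collect_conj closed_Collect_le continuous_intros | simp add: closed_Times)+
    moreover have "C n \<subseteq> {0..2*pi} \<times> {0..3*pi} \<times> {0..2*pi}" by (auto simp: C_def)
    ultimately show "compact (C n)"
      by (rule compact_if_closed_subset) (intro compact_Times compact_Icc)
    show "G p \<in> borel_measurable N" if "p \<in> C n" for p
      unfolding G_def[abs_def] by measurable
    show "continuous_on (C n) (\<lambda>p. G p \<omega>)" for \<omega> unfolding G_def
      by (intro continuous_intros continuous_on_compose2[OF cont_m[of UNIV]]) auto
    show "0 \<le> G p \<omega>" for p \<omega> unfolding G_def by (intro add_nonneg_nonneg norm_ge_zero)
  qed
  then have "(\<Union>n. {\<omega> \<in> space N. \<exists>p\<in>C n. G p \<omega> = 0}) \<in> sets N" by blast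
  also have "(\<Union>n. {\<omega> \<in> space N. \<exists>p\<in>C n. G p \<omega> = 0}) = {\<omega> \<in> space N. cocircular (x \<omega>) (y \<omega>) (z \<omega>)}"
  proof (intro equalityI subsetI)
    fix \<omega> assume "\<omega> \<in> (\<Union>n. {\<omega> \<in> space N. \<exists>p\<in>C n. G p \<omega> = 0})"
    then obtain n p where p: "\<omega> \<in> space N" "p \<in> C n" "G p \<omega> = 0" by blast
    have "0 < 1 / real (Suc n)" by simp
    then have "fst p < fst (snd p)" "fst (snd p) < fst p + pi" using p(2) unfolding C_def mem_Collect_eq by linarith+
    then show "\<omega> \<in> {\<omega> \<in> space N. cocircular (x \<omega>) (y \<omega>) (z \<omega>)}"
      using p(1,3) unfolding G0 cocircular_def by blast
  next
    fix \<omega> assume w: "\<omega> \<in> {\<omega> \<in> space N. cocircular (x \<omega>) (y \<omega>) (z \<omega>)}"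
    then obtain a b c where ab: "a < b" "b < a + pi" "y \<omega> - x \<omega> = m b - m a" "z \<omega> - x \<omega> = m c - m a"
      by (auto simp: cocircular_def)
    obtain a' b' where ab': "a' \<in> {0..<2*pi}" "m a' = m a" "m b' = m b" "b' - a' = b - a"
      by (rule shift_pair)
    obtain c' where c': "c' \<in> {0..<2*pi}" "m c' = m c" by (rule shift_pair[of c c])
    obtain n where n: "1 / real (Suc n) < min (b - a) (a + pi - b)"
      using ab(1,2) nat_approx_posE[of "min (b - a) (a + pi - b)"] by auto
    have "(a', b', c') \<in> C n" using ab' n ab c' by (auto simp: C_def)
    moreover have "G (a', b', c') \<omega> = 0" unfolding G0 using ab ab' c' by simp
    ultimately show "\<omega> \<in> (\<Union>n. {\<omega> \<in> space N. \<exists>p\<in>C n. G p \<omega> = 0})" using w by blast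
  qed
  finally show ?thesis .
qed

lemma f0_eq_card: "f0 M X = card {x \<in> X. vertex X x}"
proof -
  have "L_polygon_vertices M X = {x \<in> X. vertex X x}"
    unfolding L_polygon_vertices_def using vertex_iff by auto
  then show ?thesis by (simp add: f0_def)
qed

lemma f0_measurable:
  fixes x :: "nat \<Rightarrow> 'w \<Rightarrow> real^2"
  assumes I: "finite I" and x: "\<And>k. k \<in> I \<Longrightarrow> x k \<in> borel_measurable N"
  shows "(\<lambda>\<omega>. real (f0 M ((\<lambda>i. x i \<omega>) ` I))) \<in> borel_measurable N"
proof -
  have v: "Measurable.pred N (\<lambda>\<omega>. vertex ((\<lambda>k. x k \<omega>) ` I) (x i \<omega>))" if "i \<in> I" for i
    using vertex_measurable[OF I that x] by (simp add: pred_def)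
  have "Measurable.pred N (\<lambda>\<omega>. x j \<omega> = x i \<omega>)" if "i \<in> I" "j \<in> I" for i j
    using x[OF that(1)] x[OF that(2)] by measurable
  then have "Measurable.pred N (\<lambda>\<omega>. vertex ((\<lambda>k. x k \<omega>) ` I) (x i \<omega>) \<and> (\<forall>j\<in>I. j < i \<longrightarrow> x j \<omega> \<noteq> x i \<omega>))" if "i \<in> I" for i
    using v that I by (intro pred_intros_logic pred_intros_finite) auto
  then have "(\<lambda>\<omega>. \<Sum>i\<in>I. (of_bool (vertex ((\<lambda>k. x k \<omega>) ` I) (x i \<omega>) \<and> (\<forall>j\<in>I. j < i \<longrightarrow> x j \<omega> \<noteq> x i \<omega>)) :: real)) \<in> borel_measurable N"
    by (intro borel_measurable_sum) (simp add: of_bool_def)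
  then show ?thesis unfolding f0_eq_card card_image_eq_sum[OF I] by simp
qed

lemma f0_eq_sum_succ:
  fixes x :: "nat \<Rightarrow> real^2"
  assumes I: "finite I" "card I \<ge> 2" and inj: "inj_on x I"
    and gen: "\<And>i j k. i \<in> I \<Longrightarrow> j \<in> I \<Longrightarrow> k \<in> I \<Longrightarrow> k \<noteq> i \<Longrightarrow> k \<noteq> j \<Longrightarrow> i \<noteq> j \<Longrightarrow> \<not> cocircular (x i) (x j) (x k)"
  shows "f0 M (x ` I) = (\<Sum>i\<in>I. \<Sum>j\<in>I - {i}. of_bool (succ (x ` I) (x i) (x j)))"
proof -
  let ?X = "x ` I"
  have "f0 M ?X = card {(y, z). y \<in> ?X \<and> z \<in> ?X \<and> succ ?X y z}"
    by (rule card_vertices) (use I inj gen in \<open>auto simp: card_image\<close>)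
  also have "{(y, z). y \<in> ?X \<and> z \<in> ?X \<and> succ ?X y z} = (\<lambda>(i, j). (x i, x j)) ` {(i, j). i \<in> I \<and> j \<in> I - {i} \<and> succ ?X (x i) (x j)}"
    using succ_ne by (auto simp: image_iff) metis
  also have "card \<dots> = card {(i, j). i \<in> I \<and> j \<in> I - {i} \<and> succ ?X (x i) (x j)}"
    using inj by (intro card_image) (auto simp: inj_on_def)
  also have "{(i, j). i \<in> I \<and> j \<in> I - {i} \<and> succ ?X (x i) (x j)} = (SIGMA i:I. {j \<in> I - {i}. succ ?X (x i) (x j)})"
    by auto
  also have "card \<dots> = (\<Sum>i\<in>I. \<Sum>j\<in>I - {i}. of_bool (succ ?X (x i) (x j)))"
    using I by (subst card_SigmaI) (auto simp: of_bool_def sum.If_cases Int_def intro!: sum.cong)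
  finally show ?thesis .
qed

lemma null_frontier: "range m \<in> null_sets lborel"
proof -
  have "closed (range m)" using frontier_eq frontier_closed by metis
  then have "range m \<in> sets borel" by simp
  moreover have "negligible (range m)" using negligible_convex_frontier[OF convex_M] frontier_eq by simp
  ultimately show ?thesis by (simp add: negligible_iff_null_sets null_sets_completion_iff)
qed

text \<open>By \<open>chord_unique\<close> the points \<open>x\<close> and \<open>y\<close> leave at
  most one translate, and \<open>z\<close> would have to lie on its boundary, a null set.\<close>

lemma AE_not_cocircular: "AE z in lborel. \<not> cocircular x y z"
proof (cases "\<exists>a b. a < b \<and> b < a + pi \<and> y - x = m b - m a")
  case True
  then obtain a b where ab: "a < b" "b < a + pi" "y - x = m b - m a" by blast
  have "AE z in lborel. z + (m a - x) \<notin> range m"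
  proof -
    have "AE z in distr lborel borel ((+) (m a - x)). z \<notin> range m"
      unfolding lborel_distr_plus by (rule AE_not_in[OF null_frontier])
    then have "AE z in lborel. m a - x + z \<notin> range m"
      by (subst (asm) AE_distr_iff) (use null_frontier in auto)
    then show ?thesis by (simp add: add.commute)
  qed
  then show ?thesis
  proof eventually_elim
    case (elim z)
    show ?case
    proof
      assume "cocircular x y z"
      then obtain a' b' c' where *: "a' < b'" "b' < a' + pi" "y - x = m b' - m a'" "z - x = m c' - m a'"
        by (auto simp: cocircular_def)
      have "m b' - m a' = m b - m a" using *(3) ab(3) by simp
      then have e: "m a' = m a" using chord_unique[OF *(1,2) ab(1,2)] by blast
      have "z + (m a - x) = (z - x) + m a" by simp
      also have "\<dots> = m c'" unfolding *(4) e by simp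
      finally have "z + (m a - x) = m c'" .
      then show False using elim by blast
    qed
  qed
next
  case False
  then have "\<not> cocircular x y z" for z unfolding cocircular_def by blast
  then show ?thesis by (intro AE_I2)
qed

end

section \<open>The expected number of vertices\<close>

lemma has_vector_derivative_nth:
  fixes m :: "real \<Rightarrow> real^2"
  assumes "(m has_vector_derivative d) (at (p $ i))"
  shows "((\<lambda>p::real^2. m (p $ i)) has_derivative (\<lambda>h. h $ i *\<^sub>R d)) (at p)"
proof -
  have "((\<lambda>p::real^2. p $ i) has_derivative (\<lambda>h. h $ i)) (at p)"
    by (intro bounded_linear_imp_has_derivative bounded_linear_vec_nth)
  from has_derivative_compose[OF this] assms show ?thesis
    unfolding has_vector_derivative_def by blast
qed

section \<open>Uniform samples and integration over the remaining points\<close>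

locale uniform_oval = oval +
  fixes K :: "(real^2) set"
  assumes K_comp: "compact K" and K_pos: "0 < measure lborel K"
begin

definition \<mu> :: "(real^2) measure" where "\<mu> = uniform_measure lborel K"
definition Q :: "real^2 \<Rightarrow> ennreal" where "Q t = emeasure \<mu> {z. z - t \<in> M}"

lemma K_sets [measurable]: "K \<in> sets borel" using K_comp by (simp add: borel_compact)
lemma M_sets [measurable]: "M \<in> sets borel" using closed_M by simp

lemma K_finite: "emeasure lborel K < \<infinity>"
  using emeasure_bounded_finite[OF compact_imp_bounded[OF K_comp]] .

lemma K_emeasure: "emeasure lborel K = ennreal (measure lborel K)"
  using K_finite by (intro emeasure_eq_ennreal_measure) auto

lemma sets_mu [simp, measurable_cong]: "sets \<mu> = sets borel" by (simp add: \<mu>_def)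
lemma space_mu [simp]: "space \<mu> = UNIV" by (simp add: \<mu>_def)

sublocale mu: prob_space \<mu>
  unfolding \<mu>_def using K_pos K_finite by (intro prob_space_uniform_measure) (auto simp: K_emeasure)

sublocale prod: product_prob_space "\<lambda>_::nat. \<mu>" UNIV ..

lemma nn_mu:
  assumes "f \<in> borel_measurable borel"
  shows "(\<integral>\<^sup>+x. f x \<partial>\<mu>) = (\<integral>\<^sup>+x. f x * indicator K x \<partial>lborel) / ennreal (measure lborel K)"
  unfolding \<mu>_def using assms by (subst nn_integral_uniform_measure) (auto simp: K_emeasure)

lemma AE_mu: "AE x in lborel. P x \<Longrightarrow> AE x in \<mu>. P x"
  unfolding \<mu>_def using K_pos K_finite by (subst AE_uniform_measure) (auto simp: K_emeasure)

lemma comp_meas: "i \<in> I \<Longrightarrow> (\<lambda>v. v i) \<in> borel_measurable (PiM I (\<lambda>_. \<mu>))"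
  using measurable_component_singleton[of i I "\<lambda>_. \<mu>"] by (simp cong: measurable_cong_sets)

text \<open>Fubini's theorem with one coordinate integrated first. The null set may be required for
  every choice of the other points, since the exceptional sets treated here are null for each of
  them.\<close>

lemma AE_PiM_insert:
  fixes I :: "nat set"
  assumes I: "finite I" "i \<notin> I" and P: "Measurable.pred (PiM (insert i I) (\<lambda>_. \<mu>)) P"
    and ae: "\<And>w. AE z in \<mu>. P (w(i := z))"
  shows "AE v in PiM (insert i I) (\<lambda>_. \<mu>). P v"
proof -
  let ?N = "PiM (insert i I) (\<lambda>_. \<mu>)"
  have m [measurable]: "{v \<in> space ?N. \<not> P v} \<in> sets ?N" using P by measurable
  have "(\<integral>\<^sup>+v. indicator {v \<in> space ?N. \<not> P v} v \<partial>?N)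
    = (\<integral>\<^sup>+w. (\<integral>\<^sup>+z. indicator {v \<in> space ?N. \<not> P v} (w(i := z)) \<partial>\<mu>) \<partial>PiM I (\<lambda>_. \<mu>))"
    by (rule prod.product_nn_integral_insert[OF I]) (use m in measurable)
  also have "\<dots> = (\<integral>\<^sup>+w. 0 \<partial>PiM I (\<lambda>_. \<mu>))"
  proof (rule nn_integral_cong)
    fix w assume "w \<in> space (PiM I (\<lambda>_. \<mu>))"
    have "(\<integral>\<^sup>+z. indicator {v \<in> space ?N. \<not> P v} (w(i := z)) \<partial>\<mu>) = (\<integral>\<^sup>+z. 0 \<partial>\<mu>)"
      using ae[of w] by (intro nn_integral_cong_AE) (auto elim!: eventually_mono simp: indicator_def)
    then show "(\<integral>\<^sup>+z. indicator {v \<in> space ?N. \<not> P v} (w(i := z)) \<partial>\<mu>) = 0" by simp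
  qed
  finally show ?thesis using m by (subst AE_iff_measurable[OF m refl]) simp
qed

lemma AE_distinct:
  fixes I :: "nat set"
  assumes "finite I" "i \<in> I" "j \<in> I" "i \<noteq> j"
  shows "AE v in PiM I (\<lambda>_. \<mu>). v i \<noteq> v j"
proof -
  have I: "I = insert i (I - {i})" using assms by auto
  have "{v \<in> space (PiM I (\<lambda>_. \<mu>)). v i = v j} \<in> sets (PiM I (\<lambda>_. \<mu>))"
    by (rule measurable_equality_set) (use assms(2,3) comp_meas in auto)
  then have "Measurable.pred (PiM I (\<lambda>_. \<mu>)) (\<lambda>v. v i = v j)" by (simp add: pred_def)
  then have "Measurable.pred (PiM I (\<lambda>_. \<mu>)) (\<lambda>v. v i \<noteq> v j)" by (rule pred_intros_logic(2))
  moreover have "AE z in \<mu>. (w(i := z)) i \<noteq> (w(i := z)) j" for w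
  proof -
    have "AE z in lborel. z \<noteq> w j" by (rule AE_lborel_singleton)
    then show ?thesis using assms(4) by (intro AE_mu) (auto elim: eventually_mono)
  qed
  ultimately show ?thesis using AE_PiM_insert[of "I - {i}" i "\<lambda>v. v i \<noteq> v j", folded I] assms(1) by auto
qed

lemma AE_generic:
  fixes I :: "nat set"
  assumes "finite I" "i \<in> I" "j \<in> I" "k \<in> I" "k \<noteq> i" "k \<noteq> j"
  shows "AE v in PiM I (\<lambda>_. \<mu>). \<not> cocircular (v i) (v j) (v k)"
proof -
  have I: "I = insert k (I - {k})" using assms by auto
  have "Measurable.pred (PiM I (\<lambda>_. \<mu>)) (\<lambda>v. cocircular (v i) (v j) (v k))"
    unfolding pred_def by (rule cocircular_measurable) (use assms comp_meas in auto)
  then have "Measurable.pred (PiM I (\<lambda>_. \<mu>)) (\<lambda>v. \<not> cocircular (v i) (v j) (v k))" by measurable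
  moreover have "AE z in \<mu>. \<not> cocircular ((w(k := z)) i) ((w(k := z)) j) ((w(k := z)) k)" for w
    using AE_mu[OF AE_not_cocircular[of "w i" "w j"]] assms by simp
  ultimately show ?thesis
    using AE_PiM_insert[of "I - {k}" k "\<lambda>v. \<not> cocircular (v i) (v j) (v k)", folded I] assms(1) by auto
qed

text \<open>One parameter pair for each chord vector: the start is reduced to a period, the end is
  left unreduced so that the arc length is a plain difference.\<close>

definition arcs :: "(real \<times> real) set" where
  "arcs = {(a, b). 0 \<le> a \<and> a < 2 * pi \<and> a < b \<and> b < a + pi}"

text \<open>The inner integrals come from substituting \<open>y = x + m b - m a\<close> for the successor of \<open>x\<close>;
  \<^term>\<open>Q\<close> is the probability that a sample point lies in the translate through both.\<close>

definition T :: "nat \<Rightarrow> ennreal" where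
  "T N = (\<integral>\<^sup>+x. (\<integral>\<^sup>+a. \<integral>\<^sup>+b. indicator arcs (a, b) * (ennreal (r a * r b * sin (b - a)) *
      (indicator K (x + (m b - m a)) * Q (x - m a) ^ N)) \<partial>lborel \<partial>lborel)
     / ennreal (measure lborel K) \<partial>\<mu>)"

lemma arcs_sets [measurable]: "arcs \<in> sets borel"
proof -
  have "arcs = {p. 0 \<le> fst p \<and> fst p < 2 * pi \<and> fst p < snd p \<and> snd p < fst p + pi}"
    by (auto simp: arcs_def)
  moreover have "{p \<in> space (borel \<Otimes>\<^sub>M borel). 0 \<le> fst p \<and> fst p < 2 * pi \<and> fst p < snd p \<and> snd p < fst p + pi} \<in> sets (borel \<Otimes>\<^sub>M borel :: (real \<times> real) measure)"
    by measurable
  ultimately show ?thesis unfolding borel_prod by simp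
qed

text \<open>Injectivity is \<open>chord_unique\<close> together with the window for the start; the
  Jacobian is the determinant of the velocities of the two ends of the chord.\<close>

lemma chord_change:
  assumes f [measurable]: "f \<in> borel_measurable borel" and f1: "\<And>y. f y \<le> 1"
    and f0: "\<And>y. \<not> (\<exists>a b. a < b \<and> b < a + pi \<and> y - x = m b - m a) \<Longrightarrow> f y = 0"
  shows "(\<integral>\<^sup>+y. f y \<partial>lborel) = (\<integral>\<^sup>+a. \<integral>\<^sup>+b. indicator arcs (a, b) *
     (ennreal (r a * r b * sin (b - a)) * f (x + (m b - m a))) \<partial>lborel \<partial>lborel)"
proof -
  let ?g = "\<lambda>a b. x + (m b - m a)"
  let ?g1 = "\<lambda>a b. - (r a *\<^sub>R W a)" and ?g2 = "\<lambda>a b. r b *\<^sub>R W b"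
  have jac: "\<bar>?g1 a b $ 1 * ?g2 a b $ 2 - ?g2 a b $ 1 * ?g1 a b $ 2\<bar> = \<bar>r a * r b * sin (b - a)\<bar>" for a b
    by (simp add: sin_diff algebra_simps)
  obtain C where C: "\<And>s. r s \<le> C" by (rule r_upper) blast
  have "(\<integral>\<^sup>+y. f y \<partial>lborel) = (\<integral>\<^sup>+a. \<integral>\<^sup>+b. indicator arcs (a, b) *
     (ennreal \<bar>?g1 a b $ 1 * ?g2 a b $ 2 - ?g2 a b $ 1 * ?g1 a b $ 2\<bar> * f (?g a b)) \<partial>lborel \<partial>lborel)"
  proof (rule nn_integral_change_real2[where B = "C * C"])
    show "arcs \<in> sets borel" by measurable
    have "arcs \<subseteq> {0..2*pi} \<times> {0..3*pi}" by (auto simp: arcs_def)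
    then show "bounded arcs"
      by (rule bounded_subset[OF compact_imp_bounded[OF compact_Times[OF compact_Icc compact_Icc]]])
    show "((\<lambda>p::real^2. ?g (p$1) (p$2)) has_derivative (\<lambda>h. h$1 *\<^sub>R ?g1 a b + h$2 *\<^sub>R ?g2 a b)) (at (vector [a, b]))" for a b
    proof -
      have "((\<lambda>p::real^2. ?g (p$1) (p$2)) has_derivative (\<lambda>h. 0 + (h$2 *\<^sub>R (r b *\<^sub>R W b) - h$1 *\<^sub>R (r a *\<^sub>R W a)))) (at (vector [a, b]))"
        by (intro has_derivative_add has_derivative_diff has_derivative_const has_vector_derivative_nth) (simp_all add: der)
      then show ?thesis by simp
    qed
    show "inj_on (\<lambda>(a, b). ?g a b) arcs"
    proof (rule inj_onI, clarify)
      fix a b a' b' assume h: "(a, b) \<in> arcs" "(a', b') \<in> arcs" "?g a b = ?g a' b'"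
      then have "m a = m a' \<and> m b = m b'" by (intro chord_unique) (auto simp: arcs_def)
      then obtain k l :: int where kl: "a = a' + 2 * pi * of_int k" "b = b' + 2 * pi * of_int l" using m_eq_iff by blast
      have "\<bar>a - a'\<bar> < 2 * pi" using h(1,2) unfolding arcs_def by auto
      then have "2 * pi * \<bar>real_of_int k\<bar> < 2 * pi * 1" using kl(1) by (simp add: abs_mult)
      then have "\<bar>real_of_int k\<bar> < 1" by (subst (asm) mult_less_cancel_left_pos) auto
      then have "k = 0" by linarith
      then have "a = a'" using kl by simp
      then have "\<bar>b - b'\<bar> < pi" using h(1,2) unfolding arcs_def by auto
      then have "\<bar>b - b'\<bar> < 2 * pi" using pi_gt_zero by linarith
      then have "2 * pi * \<bar>real_of_int l\<bar> < 2 * pi * 1" using kl(2) by (simp add: abs_mult)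
      then have "\<bar>real_of_int l\<bar> < 1" by (subst (asm) mult_less_cancel_left_pos) auto
      then have "l = 0" by linarith
      then show "a = a' \<and> b = b'" using kl \<open>k = 0\<close> by simp
    qed
    show "\<bar>?g1 a b $ 1 * ?g2 a b $ 2 - ?g2 a b $ 1 * ?g1 a b $ 2\<bar> \<le> C * C" for a b
    proof -
      have "r a * r b * \<bar>sin (b - a)\<bar> \<le> (C * C) * 1"
        using C r_pos by (intro mult_mono) (auto intro: less_imp_le order_trans[OF less_imp_le[OF r_pos] C] simp: abs_sin_le_one)
      then show ?thesis unfolding jac using r_pos by (simp add: abs_mult less_imp_le)
    qed
    have [measurable]: "r \<in> borel_measurable borel" "m \<in> borel_measurable borel"
      using cont_r cont_m by (auto intro: borel_measurable_continuous_onI)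
    show "(\<lambda>(a, b). \<bar>?g1 a b $ 1 * ?g2 a b $ 2 - ?g2 a b $ 1 * ?g1 a b $ 2\<bar>) \<in> borel_measurable borel"
      unfolding jac borel_prod[symmetric] by measurable
    show "f y = 0" if "y \<notin> (\<lambda>(a, b). ?g a b) ` arcs" for y
    proof (rule f0, clarify)
      fix a b assume ab: "a < b" "b < a + pi" "y - x = m b - m a"
      obtain a' b' where ab': "a' \<in> {0..<2*pi}" "m a' = m a" "m b' = m b" "b' - a' = b - a"
        by (rule shift_pair)
      have "(a', b') \<in> arcs" using ab' ab by (auto simp: arcs_def)
      moreover have "y = ?g a' b'" using ab(3) ab' by (simp add: algebra_simps)
      ultimately show False using that by force
    qed
  qed (use f1 in auto)
  also have "\<dots> = (\<integral>\<^sup>+a. \<integral>\<^sup>+b. indicator arcs (a, b) *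
     (ennreal (r a * r b * sin (b - a)) * f (x + (m b - m a))) \<partial>lborel \<partial>lborel)"
  proof (intro nn_integral_cong)
    fix a b
    show "indicator arcs (a, b) * (ennreal \<bar>?g1 a b $ 1 * ?g2 a b $ 2 - ?g2 a b $ 1 * ?g1 a b $ 2\<bar> * f (?g a b))
      = indicator arcs (a, b) * (ennreal (r a * r b * sin (b - a)) * f (?g a b))"
    proof (cases "(a, b) \<in> arcs")
      case True
      then have "sin (b - a) > 0" by (intro sin_gt_zero) (auto simp: arcs_def)
      then show ?thesis unfolding jac using r_pos[of a] r_pos[of b] by (simp add: abs_mult)
    qed simp
  qed
  finally show ?thesis .
qed

text \<open>The two distinguished points are integrated last. Once they are fixed, so is the
  translate, and the other points have to lie in it independently of each other.\<close>

lemma succ_integral: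
  fixes I :: "nat set"
  assumes I: "finite I" "i \<in> I" "j \<in> I" "i \<noteq> j"
  shows "(\<integral>\<^sup>+v. of_bool (succ (v ` I) (v i) (v j)) \<partial>PiM I (\<lambda>_. \<mu>)) = T (card I - 2)"
proof -
  define I0 where "I0 = I - {i, j}"
  have II: "I = insert i (insert j I0)" "i \<notin> insert j I0" "j \<notin> I0" "finite I0" "finite (insert j I0)"
    using I by (auto simp: I0_def)
  have cI0: "card I0 = card I - 2" using I by (simp add: I0_def card_Diff_subset)
  let ?f = "\<lambda>v. of_bool (succ (v ` I) (v i) (v j)) :: ennreal"
  have sm: "Measurable.pred (PiM I (\<lambda>_. \<mu>)) (\<lambda>v. succ (v ` I) (v i) (v j))"
    unfolding pred_def using succ_measurable[of I i j "\<lambda>k v. v k" "PiM I (\<lambda>_. \<mu>)"] I comp_meas by simp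
  have fm: "?f \<in> borel_measurable (PiM I (\<lambda>_. \<mu>))" using sm unfolding of_bool_def by measurable
  define inner where "inner x y = (\<integral>\<^sup>+w. ?f ((w(j := y))(i := x)) \<partial>PiM I0 (\<lambda>_. \<mu>))" for x y
  have upd: "(\<lambda>w. w(i := x)) \<in> PiM (insert j I0) (\<lambda>_. \<mu>) \<rightarrow>\<^sub>M PiM I (\<lambda>_. \<mu>)" for x
    unfolding II(1) by (rule measurable_fun_upd[where J = "insert j I0"]) auto
  have "(\<integral>\<^sup>+v. ?f v \<partial>PiM I (\<lambda>_. \<mu>)) = (\<integral>\<^sup>+x. (\<integral>\<^sup>+w. ?f (w(i := x)) \<partial>PiM (insert j I0) (\<lambda>_. \<mu>)) \<partial>\<mu>)"
    unfolding II(1) by (rule prod.product_nn_integral_insert_rev[OF II(5,2)]) (use fm II(1) in simp)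
  also have "\<dots> = (\<integral>\<^sup>+x. (\<integral>\<^sup>+y. inner x y \<partial>\<mu>) \<partial>\<mu>)"
    unfolding inner_def
    by (intro nn_integral_cong prod.product_nn_integral_insert_rev[OF II(4,3)] measurable_compose[OF upd fm])
  also have "\<dots> = T (card I - 2)"
    unfolding T_def
  proof (rule nn_integral_cong)
    fix x
    have upd2: "(\<lambda>(y, w). (w(j := y))(i := x)) \<in> \<mu> \<Otimes>\<^sub>M PiM I0 (\<lambda>_. \<mu>) \<rightarrow>\<^sub>M PiM I (\<lambda>_. \<mu>)"
      unfolding split_beta' II(1)
      by (rule measurable_fun_upd[where J = "insert j I0"], simp, rule measurable_fun_upd[where J = I0]) auto
    interpret P0: prob_space "PiM I0 (\<lambda>_. \<mu>)" by (rule prob_space_PiM) unfold_locales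
    have im [measurable]: "inner x \<in> borel_measurable borel"
    proof -
      have "(\<lambda>(y, w). ?f ((w(j := y))(i := x))) \<in> borel_measurable (\<mu> \<Otimes>\<^sub>M PiM I0 (\<lambda>_. \<mu>))"
        using measurable_compose[OF upd2 fm] by (simp add: split_beta')
      then have "inner x \<in> borel_measurable \<mu>" unfolding inner_def[abs_def] by (rule P0.borel_measurable_nn_integral)
      then show ?thesis by (simp cong: measurable_cong_sets)
    qed
    have inner_1: "inner x y \<le> 1" for y
    proof -
      have "inner x y \<le> (\<integral>\<^sup>+w. 1 \<partial>PiM I0 (\<lambda>_. \<mu>))" unfolding inner_def by (intro nn_integral_mono) (simp add: of_bool_def)
      also have "\<dots> = 1" by (simp add: P0.emeasure_space_1)
      finally show ?thesis .
    qed
    have img: "((w(j := y))(i := x)) ` I = insert x (insert y (w ` I0))" for w y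
      unfolding II(1) using II(2,3) I(4) by (auto simp: image_iff I0_def)
    have inner_0: "inner x y = 0" if "\<not> (\<exists>a b. a < b \<and> b < a + pi \<and> y - x = m b - m a)" for y
    proof -
      have "\<not> succ X x y" for X using that unfolding succ_def by blast
      then show ?thesis unfolding inner_def using I(4) by simp
    qed
    \<comment> \<open>\<open>succ\<close> only asserts that some translate exists;
      \<open>chord_unique\<close> turns it into the condition for the particular one given by
      \<open>a\<close>, which is a product event.\<close>
    have inner_Q: "inner x (x + (m b - m a)) = Q (x - m a) ^ card I0" if "a < b" "b < a + pi" for a b
    proof -
      let ?y = "x + (m b - m a)"
      let ?B = "{z. z - (x - m a) \<in> M}"
      have [measurable]: "?B \<in> sets borel"
      proof -
        have "{z \<in> space borel. z - (x - m a) \<in> M} \<in> sets borel" by measurable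
        then show ?thesis by simp
      qed
      have "succ (insert x (insert ?y Z)) x ?y \<longleftrightarrow> (\<forall>z\<in>Z. z \<in> ?B)" for Z
      proof
        assume "succ (insert x (insert ?y Z)) x ?y"
        then obtain a' b' where *: "a' < b'" "b' < a' + pi" "m b - m a = m b' - m a'" "allowed (insert x (insert ?y Z)) x a'"
          by (auto simp: succ_def)
        then have "m a' = m a" using chord_unique[OF that *(1,2,3)] by simp
        then show "\<forall>z\<in>Z. z \<in> ?B" using *(4) by (auto simp: allowed_def algebra_simps)
      next
        assume "\<forall>z\<in>Z. z \<in> ?B"
        then have "allowed (insert x (insert ?y Z)) x a" by (auto simp: allowed_def algebra_simps)
        then show "succ (insert x (insert ?y Z)) x ?y" unfolding succ_def using that by auto
      qed
      then have "?f ((w(j := ?y))(i := x)) = indicator {w. \<forall>k\<in>I0. w k \<in> ?B} w" for w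
        unfolding img using I(4) by (simp add: of_bool_def indicator_def)
      then have "inner x ?y = (\<integral>\<^sup>+w. indicator {w. \<forall>k\<in>I0. w k \<in> ?B} w \<partial>PiM I0 (\<lambda>_. \<mu>))"
        unfolding inner_def by simp
      also have "\<dots> = (\<integral>\<^sup>+w. indicator (Pi\<^sub>E I0 (\<lambda>_. ?B)) w \<partial>PiM I0 (\<lambda>_. \<mu>))"
        by (rule nn_integral_cong) (auto simp: indicator_def space_PiM PiE_def Pi_def)
      also have "\<dots> = emeasure (PiM I0 (\<lambda>_. \<mu>)) (Pi\<^sub>E I0 (\<lambda>_. ?B))"
        using II(4) by (intro nn_integral_indicator sets_PiM_I_finite) auto
      also have "\<dots> = Q (x - m a) ^ card I0"
        using II(4) by (subst prod.emeasure_PiM) (auto simp: Q_def)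
      finally show ?thesis .
    qed
    have "(\<integral>\<^sup>+y. inner x y \<partial>\<mu>) = (\<integral>\<^sup>+y. inner x y * indicator K y \<partial>lborel) / ennreal (measure lborel K)"
      by (rule nn_mu) measurable
    also have "(\<integral>\<^sup>+y. inner x y * indicator K y \<partial>lborel) = (\<integral>\<^sup>+a. \<integral>\<^sup>+b. indicator arcs (a, b) *
       (ennreal (r a * r b * sin (b - a)) * (inner x (x + (m b - m a)) * indicator K (x + (m b - m a)))) \<partial>lborel \<partial>lborel)"
    proof (rule chord_change)
      show "inner x y * indicator K y \<le> 1" for y using inner_1[of y] by (auto simp: indicator_def)
    qed (use inner_0 in \<open>auto simp: indicator_def\<close>)
    also have "\<dots> = (\<integral>\<^sup>+a. \<integral>\<^sup>+b. indicator arcs (a, b) * (ennreal (r a * r b * sin (b - a)) *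
      (indicator K (x + (m b - m a)) * Q (x - m a) ^ (card I - 2))) \<partial>lborel \<partial>lborel)"
    proof (intro nn_integral_cong)
      fix a b
      show "indicator arcs (a, b) * (ennreal (r a * r b * sin (b - a)) * (inner x (x + (m b - m a)) * indicator K (x + (m b - m a))))
        = indicator arcs (a, b) * (ennreal (r a * r b * sin (b - a)) * (indicator K (x + (m b - m a)) * Q (x - m a) ^ (card I - 2)))"
      proof (cases "(a, b) \<in> arcs")
        case True
        then have "a < b" "b < a + pi" by (auto simp: arcs_def)
        from inner_Q[OF this] show ?thesis by (simp add: cI0 mult.commute)
      qed simp
    qed
    finally show "(\<integral>\<^sup>+y. inner x y \<partial>\<mu>) = (\<integral>\<^sup>+a. \<integral>\<^sup>+b. indicator arcs (a, b) * (ennreal (r a * r b * sin (b - a)) *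
      (indicator K (x + (m b - m a)) * Q (x - m a) ^ (card I - 2))) \<partial>lborel \<partial>lborel) / ennreal (measure lborel K)" .
  qed
  finally show ?thesis .
qed

lemma expectation_f0_PiM:
  fixes I :: "nat set"
  assumes I: "finite I" "card I \<ge> 2"
  shows "(\<integral>\<^sup>+v. ennreal (real (f0 M (v ` I))) \<partial>PiM I (\<lambda>_. \<mu>)) = of_nat (card I * (card I - 1)) * T (card I - 2)"
proof -
  let ?N = "PiM I (\<lambda>_. \<mu>)"
  have ae: "AE v in ?N. (\<forall>i\<in>I. \<forall>j\<in>I. i \<noteq> j \<longrightarrow> v i \<noteq> v j) \<and>
    (\<forall>i\<in>I. \<forall>j\<in>I. \<forall>k\<in>I. k \<noteq> i \<longrightarrow> k \<noteq> j \<longrightarrow> \<not> cocircular (v i) (v j) (v k))"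
  proof (intro AE_conjI AE_finite_allI[OF I(1)])
    fix i j assume "i \<in> I" "j \<in> I"
    then show "AE v in ?N. i \<noteq> j \<longrightarrow> v i \<noteq> v j" using AE_distinct[OF I(1)] by (cases "i = j") auto
  next
    fix i j k assume "i \<in> I" "j \<in> I" "k \<in> I"
    then show "AE v in ?N. k \<noteq> i \<longrightarrow> k \<noteq> j \<longrightarrow> \<not> cocircular (v i) (v j) (v k)"
      using AE_generic[OF I(1)] by (cases "k = i \<or> k = j") auto
  qed
  have "(\<integral>\<^sup>+v. ennreal (real (f0 M (v ` I))) \<partial>?N) = (\<integral>\<^sup>+v. (\<Sum>i\<in>I. \<Sum>j\<in>I - {i}. of_bool (succ (v ` I) (v i) (v j))) \<partial>?N)"
  proof (rule nn_integral_cong_AE)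
    from ae show "AE v in ?N. ennreal (real (f0 M (v ` I))) = (\<Sum>i\<in>I. \<Sum>j\<in>I - {i}. of_bool (succ (v ` I) (v i) (v j)))"
    proof eventually_elim
      case (elim v)
      have "f0 M (v ` I) = (\<Sum>i\<in>I. \<Sum>j\<in>I - {i}. of_bool (succ (v ` I) (v i) (v j)))"
        by (rule f0_eq_sum_succ[OF I]) (use elim in \<open>auto simp: inj_on_def\<close>)
      have "ennreal (real (f0 M (v ` I))) = of_nat (f0 M (v ` I))" by (rule ennreal_of_nat_eq_real_of_nat[symmetric])
      also have "\<dots> = (\<Sum>i\<in>I. \<Sum>j\<in>I - {i}. of_bool (succ (v ` I) (v i) (v j)))"
        unfolding \<open>f0 M (v ` I) = _\<close> of_nat_sum of_nat_of_bool ..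
      finally show ?case .
    qed
  qed
  also have "\<dots> = (\<Sum>i\<in>I. \<Sum>j\<in>I - {i}. (\<integral>\<^sup>+v. of_bool (succ (v ` I) (v i) (v j)) \<partial>?N))"
  proof -
    have sm: "(\<lambda>v. of_bool (succ (v ` I) (v i) (v j)) :: ennreal) \<in> borel_measurable ?N" if "i \<in> I" "j \<in> I" for i j
    proof -
      have "Measurable.pred ?N (\<lambda>v. succ (v ` I) (v i) (v j))"
        unfolding pred_def using succ_measurable[of I i j "\<lambda>k v. v k" ?N] I that comp_meas by simp
      then show ?thesis unfolding of_bool_def by measurable
    qed
    then show ?thesis by (subst nn_integral_sum; (intro sum.cong nn_integral_sum borel_measurable_sum refl)?) auto
  qed
  also have "\<dots> = (\<Sum>i\<in>I. \<Sum>j\<in>I - {i}. T (card I - 2))"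
    by (intro sum.cong refl succ_integral) (use I in auto)
  also have "\<dots> = of_nat (card I * (card I - 1)) * T (card I - 2)"
    using I by (simp add: sum_constant card_Diff_singleton mult.assoc)
  finally show ?thesis .
qed

text \<open>Independence together with the common distribution says that the sample is distributed
  as the product measure, to which the count is transported. The count is at most \<open>n\<close>,
  so the expectation is the nonnegative integral.\<close>

theorem expectation_f0:
  fixes X :: "nat \<Rightarrow> 'w \<Rightarrow> real^2"
  assumes P: "prob_space P" and n: "n \<ge> 2"
    and indep: "prob_space.indep_vars P (\<lambda>_. borel) X {1..n}"
    and distr: "\<And>i. i \<in> {1..n} \<Longrightarrow> distr P borel (X i) = uniform_measure lborel K"
  shows "ennreal (\<integral>\<omega>. real (f0 M ((\<lambda>i. X i \<omega>) ` {1..n})) \<partial>P) = of_nat (n * (n - 1)) * T (n - 2)"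
proof -
  interpret P: prob_space P by fact
  let ?I = "{1..n}"
  have Xm: "X i \<in> borel_measurable P" if "i \<in> ?I" for i using indep that by (auto simp: P.indep_vars_def)
  have fm: "(\<lambda>\<omega>. real (f0 M ((\<lambda>i. X i \<omega>) ` ?I))) \<in> borel_measurable P" by (rule f0_measurable) (use Xm in auto)
  have fb: "f0 M (x ` ?I) \<le> n" for x :: "nat \<Rightarrow> real^2"
  proof -
    have "card {z \<in> x ` ?I. vertex (x ` ?I) z} \<le> card (x ` ?I)" by (intro card_mono) auto
    also have "\<dots> \<le> n" using card_image_le[of ?I x] by simp
    finally show ?thesis by (simp add: f0_eq_card)
  qed
  have "integrable P (\<lambda>\<omega>. real (f0 M ((\<lambda>i. X i \<omega>) ` ?I)))"
    by (rule P.integrable_const_bound[of _ "real n"]) (use fm fb in auto)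
  then have "ennreal (\<integral>\<omega>. real (f0 M ((\<lambda>i. X i \<omega>) ` ?I)) \<partial>P) = (\<integral>\<^sup>+\<omega>. ennreal (real (f0 M ((\<lambda>i. X i \<omega>) ` ?I))) \<partial>P)"
    by (subst nn_integral_eq_integral) auto
  also have "\<dots> = (\<integral>\<^sup>+v. ennreal (real (f0 M (v ` ?I))) \<partial>distr P (PiM ?I (\<lambda>_. borel)) (\<lambda>\<omega>. \<lambda>i\<in>?I. X i \<omega>))"
  proof -
    have m1: "(\<lambda>\<omega>. \<lambda>i\<in>?I. X i \<omega>) \<in> P \<rightarrow>\<^sub>M PiM ?I (\<lambda>_. borel)"
      by (intro measurable_restrict) (use Xm in auto)
    have m2: "(\<lambda>v. real (f0 M (v ` ?I))) \<in> borel_measurable (PiM ?I (\<lambda>_. borel))"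
      using f0_measurable[of ?I "\<lambda>k v. v k" "PiM ?I (\<lambda>_. borel)"] by simp
    have "(\<lambda>i\<in>?I. X i \<omega>) ` ?I = (\<lambda>i. X i \<omega>) ` ?I" for \<omega> by (intro image_cong) auto
    then show ?thesis using m2 by (subst nn_integral_distr[OF m1]) auto
  qed
  also have "distr P (PiM ?I (\<lambda>_. borel)) (\<lambda>\<omega>. \<lambda>i\<in>?I. X i \<omega>) = PiM ?I (\<lambda>i. distr P borel (X i))"
    by (subst P.indep_vars_iff_distr_eq_PiM'[symmetric]) (use n Xm indep in auto)
  also have "\<dots> = PiM ?I (\<lambda>_. \<mu>)" by (intro PiM_cong) (use distr in \<open>auto simp: \<mu>_def\<close>)
  also have "(\<integral>\<^sup>+v. ennreal (real (f0 M (v ` ?I))) \<partial>PiM ?I (\<lambda>_. \<mu>)) = of_nat (n * (n - 1)) * T (n - 2)"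
    using expectation_f0_PiM[of ?I] n by simp
  finally show ?thesis .
qed

end

section \<open>Parabolic rescaling\<close>

lemma tendsto_sin_mult_div:
  fixes e :: "nat \<Rightarrow> real"
  assumes "\<And>n. e n > 0" "e \<longlonglongrightarrow> 0"
  shows "(\<lambda>n. sin (e n * u) / e n) \<longlonglongrightarrow> u"
proof -
  have "((\<lambda>t. sin (t * u)) has_real_derivative u) (at 0)"
    by (auto intro!: derivative_eq_intros)
  then have l: "((\<lambda>t. sin (t * u) / t) \<longlongrightarrow> u) (at 0)" by (simp add: has_field_derivative_iff)
  have "filterlim e (at 0) sequentially"
    unfolding filterlim_at using assms by (auto intro!: always_eventually simp: less_imp_neq[symmetric])
  from filterlim_compose[OF l this] show ?thesis by simp
qed

lemma tendsto_one_minus_cos_div: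
  fixes e :: "nat \<Rightarrow> real"
  assumes "\<And>n. e n > 0" "e \<longlonglongrightarrow> 0"
  shows "(\<lambda>n. (1 - cos (e n * u)) / (e n)\<^sup>2) \<longlonglongrightarrow> u\<^sup>2 / 2"
proof -
  have l: "(\<lambda>n. 2 * (sin (e n * (u / 2)) / e n)\<^sup>2) \<longlonglongrightarrow> 2 * (u / 2)\<^sup>2"
    by (intro tendsto_intros tendsto_sin_mult_div assms)
  have eq: "2 * (sin (e n * (u / 2)) / e n)\<^sup>2 = (1 - cos (e n * u)) / (e n)\<^sup>2" for n
  proof -
    have "cos (e n * u) = 1 - 2 * (sin (e n * (u / 2)))\<^sup>2"
      using cos_double_sin[of "e n * (u / 2)"] by simp
    then show ?thesis by (simp add: power_divide)
  qed
  show ?thesis using l unfolding eq by (simp add: power_divide)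
qed

context oval begin

lemma tangent_limit:
  assumes "\<And>n. e n > 0" "e \<longlonglongrightarrow> 0"
  shows "(\<lambda>n. W a \<bullet> (m (a + e n * u) - m a) / e n) \<longlonglongrightarrow> r a * u"
proof -
  have "((\<lambda>t. a + t * u) has_vector_derivative u) (at 0)"
    unfolding has_real_derivative_iff_has_vector_derivative[symmetric] by (auto intro!: derivative_eq_intros)
  then have "((\<lambda>t. m (a + t * u)) has_vector_derivative u *\<^sub>R r a *\<^sub>R W a) (at 0)"
    using vector_diff_chain_at[of "\<lambda>t. a + t * u" u 0 m "r a *\<^sub>R W a"] der[of a] by (simp add: o_def)
  then have "((\<lambda>t. W a \<bullet> (m (a + t * u) - m a)) has_vector_derivative W a \<bullet> (u *\<^sub>R r a *\<^sub>R W a - 0)) (at 0)"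
    by (intro bounded_linear.has_vector_derivative[OF bounded_linear_inner_right]
        has_vector_derivative_diff has_vector_derivative_const)
  then have "((\<lambda>t. W a \<bullet> (m (a + t * u) - m a)) has_real_derivative r a * u) (at 0)"
    by (simp add: has_real_derivative_iff_has_vector_derivative W_inner_W mult.commute)
  then have l: "((\<lambda>t. W a \<bullet> (m (a + t * u) - m a) / t) \<longlongrightarrow> r a * u) (at 0)" by (simp add: has_field_derivative_iff)
  have "filterlim e (at 0) sequentially"
    unfolding filterlim_at using assms by (auto intro!: always_eventually simp: less_imp_neq[symmetric])
  from filterlim_compose[OF l this] show ?thesis by simp
qed

text \<open>The neighbourhood is kept within half a turn, so that the turning inequalities apply on
  it.\<close>

lemma r_near:
  assumes "0 < \<epsilon>"
  obtains d where "0 < d" "d \<le> pi" "\<And>s. \<bar>s - a\<bar> \<le> d \<Longrightarrow> \<bar>r s - r a\<bar> < \<epsilon>"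
proof -
  obtain d where d: "d > 0" "\<And>s. dist s a < d \<Longrightarrow> dist (r s) (r a) < \<epsilon>"
    using cont_r assms unfolding continuous_on_iff by (metis UNIV_I)
  show ?thesis
  proof (rule that[of "min (d / 2) pi"])
    fix s assume "\<bar>s - a\<bar> \<le> min (d / 2) pi"
    then show "\<bar>r s - r a\<bar> < \<epsilon>" using d(2)[of s] d(1) by (simp add: dist_real_def)
  qed (use d in auto)
qed

text \<open>\<open>r\<close> is merely continuous, so the second order behaviour is squeezed between
  circles of radii slightly below and above \<open>r a\<close>.\<close>

lemma normal_limit:
  assumes e: "\<And>n. e n > 0" "e \<longlonglongrightarrow> 0"
  shows "(\<lambda>n. U a \<bullet> (m (a + e n * u) - m a) / (e n)\<^sup>2) \<longlonglongrightarrow> - (r a * u\<^sup>2 / 2)"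
proof (rule LIMSEQ_I)
  fix \<epsilon> :: real assume ep: "0 < \<epsilon>"
  \<comment> \<open>Chosen so that an error \<eta> in the radius, multiplied by the bound for the
    rescaled versine, costs half of \<epsilon>.\<close>
  define \<eta> where "\<eta> = \<epsilon> / (2 * (u\<^sup>2 / 2 + 1))"
  have pos: "0 < u\<^sup>2 / 2 + 1" by (simp add: add_nonneg_pos)
  have eta: "0 < \<eta>" using ep pos by (simp add: \<eta>_def)
  obtain d where d: "0 < d" "d \<le> pi" "\<And>s. \<bar>s - a\<bar> \<le> d \<Longrightarrow> \<bar>r s - r a\<bar> < \<eta>" using r_near[OF eta] by blast
  have L: "(\<lambda>n. (1 - cos (e n * u)) / (e n)\<^sup>2) \<longlonglongrightarrow> u\<^sup>2 / 2" by (rule tendsto_one_minus_cos_div[OF e])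
  have l1: "\<forall>\<^sub>F n in sequentially. (1 - cos (e n * u)) / (e n)\<^sup>2 < u\<^sup>2 / 2 + 1"
    by (rule order_tendstoD(2)[OF L]) simp
  have "(\<lambda>n. r a * ((1 - cos (e n * u)) / (e n)\<^sup>2)) \<longlonglongrightarrow> r a * (u\<^sup>2 / 2)" by (intro tendsto_intros L)
  then have l2: "\<forall>\<^sub>F n in sequentially. \<bar>r a * ((1 - cos (e n * u)) / (e n)\<^sup>2) - r a * (u\<^sup>2 / 2)\<bar> < \<epsilon> / 2"
    using tendstoD[of _ "r a * (u\<^sup>2 / 2)" sequentially "\<epsilon> / 2"] ep unfolding dist_real_def by simp
  have "(\<lambda>n. e n * u) \<longlonglongrightarrow> 0 * u" by (intro tendsto_intros e)
  then have "(\<lambda>n. e n * u) \<longlonglongrightarrow> 0" by simp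
  then have l3: "\<forall>\<^sub>F n in sequentially. \<bar>e n * u\<bar> < d" using d(1) by (auto simp: tendsto_iff dist_real_def)
  have "\<forall>\<^sub>F n in sequentially. norm (U a \<bullet> (m (a + e n * u) - m a) / (e n)\<^sup>2 - - (r a * u\<^sup>2 / 2)) < \<epsilon>"
    using l1 l2 l3
  proof eventually_elim
    case (elim n)
    let ?c = "1 - cos (e n * u)" and ?x = "U a \<bullet> (m (a + e n * u) - m a)"
    have seg: "\<bar>r s - r a\<bar> < \<eta>" if "s \<in> closed_segment a (a + e n * u)" for s
      using that elim(3) by (intro d(3)) (auto simp: closed_segment_eq_real_ivl split: if_splits)
    have "?x \<le> - (r a - \<eta>) * (1 - cos (a + e n * u - a))"
      by (rule turning_le[OF der]) (use seg elim(3) d(2) in \<open>auto simp: abs_less_iff less_imp_le intro: less_imp_le\<close>, smt (verit) seg)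
    moreover have "- (r a + \<eta>) * (1 - cos (a + e n * u - a)) \<le> ?x"
      by (rule turning_ge[OF der]) (use seg elim(3) d(2) in \<open>auto simp: abs_less_iff less_imp_le intro: less_imp_le\<close>, smt (verit) seg)
    ultimately have "\<bar>?x + r a * ?c\<bar> \<le> \<eta> * ?c" by (simp add: algebra_simps abs_le_iff)
    then have "\<bar>?x + r a * ?c\<bar> / (e n)\<^sup>2 \<le> \<eta> * ?c / (e n)\<^sup>2" by (rule divide_right_mono) simp
    moreover have "\<eta> * ?c / (e n)\<^sup>2 \<le> \<eta> * (u\<^sup>2 / 2 + 1)" using elim(1) eta by (simp only: times_divide_eq_right[symmetric]) (intro mult_left_mono, auto)
    moreover have "\<eta> * (u\<^sup>2 / 2 + 1) = \<epsilon> / 2" using pos unfolding \<eta>_def by (simp add: field_simps)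
    moreover have "\<bar>?x + r a * ?c\<bar> / (e n)\<^sup>2 = \<bar>?x / (e n)\<^sup>2 + r a * (?c / (e n)\<^sup>2)\<bar>"
    proof -
      have "?x / (e n)\<^sup>2 + r a * (?c / (e n)\<^sup>2) = (?x + r a * ?c) / (e n)\<^sup>2" by (simp add: add_divide_distrib)
      then show ?thesis by (simp add: abs_divide)
    qed
    ultimately have "\<bar>?x / (e n)\<^sup>2 + r a * (?c / (e n)\<^sup>2)\<bar> \<le> \<epsilon> / 2" by linarith
    then have "\<bar>?x / (e n)\<^sup>2 + r a * (u\<^sup>2 / 2)\<bar> < \<epsilon>" using elim(2) by linarith
    then show ?case by simp
  qed
  then show "\<exists>no. \<forall>n\<ge>no. norm (U a \<bullet> (m (a + e n * u) - m a) / (e n)\<^sup>2 - - (r a * u\<^sup>2 / 2)) < \<epsilon>"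
    by (simp add: eventually_sequentially)
qed

text \<open>In parabolically rescaled coordinates at a boundary point, an oval becomes the region above the
  osculating parabola.\<close>

lemma eventually_above_parabola:
  assumes e: "\<And>n. e n > 0" "e \<longlonglongrightarrow> 0" and x: "x \<longlonglongrightarrow> x0" and y: "y \<longlonglongrightarrow> y0" and gt: "x0\<^sup>2 / (2 * r a) < y0"
  shows "\<forall>\<^sub>F n in sequentially. m a + (e n * x n) *\<^sub>R W a - ((e n)\<^sup>2 * y n) *\<^sub>R U a \<in> M"
proof -
  have ra: "0 < r a" by (rule r_pos)
  have "0 \<le> x0\<^sup>2 / (2 * r a)" using ra by simp
  then have y0: "0 < y0" using gt by linarith
  have "x0\<^sup>2 / (2 * y0) < r a" using gt ra y0 by (simp add: field_simps)
  moreover have "0 < r a" by fact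
  \<comment> \<open>A radius below that of the osculating circle whose parabola is still below the
    limit point.\<close>
  ultimately obtain c where c: "x0\<^sup>2 / (2 * y0) < c" "c < r a" using dense by blast
  have "0 \<le> x0\<^sup>2 / (2 * y0)" using y0 by simp
  then have c0: "0 < c" using c by linarith
  obtain d where d: "0 < d" "d \<le> pi" "\<And>s. \<bar>s - a\<bar> \<le> d \<Longrightarrow> \<bar>r s - r a\<bar> < r a - c"
    using r_near[of "r a - c" a] c by (metis diff_gt_0_iff_gt)
  obtain c1 where c1: "0 < c1" "\<And>s. c1 \<le> r s" by (rule r_lower) blast
  have cd: "cos d < 1" using cos_monotone_0_pi[of 0 d] d by simp
  define p where "p n = m a + (e n * x n) *\<^sub>R W a - ((e n)\<^sup>2 * y n) *\<^sub>R U a" for n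
  have "(\<lambda>n. (x n)\<^sup>2 + (e n)\<^sup>2 * (y n)\<^sup>2 - 2 * c * y n) \<longlonglongrightarrow> x0\<^sup>2 + 0\<^sup>2 * y0\<^sup>2 - 2 * c * y0"
    by (intro tendsto_intros x y e)
  moreover have "x0\<^sup>2 + 0\<^sup>2 * y0\<^sup>2 - 2 * c * y0 < 0" using c(1) y0 by (simp add: field_simps)
  ultimately have l1: "\<forall>\<^sub>F n in sequentially. (x n)\<^sup>2 + (e n)\<^sup>2 * (y n)\<^sup>2 - 2 * c * y n < 0"
    by (rule order_tendstoD(2))
  have "(\<lambda>n. norm ((e n * x n) *\<^sub>R W a - ((e n)\<^sup>2 * y n) *\<^sub>R U a)) \<longlonglongrightarrow> norm ((0 * x0) *\<^sub>R W a - (0\<^sup>2 * y0) *\<^sub>R U a)"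
    by (intro tendsto_intros x y e)
  then have l2: "\<forall>\<^sub>F n in sequentially. norm ((e n * x n) *\<^sub>R W a - ((e n)\<^sup>2 * y n) *\<^sub>R U a) < c1 * (1 - cos d)"
    by (rule order_tendstoD(2)) (use c1 cd in simp)
  show ?thesis using l1 l2
  proof eventually_elim
    case (elim n)
    have "p n \<in> M" unfolding mem_local[of _ a]
    proof (intro allI impI)
      fix \<phi> assume phi: "\<bar>\<phi> - a\<bar> \<le> pi"
      show "U \<phi> \<bullet> (p n - m \<phi>) \<le> 0"
      \<comment> \<open>Normals near \<open>a\<close> are handled by the tangent disc of radius
        \<open>c\<close>. For the others the distance of \<open>m a\<close> from the supporting line
        is bounded below and exceeds the small displacement.\<close>
      proof (cases "\<bar>\<phi> - a\<bar> \<le> d")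
        case True
        show ?thesis
        proof (rule inner_ball_local[where c = c and \<theta> = a])
          show "c \<le> r s" if "s \<in> closed_segment a \<phi>" for s
          proof -
            have "\<bar>s - a\<bar> \<le> d" using that True by (auto simp: closed_segment_eq_real_ivl split: if_splits)
            then show ?thesis using d(3)[of s] by linarith
          qed
          have "p n - (m a - c *\<^sub>R U a) = (e n * x n) *\<^sub>R W a + (c - (e n)\<^sup>2 * y n) *\<^sub>R U a"
            by (simp add: p_def algebra_simps)
          then have "(norm (p n - (m a - c *\<^sub>R U a)))\<^sup>2 = (e n * x n)\<^sup>2 + (c - (e n)\<^sup>2 * y n)\<^sup>2" by (simp only: norm_UW)
          also have "\<dots> = c\<^sup>2 + (e n)\<^sup>2 * ((x n)\<^sup>2 + (e n)\<^sup>2 * (y n)\<^sup>2 - 2 * c * y n)"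
            by (simp add: power2_eq_square algebra_simps)
          also have "\<dots> \<le> c\<^sup>2" using elim(1) by (simp add: mult_nonneg_nonpos)
          finally show "norm (p n - (m a - c *\<^sub>R U a)) \<le> c" using c0 by (simp add: power2_le_iff_abs_le)
        qed fact
      next
        case False
        have "U \<phi> \<bullet> (p n - m \<phi>) = U \<phi> \<bullet> ((e n * x n) *\<^sub>R W a - ((e n)\<^sup>2 * y n) *\<^sub>R U a) + U \<phi> \<bullet> (m a - m \<phi>)"
          by (simp add: p_def inner_diff_right inner_add_right)
        also have "\<dots> \<le> norm ((e n * x n) *\<^sub>R W a - ((e n)\<^sup>2 * y n) *\<^sub>R U a) - c1 * (1 - cos (a - \<phi>))"
        proof -
          have "U \<phi> \<bullet> (m a - m \<phi>) \<le> - c1 * (1 - cos (a - \<phi>))"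
            by (rule turning_le[OF der]) (use c1 phi in \<open>auto simp: abs_minus_commute\<close>)
          moreover have "U \<phi> \<bullet> ((e n * x n) *\<^sub>R W a - ((e n)\<^sup>2 * y n) *\<^sub>R U a) \<le> norm ((e n * x n) *\<^sub>R W a - ((e n)\<^sup>2 * y n) *\<^sub>R U a)"
            using norm_cauchy_schwarz[of "U \<phi>" "(e n * x n) *\<^sub>R W a - ((e n)\<^sup>2 * y n) *\<^sub>R U a"] by simp
          ultimately show ?thesis by simp
        qed
        also have "\<dots> \<le> c1 * (1 - cos d) - c1 * (1 - cos (a - \<phi>))" using elim(2) by simp
        also have "\<dots> \<le> 0"
        proof -
          have "cos (a - \<phi>) = cos \<bar>\<phi> - a\<bar>" using cos_minus[of "\<phi> - a"] by simp
          also have "\<dots> \<le> cos d" using False phi d by (intro cos_monotone_0_pi_le) auto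
          finally show ?thesis using c1 by simp
        qed
        finally show ?thesis .
      qed
    qed
    then show ?case by (simp add: p_def)
  qed
qed

text \<open>A single violated half-plane suffices; its normal angle deviates from \<open>a\<close>
  by a multiple of \<open>e n\<close>.\<close>

lemma eventually_below_parabola:
  assumes e: "\<And>n. e n > 0" "e \<longlonglongrightarrow> 0" and x: "x \<longlonglongrightarrow> x0" and y: "y \<longlonglongrightarrow> y0" and lt: "y0 < x0\<^sup>2 / (2 * r a)"
  shows "\<forall>\<^sub>F n in sequentially. m a + (e n * x n) *\<^sub>R W a - ((e n)\<^sup>2 * y n) *\<^sub>R U a \<notin> M"
proof -
  have ra: "0 < r a" by (rule r_pos)
  obtain c where c: "r a < c" "y0 < x0\<^sup>2 / (2 * c)"
  proof -
    have "((\<lambda>c. x0\<^sup>2 / (2 * c)) \<longlongrightarrow> x0\<^sup>2 / (2 * r a)) (at_right (r a))"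
      using ra by (intro tendsto_intros) auto
    then have "\<forall>\<^sub>F c in at_right (r a). y0 < x0\<^sup>2 / (2 * c)" using lt by (rule order_tendstoD(1))
    moreover have "\<forall>\<^sub>F c in at_right (r a). r a < c" by (rule eventually_at_right_less)
    ultimately have "\<forall>\<^sub>F c in at_right (r a). r a < c \<and> y0 < x0\<^sup>2 / (2 * c)" by eventually_elim blast
    from eventually_happens[OF this] show ?thesis using that by auto
  qed
  have c0: "0 < c" using c ra by linarith
  obtain d where d: "0 < d" "d \<le> pi" "\<And>s. \<bar>s - a\<bar> \<le> d \<Longrightarrow> \<bar>r s - r a\<bar> < c - r a"
    using r_near[of "c - r a" a] c by (metis diff_gt_0_iff_gt)
  \<comment> \<open>This \<open>u\<close> maximizes \<open>x0 * u - c * u\<^sup>2 / 2\<close>; the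
    maximum \<open>x0\<^sup>2 / (2 * c)\<close> still exceeds \<open>y0\<close>.\<close>
  define u where "u = x0 / c"
  define p where "p n = m a + (e n * x n) *\<^sub>R W a - ((e n)\<^sup>2 * y n) *\<^sub>R U a" for n
  have eu: "(\<lambda>n. e n * u) \<longlonglongrightarrow> 0" using tendsto_mult[OF e(2) tendsto_const, of u] by simp
  have "(\<lambda>n. x n * (sin (e n * u) / e n) - y n * cos (e n * u) - c * ((1 - cos (e n * u)) / (e n)\<^sup>2))
    \<longlonglongrightarrow> x0 * u - y0 * cos 0 - c * (u\<^sup>2 / 2)"
    by (intro tendsto_intros x y eu tendsto_sin_mult_div tendsto_one_minus_cos_div e)
  moreover have "0 < x0 * u - y0 * cos 0 - c * (u\<^sup>2 / 2)"
    using c(2) c0 by (simp add: u_def power2_eq_square field_simps)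
  ultimately have l1: "\<forall>\<^sub>F n in sequentially. 0 < x n * (sin (e n * u) / e n) - y n * cos (e n * u) - c * ((1 - cos (e n * u)) / (e n)\<^sup>2)"
    by (rule order_tendstoD(1))
  have l2: "\<forall>\<^sub>F n in sequentially. \<bar>e n * u\<bar> < d" using eu d(1) by (auto simp: tendsto_iff dist_real_def)
  show ?thesis using l1 l2
  proof eventually_elim
    case (elim n)
    define \<phi> where "\<phi> = a + e n * u"
    have pa: "\<phi> - a = e n * u" "a - \<phi> = - (e n * u)" by (simp_all add: \<phi>_def)
    have "- c * (1 - cos (a - \<phi>)) \<le> U \<phi> \<bullet> (m a - m \<phi>)"
    proof (rule turning_ge[OF der])
      show "r s \<le> c" if "s \<in> closed_segment \<phi> a" for s
      proof -
        have "\<bar>s - a\<bar> \<le> d" using that elim(2) by (auto simp: \<phi>_def closed_segment_eq_real_ivl split: if_splits)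
        then show ?thesis using d(3)[of s] by linarith
      qed
      show "\<bar>a - \<phi>\<bar> \<le> pi" unfolding pa using elim(2) d(2) by simp
    qed
    moreover have "U \<phi> \<bullet> (p n - m \<phi>) = e n * x n * sin (e n * u) - (e n)\<^sup>2 * y n * cos (e n * u) + U \<phi> \<bullet> (m a - m \<phi>)"
      by (simp add: p_def inner_diff_right inner_add_right U_inner_W U_inner_U pa)
    moreover have "0 < (e n)\<^sup>2 * (x n * (sin (e n * u) / e n) - y n * cos (e n * u) - c * ((1 - cos (e n * u)) / (e n)\<^sup>2))"
      using elim(1) e(1)[of n] by simp
    moreover have "(e n)\<^sup>2 * (x n * (sin (e n * u) / e n) - y n * cos (e n * u) - c * ((1 - cos (e n * u)) / (e n)\<^sup>2))
      = e n * x n * sin (e n * u) - (e n)\<^sup>2 * y n * cos (e n * u) - c * (1 - cos (e n * u))"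
      using e(1)[of n] by (simp add: power2_eq_square field_simps)
    ultimately have "0 < U \<phi> \<bullet> (p n - m \<phi>)" unfolding pa by simp
    then show ?case using mem_iff unfolding p_def[symmetric] by (meson not_less)
  qed
qed

end

lemma emeasure_open_interval: "emeasure lborel {x. a < x \<and> x < b} = ennreal (b - a)" for a b :: real
proof -
  have e: "{x. a < x \<and> x < b} = {a<..<b}" by auto
  show ?thesis unfolding e by (cases "a \<le> b") (simp_all add: ennreal_neg)
qed

text \<open>The quadrature of Archimedes: two thirds of the height \<open>s\<close> times the base,
  which is twice the square root. Outside the base the integrand is truncated to zero by
  \<open>ennreal\<close>.\<close>

lemma nn_integral_inverted_parabola:
  assumes s: "0 \<le> s" and k: "0 < k"
  shows "(\<integral>\<^sup>+x. ennreal (s - k / 2 * (x - c)\<^sup>2) \<partial>lborel) = ennreal (4 / 3 * s * sqrt (2 * s / k))"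
proof -
  define w where "w = sqrt (2 * s / k)"
  have w: "0 \<le> w" "k * w\<^sup>2 = 2 * s" using s k by (simp_all add: w_def)
  have "(\<integral>\<^sup>+x. ennreal (s - k / 2 * (x - c)\<^sup>2) \<partial>lborel) = ennreal \<bar>1\<bar> * (\<integral>\<^sup>+x. ennreal (s - k / 2 * ((c + 1 * x) - c)\<^sup>2) \<partial>lborel)"
    by (rule nn_integral_real_affine) auto
  also have "\<dots> = (\<integral>\<^sup>+x. ennreal (s - k / 2 * x\<^sup>2) \<partial>lborel)" by simp
  also have "\<dots> = (\<integral>\<^sup>+x. ennreal (s - k / 2 * x\<^sup>2) * indicator {-w..w} x \<partial>lborel)"
  proof (rule nn_integral_cong)
    fix x :: real
    show "ennreal (s - k / 2 * x\<^sup>2) = ennreal (s - k / 2 * x\<^sup>2) * indicator {-w..w} x"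
    proof (cases "x \<in> {-w..w}")
      case False
      then have "w < \<bar>x\<bar>" by auto
      then have "w\<^sup>2 < x\<^sup>2" using w by (metis abs_of_nonneg abs_square_less_1 power2_abs power2_less_eq_zero_iff power_strict_mono zero_less_numeral)
      then have "k * w\<^sup>2 \<le> k * x\<^sup>2" using k by simp
      then have "s - k / 2 * x\<^sup>2 \<le> 0" using w by simp
      then show ?thesis using False by (simp add: ennreal_neg)
    qed simp
  qed
  also have "\<dots> = ennreal ((s * w - k / 6 * w ^ 3) - (s * (- w) - k / 6 * (- w) ^ 3))"
  proof (rule nn_integral_FTC_Icc[where F = "\<lambda>x. s * x - k / 6 * x ^ 3"])
    show "((\<lambda>x. s * x - k / 6 * x ^ 3) has_real_derivative s - k / 2 * x\<^sup>2) (at x)" for x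
      by (auto intro!: derivative_eq_intros simp: power2_eq_square)
    show "0 \<le> s - k / 2 * x\<^sup>2" if "x \<in> {- w..w}" for x
    proof -
      have "\<bar>x\<bar> \<le> w" using that by auto
      then have "x\<^sup>2 \<le> w\<^sup>2" using w(1) by (metis abs_le_square_iff abs_of_nonneg)
      then have "k * x\<^sup>2 \<le> k * w\<^sup>2" using k by simp
      then show ?thesis using w by simp
    qed
  qed (use w in auto)
  also have "(s * w - k / 6 * w ^ 3) - (s * (- w) - k / 6 * (- w) ^ 3) = 2 * s * w - (k * w\<^sup>2) * w / 3"
    by (simp add: power3_eq_cube power2_eq_square algebra_simps)
  also have "\<dots> = 4 / 3 * s * w" unfolding w(2) by simp
  finally show ?thesis by (simp add: w_def)
qed

section \<open>Rescaled coordinates and the cut-off area\<close>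

text \<open>\<open>M\<close> is translated and \<open>K\<close> is sampled. \<open>R\<close> puts a
  uniform gap between the radii, the quantitative form of the strict curvature inequalities; powers
  of \<open>1 - R\<close> appear in the bounds for the cut-off region and the arc.\<close>

locale oval_pair = uniform_oval M m r K + Ko: oval K k q for M m r K k q +
  fixes R :: real
  assumes r_ge: "1 \<le> r s" and q_le: "q s \<le> R" and R_less: "R < 1"
begin

lemma R_pos: "0 < R" using Ko.r_pos[of 0] q_le[of 0] by linarith

lemma q_less_r: "q s < r s" using q_le[of s] r_ge[of s] R_less by linarith

text \<open>Coordinates at the boundary point \<open>k a\<close>: tangential offset in units of
  \<open>e\<close>, depth along the inner normal in units of \<open>e\<^sup>2\<close>.\<close>

definition P :: "real \<Rightarrow> real \<Rightarrow> real \<Rightarrow> real \<Rightarrow> real^2" where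
  "P e a x y = k a + (e * x) *\<^sub>R W a - (e\<^sup>2 * y) *\<^sub>R U a"

lemma P_diff: "P e a x' y' - P e a x y + m a = m a + (e * (x' - x)) *\<^sub>R W a - (e\<^sup>2 * (y' - y)) *\<^sub>R U a"
  by (simp add: P_def algebra_simps)

text \<open>The enclosing disc of radius \<open>R\<close> in coordinates. Unlike the parabola of the
  limit, it holds at every scale \<open>e\<close>.\<close>

lemma P_in_K:
  assumes e: "e > 0" and PK: "P e a x y \<in> K"
  shows "x\<^sup>2 + e\<^sup>2 * y\<^sup>2 \<le> 2 * R * y"
proof -
  have "norm (P e a x y - (k a - R *\<^sub>R U a)) \<le> R" using Ko.outer_ball[OF q_le PK] .
  moreover have "P e a x y - (k a - R *\<^sub>R U a) = (e * x) *\<^sub>R W a + (R - e\<^sup>2 * y) *\<^sub>R U a"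
    by (simp add: P_def algebra_simps)
  ultimately have "(norm ((e * x) *\<^sub>R W a + (R - e\<^sup>2 * y) *\<^sub>R U a))\<^sup>2 \<le> R\<^sup>2" by (simp add: power_mono)
  then have "(e * x)\<^sup>2 + (R - e\<^sup>2 * y)\<^sup>2 \<le> R\<^sup>2" by (simp only: norm_UW)
  then have "e\<^sup>2 * (x\<^sup>2 + e\<^sup>2 * y\<^sup>2) \<le> e\<^sup>2 * (2 * R * y)" by (simp add: power2_eq_square algebra_simps)
  then show ?thesis using e by (simp add: mult_le_cancel_left)
qed

text \<open>The counterpart for the unit disc contained in \<open>M\<close>, again valid at every
  scale.\<close>

lemma notin_M:
  assumes e: "e > 0" and out: "m a + (e * x) *\<^sub>R W a - (e\<^sup>2 * y) *\<^sub>R U a \<notin> M"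
  shows "2 * y < x\<^sup>2 + e\<^sup>2 * y\<^sup>2"
proof -
  let ?p = "m a + (e * x) *\<^sub>R W a - (e\<^sup>2 * y) *\<^sub>R U a"
  have "\<not> norm (?p - (m a - 1 *\<^sub>R U a)) \<le> 1" using inner_ball[OF r_ge] out by blast
  moreover have "?p - (m a - 1 *\<^sub>R U a) = (e * x) *\<^sub>R W a + (1 - e\<^sup>2 * y) *\<^sub>R U a" by (simp add: algebra_simps)
  ultimately have "1\<^sup>2 < (norm ((e * x) *\<^sub>R W a + (1 - e\<^sup>2 * y) *\<^sub>R U a))\<^sup>2"
    by (intro power_strict_mono) auto
  then have "1 < (e * x)\<^sup>2 + (1 - e\<^sup>2 * y)\<^sup>2" by (simp only: norm_UW) simp
  then have "e\<^sup>2 * (2 * y) < e\<^sup>2 * (x\<^sup>2 + e\<^sup>2 * y\<^sup>2)" by (simp add: power2_eq_square algebra_simps)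
  then show ?thesis using e by (simp add: mult_less_cancel_left)
qed

lemma continuous_P2: "continuous_on S (\<lambda>p. P e a (fst p) (snd p))"
  unfolding P_def by (intro continuous_intros)

text \<open>The chart is affine with constant Jacobian \<open>e ^ 3\<close>. Since \<open>f\<close>
  vanishes off \<open>K\<close>, the coordinates may be restricted to a bounded set, whose size is
  read off from \<open>P_in_K\<close>.\<close>

lemma affine_change:
  assumes e: "e > 0" and f [measurable]: "f \<in> borel_measurable borel" and f1: "\<And>y. f y \<le> 1"
    and f0: "\<And>y. y \<notin> K \<Longrightarrow> f y = 0"
  shows "(\<integral>\<^sup>+y. f y \<partial>lborel) = ennreal (e ^ 3) * (\<integral>\<^sup>+x. \<integral>\<^sup>+y. f (P e a x y) \<partial>lborel \<partial>lborel)"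
proof -
  define D where "D = {p. P e a (fst p) (snd p) \<in> K}"
  have jac: "\<bar>(e *\<^sub>R W a) $ 1 * (- (e\<^sup>2 *\<^sub>R U a)) $ 2 - (- (e\<^sup>2 *\<^sub>R U a)) $ 1 * (e *\<^sub>R W a) $ 2\<bar> = e ^ 3"
  proof -
    have c: "(e *\<^sub>R W a) $ 1 = - (e * sin a)" "(e *\<^sub>R W a) $ 2 = e * cos a"
      "(- (e\<^sup>2 *\<^sub>R U a)) $ 1 = - (e\<^sup>2 * cos a)" "(- (e\<^sup>2 *\<^sub>R U a)) $ 2 = - (e\<^sup>2 * sin a)"
      by simp_all
    have "(e *\<^sub>R W a) $ 1 * (- (e\<^sup>2 *\<^sub>R U a)) $ 2 - (- (e\<^sup>2 *\<^sub>R U a)) $ 1 * (e *\<^sub>R W a) $ 2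
      = e ^ 3 * ((sin a)\<^sup>2 + (cos a)\<^sup>2)"
      unfolding c by algebra
    then show ?thesis using e by simp
  qed
  have cD: "closed D"
  proof -
    have "closed ((\<lambda>p. P e a (fst p) (snd p)) -` K)"
      by (intro continuous_closed_vimage Ko.closed_M) (use continuous_P2[of UNIV] continuous_on_eq_continuous_at in blast)
    then show ?thesis by (simp add: D_def vimage_def)
  qed
  have D_sub: "D \<subseteq> {- 2 / e .. 2 / e} \<times> {0..2 / e\<^sup>2}"
  proof
    fix p assume "p \<in> D"
    then have *: "(fst p)\<^sup>2 + e\<^sup>2 * (snd p)\<^sup>2 \<le> 2 * R * snd p" using P_in_K[OF e] by (simp add: D_def)
    moreover have "0 \<le> (fst p)\<^sup>2 + e\<^sup>2 * (snd p)\<^sup>2" by simp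
    ultimately have "0 \<le> 2 * R * snd p" by linarith
    then have y0: "0 \<le> snd p" using R_pos by (simp add: zero_le_mult_iff)
    have "2 * R * snd p \<le> 2 * 1 * snd p" using y0 R_less R_pos by (intro mult_mono) auto
    then have **: "(fst p)\<^sup>2 + e\<^sup>2 * (snd p)\<^sup>2 \<le> 2 * snd p" using * by linarith
    then have "e\<^sup>2 * (snd p)\<^sup>2 \<le> 2 * snd p" by (smt (verit) zero_le_power2)
    then have "snd p * (e\<^sup>2 * snd p) \<le> snd p * 2" by (simp add: power2_eq_square mult.assoc mult.left_commute)
    then have y2: "e\<^sup>2 * snd p \<le> 2" using y0 by (cases "snd p = 0") (auto simp: mult_le_cancel_left)
    have "(fst p)\<^sup>2 \<le> 2 * snd p" using ** by (smt (verit) mult_nonneg_nonneg zero_le_power2)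
    then have "e\<^sup>2 * (fst p)\<^sup>2 \<le> e\<^sup>2 * (2 * snd p)" using e by simp
    also have "\<dots> = 2 * (e\<^sup>2 * snd p)" by simp
    also have "\<dots> \<le> 2 * 2" by (rule mult_left_mono[OF y2]) simp
    also have "\<dots> = 2\<^sup>2" by simp
    finally have "(e * fst p)\<^sup>2 \<le> 2\<^sup>2" by (simp add: power_mult_distrib)
    then have "\<bar>e * fst p\<bar> \<le> \<bar>2\<bar>" by (rule abs_le_square_iff[THEN iffD2])
    then have "\<bar>e * fst p\<bar> \<le> 2" by simp
    then have "\<bar>fst p\<bar> \<le> 2 / e" using e by (simp add: abs_mult field_simps)
    moreover have "snd p * e\<^sup>2 \<le> 2" using y2 by (metis mult.commute)
    then have "snd p \<le> 2 / e\<^sup>2" using e by (simp add: pos_le_divide_eq)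
    ultimately show "p \<in> {- 2 / e .. 2 / e} \<times> {0..2 / e\<^sup>2}" using y0 by (cases p) auto
  qed
  have inv: "W a \<bullet> (P e a x y - k a) = e * x" "U a \<bullet> (P e a x y - k a) = - (e\<^sup>2 * y)" for x y
    by (simp_all add: P_def inner_diff_right inner_add_right W_inner_W W_inner_U U_inner_W U_inner_U)
  have "(\<integral>\<^sup>+y. f y \<partial>lborel) = (\<integral>\<^sup>+x. \<integral>\<^sup>+y. indicator D (x, y) *
      (ennreal \<bar>(e *\<^sub>R W a) $ 1 * (- (e\<^sup>2 *\<^sub>R U a)) $ 2 - (- (e\<^sup>2 *\<^sub>R U a)) $ 1 * (e *\<^sub>R W a) $ 2\<bar> * f (P e a x y)) \<partial>lborel \<partial>lborel)"
  proof (rule nn_integral_change_real2[where B = "e ^ 3"])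
    show "D \<in> sets borel" using cD by simp
    show "bounded D" using D_sub by (rule bounded_subset[OF compact_imp_bounded[OF compact_Times[OF compact_Icc compact_Icc]]])
    have l1: "((\<lambda>p::real^2. p $ i) has_derivative (\<lambda>h. h $ i)) (at p)" for i p
      by (intro bounded_linear_imp_has_derivative bounded_linear_vec_nth)
    show "((\<lambda>p::real^2. P e a (p $ 1) (p $ 2)) has_derivative (\<lambda>h. h $ 1 *\<^sub>R (e *\<^sub>R W a) + h $ 2 *\<^sub>R (- (e\<^sup>2 *\<^sub>R U a)))) (at (vector [x, y]))" for x y
      unfolding P_def by (auto intro!: derivative_eq_intros l1 simp: mult.commute)
    show "inj_on (\<lambda>(x, y). P e a x y) D"
    proof (rule inj_onI, clarify)
      fix x y x' y' assume eq: "P e a x y = P e a x' y'"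
      have "e * x = e * x'" "e\<^sup>2 * y = e\<^sup>2 * y'" using inv[of x y] inv[of x' y'] unfolding eq by (simp_all only:)
      then show "x = x' \<and> y = y'" using e by auto
    qed
    show "f y = 0" if "y \<notin> (\<lambda>(x, y). P e a x y) ` D" for y
    proof (rule f0)
      show "y \<notin> K"
      proof
        assume yK: "y \<in> K"
        define u v where "u = (W a \<bullet> (y - k a)) / e" and "v = - (U a \<bullet> (y - k a)) / e\<^sup>2"
        have "P e a u v = k a + ((W a \<bullet> (y - k a)) *\<^sub>R W a + (U a \<bullet> (y - k a)) *\<^sub>R U a)"
          using e by (simp add: P_def u_def v_def)
        also have "\<dots> = y" using U_decomp[of "y - k a" a] by simp
        finally show False using that yK by (force simp: D_def)
      qed
    qed
  qed (use f1 jac in auto)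
  also have "\<dots> = (\<integral>\<^sup>+x. \<integral>\<^sup>+y. ennreal (e ^ 3) * f (P e a x y) \<partial>lborel \<partial>lborel)"
    unfolding jac using f0 by (intro nn_integral_cong) (auto simp: D_def indicator_def)
  also have "\<dots> = ennreal (e ^ 3) * (\<integral>\<^sup>+x. \<integral>\<^sup>+y. f (P e a x y) \<partial>lborel \<partial>lborel)"
  proof -
    have [measurable]: "(\<lambda>p. P e a (fst p) (snd p)) \<in> borel_measurable (borel \<Otimes>\<^sub>M borel)"
      unfolding P_def by measurable
    have [measurable]: "(\<lambda>y. P e a x y) \<in> borel_measurable borel" for x unfolding P_def by measurable
    show ?thesis by (subst nn_integral_cmult, measurable)+
  qed
  finally show ?thesis .
qed

definition V :: "real^2 \<Rightarrow> real" where "V t = measure lborel {z \<in> K. z - t \<notin> M}"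

lemma V_emeasure: "emeasure lborel {z \<in> K. z - t \<notin> M} = ennreal (V t)"
proof -
  have "emeasure lborel {z \<in> K. z - t \<notin> M} \<le> emeasure lborel K" by (intro emeasure_mono) auto
  then have "emeasure lborel {z \<in> K. z - t \<notin> M} \<noteq> \<infinity>" using K_finite by (auto simp: top_unique)
  then show ?thesis unfolding V_def by (intro emeasure_eq_ennreal_measure) auto
qed

lemma V_nonneg: "0 \<le> V t" by (simp add: V_def)

lemma V_le: "V t \<le> measure lborel K"
  unfolding V_def using K_finite by (intro measure_mono_fmeasurable) (auto simp: fmeasurable_def)

lemma Q_eq: "Q t = ennreal (1 - V t / measure lborel K)"
proof -
  have s: "{z. z - t \<in> M} \<in> sets borel"
  proof -
    have "{z \<in> space borel. z - t \<in> M} \<in> sets borel" by measurable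
    then show ?thesis by simp
  qed
  have "Q t = emeasure lborel (K \<inter> {z. z - t \<in> M}) / emeasure lborel K"
    unfolding Q_def \<mu>_def using s by (intro emeasure_uniform_measure) auto
  also have "K \<inter> {z. z - t \<in> M} = K - {z \<in> K. z - t \<notin> M}" by auto
  also have "emeasure lborel \<dots> = emeasure lborel K - emeasure lborel {z \<in> K. z - t \<notin> M}"
    by (rule emeasure_Diff) (auto simp: V_emeasure)
  also have "\<dots> = ennreal (measure lborel K - V t)"
    by (simp add: K_emeasure V_emeasure V_nonneg ennreal_minus)
  also have "\<dots> / emeasure lborel K = ennreal ((measure lborel K - V t) / measure lborel K)"
    unfolding K_emeasure using K_pos V_le by (intro divide_ennreal) auto
  also have "(measure lborel K - V t) / measure lborel K = 1 - V t / measure lborel K"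
    using K_pos by (simp add: diff_divide_distrib)
  finally show ?thesis .
qed

text \<open>The part of \<open>K\<close> outside the translate that touches \<open>P e a x y\<close>
  with normal \<open>U a\<close>, in rescaled coordinates.\<close>

definition H :: "real \<Rightarrow> real \<Rightarrow> real \<Rightarrow> real \<Rightarrow> (real \<times> real) set" where
  "H e a x y = {p. P e a (fst p) (snd p) \<in> K \<and> P e a (fst p) (snd p) - P e a x y + m a \<notin> M}"

lemma V_chart:
  assumes e: "e > 0"
  shows "ennreal (V (P e a x y - m a) / e ^ 3) = (\<integral>\<^sup>+x'. \<integral>\<^sup>+y'. indicator (H e a x y) (x', y') \<partial>lborel \<partial>lborel)"
proof -
  let ?S = "{z \<in> K. z - (P e a x y - m a) \<notin> M}"
  have "ennreal (V (P e a x y - m a)) = (\<integral>\<^sup>+z. indicator ?S z \<partial>lborel)"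
    by (subst nn_integral_indicator) (simp_all add: V_emeasure del: mem_Collect_eq)
  also have "\<dots> = ennreal (e ^ 3) * (\<integral>\<^sup>+x'. \<integral>\<^sup>+y'. indicator ?S (P e a x' y') \<partial>lborel \<partial>lborel)"
    by (rule affine_change[OF e]) (auto simp: indicator_def simp del: mem_Collect_eq)
  also have "\<dots> = ennreal (e ^ 3) * (\<integral>\<^sup>+x'. \<integral>\<^sup>+y'. indicator (H e a x y) (x', y') \<partial>lborel \<partial>lborel)"
    by (simp add: H_def indicator_def diff_diff_eq2 add_diff_eq algebra_simps)
  finally have *: "ennreal (V (P e a x y - m a)) = ennreal (e ^ 3) * (\<integral>\<^sup>+x'. \<integral>\<^sup>+y'. indicator (H e a x y) (x', y') \<partial>lborel \<partial>lborel)" .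
  have "ennreal (V (P e a x y - m a) / e ^ 3) = ennreal (1 / e ^ 3) * ennreal (V (P e a x y - m a))"
    using e V_nonneg by (simp add: ennreal_mult[symmetric])
  also have "\<dots> = (ennreal (1 / e ^ 3) * ennreal (e ^ 3)) * (\<integral>\<^sup>+x'. \<integral>\<^sup>+y'. indicator (H e a x y) (x', y') \<partial>lborel \<partial>lborel)"
    unfolding * by (simp add: mult.assoc)
  also have "ennreal (1 / e ^ 3) * ennreal (e ^ 3) = 1" using e by (simp add: ennreal_mult[symmetric])
  finally show ?thesis by simp
qed

text \<open>Membership in \<open>K\<close> and non-membership in the translate bound
  \<open>y'\<close> by opposite quadratic inequalities; their leading terms differ by the gap
  between \<open>R\<close> and 1. The resulting bound \<open>B\<close> does not depend on the
  scale.\<close>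

lemma H_bounded:
  assumes e: "0 < e" "e \<le> 1" and y: "0 \<le> y" and h: "(x', y') \<in> H e a x y"
    and B: "B = (2 * y + x\<^sup>2 + y\<^sup>2 + 2 * x\<^sup>2 / (1 - R)) / (1 - R)"
  shows "0 \<le> y'" "y' \<le> B" "x'\<^sup>2 \<le> 2 * B"
proof -
  have 1: "x'\<^sup>2 + e\<^sup>2 * y'\<^sup>2 \<le> 2 * R * y'" using h P_in_K[OF e(1), of a x' y'] by (simp add: H_def)
  have "0 \<le> x'\<^sup>2 + e\<^sup>2 * y'\<^sup>2" by simp
  then have "0 \<le> 2 * R * y'" using 1 by linarith
  then show y': "0 \<le> y'" using R_pos by (simp add: zero_le_mult_iff)
  have 2: "2 * (y' - y) < (x' - x)\<^sup>2 + e\<^sup>2 * (y' - y)\<^sup>2"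
    using h notin_M[OF e(1), of a "x' - x" "y' - y"] by (simp add: H_def P_diff)
  have Ry: "R * y' \<le> 1 * y'" using y' R_less by (intro mult_right_mono) auto
  have "0 \<le> e\<^sup>2 * y'\<^sup>2" by simp
  then have 3: "x'\<^sup>2 \<le> 2 * y'" using 1 Ry by linarith
  \<comment> \<open>The weight is chosen so that, with \<open>x'\<^sup>2 \<le> 2 * y'\<close>, the
    mixed term costs \<open>(1 - R) * y'\<close>, half of what the gap provides.\<close>
  have 4: "- 2 * x * x' \<le> (1 - R) / 2 * x'\<^sup>2 + 2 * x\<^sup>2 / (1 - R)"
  proof -
    have "0 \<le> ((1 - R) * x' + 2 * x)\<^sup>2 / (2 * (1 - R))" using R_less by simp
    also have "\<dots> = (1 - R) / 2 * x'\<^sup>2 + 2 * x * x' + 2 * x\<^sup>2 / (1 - R)"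
      using R_less by (simp add: power2_eq_square field_simps)
    finally show ?thesis by linarith
  qed
  have "(1 - R) / 2 * x'\<^sup>2 \<le> (1 - R) / 2 * (2 * y')" using 3 R_less by (intro mult_left_mono) auto
  then have 5: "(1 - R) / 2 * x'\<^sup>2 \<le> (1 - R) * y'" by simp
  have 6: "e\<^sup>2 * y\<^sup>2 \<le> 1 * y\<^sup>2" using e by (intro mult_right_mono power_le_one) auto
  have 7: "0 \<le> e\<^sup>2 * (y * y')" using y y' by simp
  have exp: "(x' - x)\<^sup>2 + e\<^sup>2 * (y' - y)\<^sup>2 = x'\<^sup>2 + e\<^sup>2 * y'\<^sup>2 - 2 * x * x' + x\<^sup>2 + e\<^sup>2 * y\<^sup>2 - 2 * (e\<^sup>2 * (y * y'))"
    by (simp add: power2_eq_square algebra_simps)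
  have "2 * y' - 2 * y < 2 * R * y' + ((1 - R) * y' + 2 * x\<^sup>2 / (1 - R)) + x\<^sup>2 + y\<^sup>2"
  proof -
    \<comment> \<open>Naming the nonlinear terms leaves a linear deduction.\<close>
    define h g t p z where "h = (1 - R) / 2 * x'\<^sup>2" and "g = 2 * x\<^sup>2 / (1 - R)" and "t = (1 - R) * y'"
      and "p = 2 * R * y'" and "z = - 2 * x * x'"
    define A C D where "A = x'\<^sup>2 + e\<^sup>2 * y'\<^sup>2" and "C = e\<^sup>2 * y\<^sup>2" and "D = e\<^sup>2 * (y * y')"
    have "2 * (y' - y) < A + z + x\<^sup>2 + C - 2 * D"
      using 2 unfolding exp z_def A_def C_def D_def by simp
    moreover have "A \<le> p" "z \<le> h + g" "h \<le> t" "C \<le> y\<^sup>2" "0 \<le> D"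
      using 1 4 5 6 7 by (simp_all add: A_def p_def z_def h_def g_def t_def C_def D_def)
    ultimately have "2 * y' - 2 * y < p + (t + g) + x\<^sup>2 + y\<^sup>2" by (smt (verit))
    then show ?thesis by (simp only: p_def t_def g_def)
  qed
  then have "(1 - R) * y' \<le> 2 * y + x\<^sup>2 + y\<^sup>2 + 2 * x\<^sup>2 / (1 - R)" by (simp add: algebra_simps)
  then show yB: "y' \<le> B" unfolding B using R_less by (simp add: pos_le_divide_eq mult.commute)
  show "x'\<^sup>2 \<le> 2 * B" using 3 yB by linarith
qed

text \<open>In the rescaled limit the region cut off by the translate lies between two parabolas;
  \<open>sag\<close> is the maximal vertical distance between them and \<open>kap\<close> the difference of their curvatures.\<close>

definition kap :: "real \<Rightarrow> real" where "kap a = 1 / q a - 1 / r a"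
definition sag :: "real \<Rightarrow> real \<Rightarrow> real \<Rightarrow> real" where "sag a x y = y + x\<^sup>2 / (2 * (r a - q a))"

lemma kap_pos: "0 < kap a"
  using q_less_r[of a] Ko.r_pos[of a] by (simp add: kap_def divide_strict_left_mono)

text \<open>Completing the square in \<open>x'\<close>: the vertical distance between the two
  parabolas is itself an inverted parabola, with its top at the shifted centre.\<close>

lemma sag_eq:
  "y + (x' - x)\<^sup>2 / (2 * r a) - x'\<^sup>2 / (2 * q a) = sag a x y - kap a / 2 * (x' - (- x * q a / (r a - q a)))\<^sup>2"
proof -
  define d where "d = r a - q a"
  have nz: "d \<noteq> 0" "q a \<noteq> 0" "r a = d + q a" "d + q a \<noteq> 0"
    using q_less_r[of a] Ko.r_pos[of a] r_pos[of a] by (auto simp: d_def)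
  show ?thesis unfolding sag_def kap_def d_def[symmetric] nz(3)
    using nz(1,2,4) by (simp add: power2_eq_square divide_simps) algebra
qed

lemma limit_region_area:
  assumes "0 \<le> y"
  shows "(\<integral>\<^sup>+x'. \<integral>\<^sup>+y'. indicator {p. (fst p)\<^sup>2 / (2 * q a) < snd p \<and> snd p < y + (fst p - x)\<^sup>2 / (2 * r a)} (x', y') \<partial>lborel \<partial>lborel)
    = ennreal (4 / 3 * sag a x y * sqrt (2 * sag a x y / kap a))"
proof -
  have "0 \<le> x\<^sup>2 / (2 * (r a - q a))" using q_less_r[of a] by simp
  then have s: "0 \<le> sag a x y" using assms by (simp add: sag_def)
  have inner: "(\<integral>\<^sup>+y'. indicator {p. (fst p)\<^sup>2 / (2 * q a) < snd p \<and> snd p < y + (fst p - x)\<^sup>2 / (2 * r a)} (x', y') \<partial>lborel)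
    = ennreal (sag a x y - kap a / 2 * (x' - (- x * q a / (r a - q a)))\<^sup>2)" for x'
  proof -
    have "(\<integral>\<^sup>+y'. indicator {p. (fst p)\<^sup>2 / (2 * q a) < snd p \<and> snd p < y + (fst p - x)\<^sup>2 / (2 * r a)} (x', y') \<partial>lborel)
      = (\<integral>\<^sup>+y'. indicator {y'. x'\<^sup>2 / (2 * q a) < y' \<and> y' < y + (x' - x)\<^sup>2 / (2 * r a)} y' \<partial>lborel)"
      by (rule nn_integral_cong) (simp add: indicator_def)
    also have "\<dots> = emeasure lborel {y'. x'\<^sup>2 / (2 * q a) < y' \<and> y' < y + (x' - x)\<^sup>2 / (2 * r a)}"
      by (rule nn_integral_indicator) measurable
    also have "\<dots> = ennreal (y + (x' - x)\<^sup>2 / (2 * r a) - x'\<^sup>2 / (2 * q a))" by (rule emeasure_open_interval)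
    finally show ?thesis unfolding sag_eq .
  qed
  show ?thesis unfolding inner by (rule nn_integral_inverted_parabola[OF s kap_pos])
qed

text \<open>Off the two limiting parabolas membership in \<open>H\<close> stabilizes, and each
  vertical line meets them in at most two points. Dominated convergence is applied on each vertical
  line and then across the lines, with the bounds of \<open>H_bounded\<close>.\<close>

lemma V_limit:
  assumes e: "\<And>n. e n > 0" "\<And>n. e n \<le> 1" "e \<longlonglongrightarrow> 0" and y: "0 \<le> y"
  shows "(\<lambda>n. V (P (e n) a x y - m a) / e n ^ 3) \<longlonglongrightarrow> 4 / 3 * sag a x y * sqrt (2 * sag a x y / kap a)"
proof -
  let ?L = "{p. (fst p)\<^sup>2 / (2 * q a) < snd p \<and> snd p < y + (fst p - x)\<^sup>2 / (2 * r a)}"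
  define B where "B = (2 * y + x\<^sup>2 + y\<^sup>2 + 2 * x\<^sup>2 / (1 - R)) / (1 - R)"
  have hb: "0 \<le> y'" "y' \<le> B" "x'\<^sup>2 \<le> 2 * B" if "(x', y') \<in> H (e n) a x y" for n x' y'
    using H_bounded[OF e(1,2) y that B_def] by auto
  have Hm [measurable]: "H (e n) a x y \<in> sets (borel \<Otimes>\<^sub>M borel)" for n
  proof -
    have "{p \<in> space (borel \<Otimes>\<^sub>M borel). P (e n) a (fst p) (snd p) \<in> K \<and> P (e n) a (fst p) (snd p) - P (e n) a x y + m a \<notin> M} \<in> sets (borel \<Otimes>\<^sub>M borel)"
      unfolding P_def by measurable
    then show ?thesis by (simp add: H_def space_pair_measure)
  qed
  have Lm [measurable]: "?L \<in> sets (borel \<Otimes>\<^sub>M borel)"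
  proof -
    have "{p \<in> space (borel \<Otimes>\<^sub>M borel). (fst p)\<^sup>2 / (2 * q a) < snd p \<and> snd p < y + (fst p - x)\<^sup>2 / (2 * r a)} \<in> sets (borel \<Otimes>\<^sub>M borel)"
      by measurable
    then show ?thesis by (simp add: space_pair_measure)
  qed
  have pt: "(\<lambda>n. indicator (H (e n) a x y) (x', y') :: ennreal) \<longlonglongrightarrow> indicator ?L (x', y')"
    if ne: "y' \<noteq> x'\<^sup>2 / (2 * q a)" "y' \<noteq> y + (x' - x)\<^sup>2 / (2 * r a)" for x' y'
  proof -
    have K1: "\<forall>\<^sub>F n in sequentially. (P (e n) a x' y' \<in> K \<longleftrightarrow> x'\<^sup>2 / (2 * q a) < y')"
    proof (cases "x'\<^sup>2 / (2 * q a) < y'")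
      case True
      from Ko.eventually_above_parabola[OF e(1,3) tendsto_const tendsto_const True]
      show ?thesis unfolding P_def by eventually_elim (use True in simp)
    next
      case False
      then have "y' < x'\<^sup>2 / (2 * q a)" using ne by simp
      from Ko.eventually_below_parabola[OF e(1,3) tendsto_const tendsto_const this]
      show ?thesis unfolding P_def by eventually_elim (use False in simp)
    qed
    have M1: "\<forall>\<^sub>F n in sequentially. (P (e n) a x' y' - P (e n) a x y + m a \<notin> M \<longleftrightarrow> y' < y + (x' - x)\<^sup>2 / (2 * r a))"
    proof (cases "y' < y + (x' - x)\<^sup>2 / (2 * r a)")
      case True
      then have "y' - y < (x' - x)\<^sup>2 / (2 * r a)" by simp
      from eventually_below_parabola[OF e(1,3) tendsto_const tendsto_const this]
      show ?thesis unfolding P_diff by eventually_elim (use True in simp)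
    next
      case False
      then have "(x' - x)\<^sup>2 / (2 * r a) < y' - y" using ne by simp
      from eventually_above_parabola[OF e(1,3) tendsto_const tendsto_const this]
      show ?thesis unfolding P_diff by eventually_elim (use False in simp)
    qed
    from K1 M1 have "\<forall>\<^sub>F n in sequentially. (indicator (H (e n) a x y) (x', y') :: ennreal) = indicator ?L (x', y')"
      by eventually_elim (simp add: H_def indicator_def)
    then show ?thesis by (rule tendsto_eventually)
  qed
  have inner: "(\<lambda>n. \<integral>\<^sup>+y'. indicator (H (e n) a x y) (x', y') \<partial>lborel) \<longlonglongrightarrow> (\<integral>\<^sup>+y'. indicator ?L (x', y') \<partial>lborel)" for x'
  proof (rule nn_integral_dominated_convergence[where w = "indicator {0..B}"])
    show "AE y' in lborel. indicator (H (e n) a x y) (x', y') \<le> (indicator {0..B} y' :: ennreal)" for n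
      using hb by (intro AE_I2) (auto simp: indicator_def)
    show "(\<integral>\<^sup>+y'. indicator {0..B} y' \<partial>lborel) < \<infinity>" by (simp add: emeasure_lborel_Icc_eq)
    have "AE y' in lborel. y' \<noteq> x'\<^sup>2 / (2 * q a)" "AE y' in lborel. y' \<noteq> y + (x' - x)\<^sup>2 / (2 * r a)"
      by (rule AE_lborel_singleton)+
    then show "AE y' in lborel. (\<lambda>n. indicator (H (e n) a x y) (x', y') :: ennreal) \<longlonglongrightarrow> indicator ?L (x', y')"
      by eventually_elim (rule pt)
  qed measurable
  have "(\<lambda>n. \<integral>\<^sup>+x'. \<integral>\<^sup>+y'. indicator (H (e n) a x y) (x', y') \<partial>lborel \<partial>lborel)
    \<longlonglongrightarrow> (\<integral>\<^sup>+x'. \<integral>\<^sup>+y'. indicator ?L (x', y') \<partial>lborel \<partial>lborel)"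
  proof (rule nn_integral_dominated_convergence[where w = "\<lambda>x'. ennreal B * indicator {- (2 * B + 1)..2 * B + 1} x'"])
    show "AE x' in lborel. (\<integral>\<^sup>+y'. indicator (H (e n) a x y) (x', y') \<partial>lborel) \<le> ennreal B * indicator {- (2 * B + 1)..2 * B + 1} x'" for n
    proof (intro AE_I2)
      fix x' :: real
      show "(\<integral>\<^sup>+y'. indicator (H (e n) a x y) (x', y') \<partial>lborel) \<le> ennreal B * indicator {- (2 * B + 1)..2 * B + 1} x'"
      proof (cases "x'\<^sup>2 \<le> 2 * B")
        case True
        then have "\<bar>x'\<bar> \<le> 2 * B + 1"
        proof -
          have "2 * \<bar>x'\<bar> \<le> x'\<^sup>2 + 1" using sum_squares_bound[of "\<bar>x'\<bar>" 1] by simp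
          then show ?thesis using True by (smt (verit) zero_le_power2)
        qed
        have "(\<integral>\<^sup>+y'. indicator (H (e n) a x y) (x', y') \<partial>lborel) \<le> (\<integral>\<^sup>+y'. indicator {0..B} y' \<partial>lborel)"
          using hb by (intro nn_integral_mono) (auto simp: indicator_def)
        also have "\<dots> \<le> ennreal B" by (cases "0 \<le> B") auto
        finally show ?thesis using \<open>\<bar>x'\<bar> \<le> 2 * B + 1\<close> by (auto simp: indicator_def)
      next
        case False
        then have "(\<integral>\<^sup>+y'. indicator (H (e n) a x y) (x', y') \<partial>lborel) = (\<integral>\<^sup>+y'. 0 \<partial>(lborel :: real measure))"
          using hb by (intro nn_integral_cong) (auto simp: indicator_def)
        then show ?thesis by simp
      qed
    qed
    show "(\<integral>\<^sup>+x'. ennreal B * indicator {- (2 * B + 1)..2 * B + 1} x' \<partial>lborel) < \<infinity>"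
      by (subst nn_integral_cmult_indicator) (auto simp: ennreal_mult_less_top emeasure_lborel_Icc_eq)
    show "(\<lambda>x'. \<integral>\<^sup>+y'. indicator ?L (x', y') \<partial>lborel) \<in> borel_measurable lborel" by measurable
    show "(\<lambda>x'. \<integral>\<^sup>+y'. indicator (H (e n) a x y) (x', y') \<partial>lborel) \<in> borel_measurable lborel" for n by measurable
  qed (use inner in auto)
  then have "(\<lambda>n. ennreal (V (P (e n) a x y - m a) / e n ^ 3)) \<longlonglongrightarrow> ennreal (4 / 3 * sag a x y * sqrt (2 * sag a x y / kap a))"
    unfolding limit_region_area[OF y] V_chart[OF e(1), symmetric] .
  moreover have "0 \<le> V (P (e n) a x y - m a) / e n ^ 3" for n using V_nonneg e(1)[of n] by simp
  moreover have "0 \<le> 4 / 3 * sag a x y * sqrt (2 * sag a x y / kap a)"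
  proof -
    have "0 \<le> sag a x y" using y q_less_r[of a] by (simp add: sag_def)
    then show ?thesis using kap_pos[of a] by simp
  qed
  ultimately show ?thesis by (subst (asm) tendsto_ennreal_iff) auto
qed

end

section \<open>Domination and passage to the limit\<close>

text \<open>From \<open>sin x \<ge> x / 3\<close> on the interval up to 2 and the half-angle
  formula; the constant 18 is not sharp.\<close>

lemma one_minus_cos_ge:
  assumes "0 \<le> h" "h \<le> pi" shows "h\<^sup>2 / 18 \<le> 1 - cos h"
proof -
  define x where "x = h / 2"
  have x: "0 \<le> x" "x \<le> 2" using assms pi_less_4 by (auto simp: x_def)
  have "\<bar>sin x - (\<Sum>i<3. sin_coeff i * x ^ i)\<bar> \<le> inverse (fact 3) * \<bar>x\<bar> ^ 3" by (rule Maclaurin_sin_bound)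
  moreover have "(\<Sum>i<3. sin_coeff i * x ^ i) = x" by (simp add: numeral_eq_Suc sin_coeff_def)
  moreover have "inverse (fact 3) * \<bar>x\<bar> ^ 3 = x ^ 3 / 6" using x by (simp add: fact_numeral)
  ultimately have "x - x ^ 3 / 6 \<le> sin x" by linarith
  moreover have "x ^ 3 \<le> 4 * x"
  proof -
    have "x\<^sup>2 \<le> 2\<^sup>2" using x by (intro power_mono) auto
    then have "x\<^sup>2 * x \<le> 4 * x" using x by (intro mult_right_mono) auto
    then show ?thesis by (simp add: power3_eq_cube power2_eq_square)
  qed
  ultimately have "x / 3 \<le> sin x" by linarith
  then have "(x / 3)\<^sup>2 \<le> (sin x)\<^sup>2" using x by (intro power_mono) auto
  moreover have "1 - cos h = 2 * (sin x)\<^sup>2" using cos_double_sin[of x] by (simp add: x_def)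
  ultimately show ?thesis by (simp add: x_def power2_eq_square)
qed

text \<open>The inequality \<open>1 + z \<le> exp z\<close>, applied to \<open>- t\<close> and to
  \<open>t / (1 - t)\<close>, encloses \<open>1 - t\<close> between two exponentials.\<close>

lemma tendsto_power_exp:
  fixes t :: "nat \<Rightarrow> real" and N :: "nat \<Rightarrow> nat"
  assumes t: "t \<longlonglongrightarrow> 0" and Nt: "(\<lambda>n. real (N n) * t n) \<longlonglongrightarrow> c"
  shows "(\<lambda>n. (1 - t n) ^ N n) \<longlonglongrightarrow> exp (- c)"
proof (rule tendsto_sandwich)
  have ev: "\<forall>\<^sub>F n in sequentially. t n < 1" using t by (rule order_tendstoD(2)) simp
  show "\<forall>\<^sub>F n in sequentially. exp (- (real (N n) * t n / (1 - t n))) \<le> (1 - t n) ^ N n"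
    using ev
  proof eventually_elim
    case (elim n)
    have "1 / (1 - t n) = 1 + t n / (1 - t n)" using elim by (simp add: field_simps)
    also have "\<dots> \<le> exp (t n / (1 - t n))" by (rule exp_ge_add_one_self)
    finally have "1 / exp (t n / (1 - t n)) \<le> 1 - t n" using elim by (simp add: field_simps)
    then have "exp (- (t n / (1 - t n))) \<le> 1 - t n" by (simp add: exp_minus inverse_eq_divide)
    then have "exp (- (t n / (1 - t n))) ^ N n \<le> (1 - t n) ^ N n" by (intro power_mono) auto
    moreover have "exp (- (t n / (1 - t n))) ^ N n = exp (- (real (N n) * t n / (1 - t n)))"
      by (simp flip: exp_of_nat_mult)
    ultimately show ?case by simp
  qed
  show "\<forall>\<^sub>F n in sequentially. (1 - t n) ^ N n \<le> exp (- (real (N n) * t n))"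
    using ev
  proof eventually_elim
    case (elim n)
    have "1 - t n \<le> exp (- t n)" using exp_ge_add_one_self[of "- t n"] by simp
    then have "(1 - t n) ^ N n \<le> exp (- t n) ^ N n" using elim by (intro power_mono) auto
    also have "\<dots> = exp (- (real (N n) * t n))" by (simp flip: exp_of_nat_mult)
    finally show ?case .
  qed
  have "(\<lambda>n. exp (- (real (N n) * t n / (1 - t n)))) \<longlonglongrightarrow> exp (- (c / (1 - 0)))"
    by (intro tendsto_intros Nt t) simp
  then show "(\<lambda>n. exp (- (real (N n) * t n / (1 - t n)))) \<longlonglongrightarrow> exp (- c)" by simp
  show "(\<lambda>n. exp (- (real (N n) * t n))) \<longlonglongrightarrow> exp (- c)" by (intro tendsto_intros Nt)
qed

lemma two_abs_le: "2 * \<bar>x\<bar> - 1 \<le> x\<^sup>2" for x :: real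
proof -
  have "0 \<le> (\<bar>x\<bar> - 1)\<^sup>2" by simp
  then show ?thesis by (simp add: power2_diff)
qed

context oval_pair begin

section \<open>The expectation integral in rescaled coordinates\<close>

lemma V_measurable [measurable]: "V \<in> borel_measurable borel"
proof -
  have s: "{p \<in> space (borel \<Otimes>\<^sub>M lborel). snd p \<in> K \<and> snd p - fst p \<notin> M} \<in> sets (borel \<Otimes>\<^sub>M lborel)"
    by measurable
  from lborel.measurable_emeasure_Pair[OF this]
  have "(\<lambda>t. emeasure lborel {z \<in> K. z - t \<notin> M}) \<in> borel_measurable borel"
    by (simp add: space_pair_measure vimage_def)
  then have "(\<lambda>t. enn2real (emeasure lborel {z \<in> K. z - t \<notin> M})) \<in> borel_measurable borel" by measurable
  then show ?thesis by (simp add: V_def[abs_def] measure_def)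
qed

lemma Q_measurable [measurable]: "Q \<in> borel_measurable borel"
  unfolding Q_eq[abs_def] by measurable

lemma measurable_curves [measurable]:
  "m \<in> borel_measurable borel" "r \<in> borel_measurable borel" "k \<in> borel_measurable borel"
  "q \<in> borel_measurable borel" "U \<in> borel_measurable borel" "W \<in> borel_measurable borel"
  using cont_m cont_r Ko.cont_m Ko.cont_r continuous_U continuous_W
  by (auto intro: borel_measurable_continuous_onI)

definition F :: "nat \<Rightarrow> real \<Rightarrow> real \<Rightarrow> real \<Rightarrow> real \<Rightarrow> real \<Rightarrow> real" where
  "F N e a b x y = indicator {0..<2*pi} a * (indicator {0<..<pi} (e * b) * (r a * r (a + e * b) * (sin (e * b) / e) *
    (indicator K (P e a x y) * indicator K (P e a x y + (m (a + e * b) - m a)) *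
      (1 - V (P e a x y - m a) / measure lborel K) ^ N)))"

lemma V_ratio: "0 \<le> 1 - V t / measure lborel K" "1 - V t / measure lborel K \<le> 1"
  using V_le[of t] V_nonneg[of t] K_pos by simp_all

text \<open>Of the five factors \<open>e\<close>, three come from the chart, one from rescaling the
  arc, and one is taken out of the sine. The squared area comes from the densities of the two
  distinguished points.\<close>

lemma T_chart:
  assumes e: "e > 0"
  shows "T N = ennreal (e ^ 5 / (measure lborel K)\<^sup>2) *
    (\<integral>\<^sup>+a. \<integral>\<^sup>+b. \<integral>\<^sup>+x. \<integral>\<^sup>+y. ennreal (F N e a b x y) \<partial>lborel \<partial>lborel \<partial>lborel \<partial>lborel)"
proof -
  define A where "A = measure lborel K"
  have A: "A > 0" using K_pos by (simp add: A_def)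
  define f where "f a c x = indicator K x * (indicator K (x + c) * Q (x - m a) ^ N)" for a :: real and c x
  define J where "J a b = indicator arcs (a, b) * ennreal (r a * r b * sin (b - a))" for a b
  have arcs_m [measurable]: "arcs \<in> sets (borel \<Otimes>\<^sub>M borel)" using arcs_sets unfolding borel_prod .
  have Jm [measurable]: "(\<lambda>p. J (fst p) (snd p)) \<in> borel_measurable (borel \<Otimes>\<^sub>M borel)"
    unfolding J_def by measurable
  have Jm' [measurable (raw)]: "(\<lambda>z. J (u z) (v z)) \<in> borel_measurable S"
    if [measurable]: "u \<in> borel_measurable S" "v \<in> borel_measurable S" for u v and S :: "'z measure"
    unfolding J_def by measurable
  have inv: "inverse (ennreal A) = ennreal (1 / A)" using A by (simp add: inverse_ennreal inverse_eq_divide)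
  have "T N = (\<integral>\<^sup>+x. (\<integral>\<^sup>+a. \<integral>\<^sup>+b. J a b * (indicator K (x + (m b - m a)) * Q (x - m a) ^ N) \<partial>lborel \<partial>lborel) / ennreal A \<partial>\<mu>)"
    unfolding T_def J_def A_def by (simp add: mult.assoc)
  also have "\<dots> = (\<integral>\<^sup>+x. (\<integral>\<^sup>+a. \<integral>\<^sup>+b. J a b * (indicator K (x + (m b - m a)) * Q (x - m a) ^ N) \<partial>lborel \<partial>lborel) / ennreal A * indicator K x \<partial>lborel) / ennreal A"
    unfolding A_def by (rule nn_mu) measurable
  also have "\<dots> = (\<integral>\<^sup>+x. (\<integral>\<^sup>+a. \<integral>\<^sup>+b. J a b * f a (m b - m a) x \<partial>lborel \<partial>lborel) * ennreal (1 / A) \<partial>lborel) * ennreal (1 / A)"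
    unfolding divide_ennreal_def inv f_def
    by (rule arg_cong2[where f = "(*)"], rule nn_integral_cong) (auto simp: indicator_def)
  also have "\<dots> = (\<integral>\<^sup>+x. \<integral>\<^sup>+a. \<integral>\<^sup>+b. J a b * f a (m b - m a) x \<partial>lborel \<partial>lborel \<partial>lborel) * ennreal (1 / A) * ennreal (1 / A)"
    unfolding f_def by (subst nn_integral_multc) measurable
  \<comment> \<open>\<open>a\<close> has to become the outermost variable, because the chart that
    replaces \<open>x\<close> is centred at \<open>k a\<close>.\<close>
  also have "(\<integral>\<^sup>+x. \<integral>\<^sup>+a. \<integral>\<^sup>+b. J a b * f a (m b - m a) x \<partial>lborel \<partial>lborel \<partial>lborel)
    = (\<integral>\<^sup>+a. \<integral>\<^sup>+x. \<integral>\<^sup>+b. J a b * f a (m b - m a) x \<partial>lborel \<partial>lborel \<partial>lborel)"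
    unfolding f_def by (rule lborel_pair.Fubini') measurable
  also have "\<dots> = (\<integral>\<^sup>+a. \<integral>\<^sup>+b. \<integral>\<^sup>+x. J a b * f a (m b - m a) x \<partial>lborel \<partial>lborel \<partial>lborel)"
    unfolding f_def by (intro nn_integral_cong lborel_pair.Fubini') measurable
  also have "\<dots> = (\<integral>\<^sup>+a. \<integral>\<^sup>+b. J a b * (ennreal (e ^ 3) * (\<integral>\<^sup>+x. \<integral>\<^sup>+y. f a (m b - m a) (P e a x y) \<partial>lborel \<partial>lborel)) \<partial>lborel \<partial>lborel)"
  proof (intro nn_integral_cong)
    fix a b
    have fm [measurable]: "f a (m b - m a) \<in> borel_measurable borel" unfolding f_def by measurable
    have "(\<integral>\<^sup>+x. f a (m b - m a) x \<partial>lborel) = ennreal (e ^ 3) * (\<integral>\<^sup>+x. \<integral>\<^sup>+y. f a (m b - m a) (P e a x y) \<partial>lborel \<partial>lborel)"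
    proof (rule affine_change[OF e fm])
      show "f a (m b - m a) y \<le> 1" for y
      proof -
        have "Q (y - m a) ^ N \<le> 1"
          unfolding Q_eq using V_ratio[of "y - m a"] by (intro power_le_one) (auto simp: ennreal_le_1)
        then show ?thesis by (simp add: f_def indicator_def)
      qed
    qed (simp add: f_def)
    then show "(\<integral>\<^sup>+x. J a b * f a (m b - m a) x \<partial>lborel) = J a b * (ennreal (e ^ 3) * (\<integral>\<^sup>+x. \<integral>\<^sup>+y. f a (m b - m a) (P e a x y) \<partial>lborel \<partial>lborel))"
      by (subst nn_integral_cmult) (use fm in auto)
  qed
  also have "\<dots> = (\<integral>\<^sup>+a. ennreal e * (\<integral>\<^sup>+b. J a (a + e * b) * (ennreal (e ^ 3) * (\<integral>\<^sup>+x. \<integral>\<^sup>+y. f a (m (a + e * b) - m a) (P e a x y) \<partial>lborel \<partial>lborel)) \<partial>lborel) \<partial>lborel)"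
  proof (rule nn_integral_cong)
    fix a
    have "(\<lambda>b. J a b * (ennreal (e ^ 3) * (\<integral>\<^sup>+x. \<integral>\<^sup>+y. f a (m b - m a) (P e a x y) \<partial>lborel \<partial>lborel))) \<in> borel_measurable borel"
      unfolding f_def P_def by measurable
    from nn_integral_real_affine[OF this, of e a] e
    show "(\<integral>\<^sup>+b. J a b * (ennreal (e ^ 3) * (\<integral>\<^sup>+x. \<integral>\<^sup>+y. f a (m b - m a) (P e a x y) \<partial>lborel \<partial>lborel)) \<partial>lborel)
      = ennreal e * (\<integral>\<^sup>+b. J a (a + e * b) * (ennreal (e ^ 3) * (\<integral>\<^sup>+x. \<integral>\<^sup>+y. f a (m (a + e * b) - m a) (P e a x y) \<partial>lborel \<partial>lborel)) \<partial>lborel)"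
      by simp
  qed
  also have "\<dots> = (\<integral>\<^sup>+a. \<integral>\<^sup>+b. \<integral>\<^sup>+x. \<integral>\<^sup>+y. ennreal (e ^ 5) * ennreal (F N e a b x y) \<partial>lborel \<partial>lborel \<partial>lborel \<partial>lborel)"
  proof (rule nn_integral_cong)
    fix a
    have m1: "(\<lambda>b. J a (a + e * b) * (ennreal (e ^ 3) * (\<integral>\<^sup>+x. \<integral>\<^sup>+y. f a (m (a + e * b) - m a) (P e a x y) \<partial>lborel \<partial>lborel))) \<in> borel_measurable lborel"
      unfolding f_def P_def by measurable
    have "ennreal e * (\<integral>\<^sup>+b. J a (a + e * b) * (ennreal (e ^ 3) * (\<integral>\<^sup>+x. \<integral>\<^sup>+y. f a (m (a + e * b) - m a) (P e a x y) \<partial>lborel \<partial>lborel)) \<partial>lborel)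
      = (\<integral>\<^sup>+b. ennreal e * (J a (a + e * b) * (ennreal (e ^ 3) * (\<integral>\<^sup>+x. \<integral>\<^sup>+y. f a (m (a + e * b) - m a) (P e a x y) \<partial>lborel \<partial>lborel))) \<partial>lborel)"
      by (rule nn_integral_cmult[OF m1, symmetric])
    also have "\<dots> = (\<integral>\<^sup>+b. \<integral>\<^sup>+x. \<integral>\<^sup>+y. ennreal (e ^ 5) * ennreal (F N e a b x y) \<partial>lborel \<partial>lborel \<partial>lborel)"
    proof (rule nn_integral_cong)
      fix b
      let ?c = "ennreal e * (J a (a + e * b) * ennreal (e ^ 3))"
      have m2: "(\<lambda>x. \<integral>\<^sup>+y. f a (m (a + e * b) - m a) (P e a x y) \<partial>lborel) \<in> borel_measurable lborel"
        "(\<lambda>y. f a (m (a + e * b) - m a) (P e a x y)) \<in> borel_measurable lborel" for x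
        unfolding f_def P_def by measurable
      have "?c * (\<integral>\<^sup>+x. \<integral>\<^sup>+y. f a (m (a + e * b) - m a) (P e a x y) \<partial>lborel \<partial>lborel)
        = (\<integral>\<^sup>+x. ?c * (\<integral>\<^sup>+y. f a (m (a + e * b) - m a) (P e a x y) \<partial>lborel) \<partial>lborel)"
        by (rule nn_integral_cmult[OF m2(1), symmetric])
      also have "\<dots> = (\<integral>\<^sup>+x. \<integral>\<^sup>+y. ?c * f a (m (a + e * b) - m a) (P e a x y) \<partial>lborel \<partial>lborel)"
        by (intro nn_integral_cong nn_integral_cmult[OF m2(2), symmetric])
      also have "\<dots> = (\<integral>\<^sup>+x. \<integral>\<^sup>+y. ennreal (e ^ 5) * ennreal (F N e a b x y) \<partial>lborel \<partial>lborel)"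
      proof (intro nn_integral_cong)
        fix x y
        have arc: "(a, a + e * b) \<in> arcs \<longleftrightarrow> a \<in> {0..<2*pi} \<and> e * b \<in> {0<..<pi}" by (auto simp: arcs_def)
        show "?c * f a (m (a + e * b) - m a) (P e a x y) = ennreal (e ^ 5) * ennreal (F N e a b x y)"
        proof (cases "a \<in> {0..<2*pi} \<and> e * b \<in> {0<..<pi} \<and> P e a x y \<in> K \<and> P e a x y + (m (a + e * b) - m a) \<in> K")
          case True
          have s: "0 \<le> r a * r (a + e * b) * sin (e * b)"
          proof -
            have "0 \<le> sin (e * b)" by (rule sin_ge_zero) (use True in auto)
            then show ?thesis using r_pos[of a] r_pos[of "a + e * b"] by simp
          qed
          have v: "0 \<le> (1 - V (P e a x y - m a) / A) ^ N" unfolding A_def using V_ratio by simp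
          define S Y where "S = r a * r (a + e * b) * sin (e * b)" and "Y = (1 - V (P e a x y - m a) / A) ^ N"
          have "?c * f a (m (a + e * b) - m a) (P e a x y) = ennreal e * (ennreal S * ennreal (e ^ 3)) * ennreal Y"
            using True arc V_ratio by (simp add: J_def f_def Q_eq A_def[symmetric] ennreal_power S_def Y_def)
          also have "\<dots> = ennreal (e * S * e ^ 3 * Y)"
            using e s v unfolding S_def[symmetric] Y_def[symmetric] by (simp add: ennreal_mult mult.assoc)
          finally have "?c * f a (m (a + e * b) - m a) (P e a x y) = ennreal (e * (r a * r (a + e * b) * sin (e * b)) * e ^ 3 * (1 - V (P e a x y - m a) / A) ^ N)"
            unfolding S_def Y_def .
          also have "e * (r a * r (a + e * b) * sin (e * b)) * e ^ 3 * (1 - V (P e a x y - m a) / A) ^ N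
            = e ^ 5 * (r a * r (a + e * b) * (sin (e * b) / e) * (1 - V (P e a x y - m a) / A) ^ N)"
            using e by (simp add: numeral_eq_Suc)
          also have "ennreal \<dots> = ennreal (e ^ 5) * ennreal (r a * r (a + e * b) * (sin (e * b) / e) * (1 - V (P e a x y - m a) / A) ^ N)"
            using e by (intro ennreal_mult' ) simp
          finally show ?thesis using True by (simp add: F_def A_def)
        next
          case False
          then show ?thesis using arc by (auto simp: J_def f_def F_def indicator_def)
        qed
      qed
      finally show "ennreal e * (J a (a + e * b) * (ennreal (e ^ 3) * (\<integral>\<^sup>+x. \<integral>\<^sup>+y. f a (m (a + e * b) - m a) (P e a x y) \<partial>lborel \<partial>lborel)))
        = (\<integral>\<^sup>+x. \<integral>\<^sup>+y. ennreal (e ^ 5) * ennreal (F N e a b x y) \<partial>lborel \<partial>lborel)"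
        by (simp add: mult.assoc)
    qed
    finally show "ennreal e * (\<integral>\<^sup>+b. J a (a + e * b) * (ennreal (e ^ 3) * (\<integral>\<^sup>+x. \<integral>\<^sup>+y. f a (m (a + e * b) - m a) (P e a x y) \<partial>lborel \<partial>lborel)) \<partial>lborel)
      = (\<integral>\<^sup>+b. \<integral>\<^sup>+x. \<integral>\<^sup>+y. ennreal (e ^ 5) * ennreal (F N e a b x y) \<partial>lborel \<partial>lborel \<partial>lborel)" .
  qed
  also have "\<dots> = ennreal (e ^ 5) * (\<integral>\<^sup>+a. \<integral>\<^sup>+b. \<integral>\<^sup>+x. \<integral>\<^sup>+y. ennreal (F N e a b x y) \<partial>lborel \<partial>lborel \<partial>lborel \<partial>lborel)"
  proof -
    have m3: "(\<lambda>y. ennreal (F N e a b x y)) \<in> borel_measurable lborel" for a b x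
      unfolding F_def P_def by measurable
    have m4: "(\<lambda>x. \<integral>\<^sup>+y. ennreal (F N e a b x y) \<partial>lborel) \<in> borel_measurable lborel" for a b
      unfolding F_def P_def by measurable
    have m5: "(\<lambda>b. \<integral>\<^sup>+x. \<integral>\<^sup>+y. ennreal (F N e a b x y) \<partial>lborel \<partial>lborel) \<in> borel_measurable lborel" for a
      unfolding F_def P_def by measurable
    have m6: "(\<lambda>a. \<integral>\<^sup>+b. \<integral>\<^sup>+x. \<integral>\<^sup>+y. ennreal (F N e a b x y) \<partial>lborel \<partial>lborel \<partial>lborel) \<in> borel_measurable lborel"
      unfolding F_def P_def by measurable
    show ?thesis
      by (simp only: nn_integral_cmult[OF m3] nn_integral_cmult[OF m4] nn_integral_cmult[OF m5] nn_integral_cmult[OF m6])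
  qed
  finally have "T N = ennreal (e ^ 5) * (\<integral>\<^sup>+a. \<integral>\<^sup>+b. \<integral>\<^sup>+x. \<integral>\<^sup>+y. ennreal (F N e a b x y) \<partial>lborel \<partial>lborel \<partial>lborel \<partial>lborel) * ennreal (1 / A) * ennreal (1 / A)" .
  also have "\<dots> = (ennreal (e ^ 5) * ennreal (1 / A) * ennreal (1 / A)) * (\<integral>\<^sup>+a. \<integral>\<^sup>+b. \<integral>\<^sup>+x. \<integral>\<^sup>+y. ennreal (F N e a b x y) \<partial>lborel \<partial>lborel \<partial>lborel \<partial>lborel)"
    by (simp only: mult_ac)
  also have "ennreal (e ^ 5) * ennreal (1 / A) * ennreal (1 / A) = ennreal (e ^ 5 / A\<^sup>2)"
    using e A by (simp add: ennreal_mult[symmetric] power2_eq_square)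
  finally show ?thesis by (simp add: A_def)
qed

section \<open>Bounds uniform in the scale\<close>

text \<open>Both ends of the arc lie in \<open>K\<close>, but the boundary of the translate bends
  less than that of \<open>K\<close>; so a long arc forces its start to be deep.\<close>

lemma beta_bound:
  assumes e: "e > 0" and h: "0 < e * b" "e * b < pi"
    and PK: "P e a x y \<in> K" and PK2: "P e a x y + (m (a + e * b) - m a) \<in> K"
  shows "b\<^sup>2 \<le> 36 / (1 - R) * (1 + 18 / (1 - R)) * y"
proof -
  define h where "h = e * b"
  define c where "c = 1 - R"
  have c: "0 < c" using R_less by (simp add: c_def)
  have hb: "0 < h" "h < pi" using h by (auto simp: h_def)
  have b: "0 < b" using h e by (simp add: zero_less_mult_iff)
  have xy: "x\<^sup>2 + e\<^sup>2 * y\<^sup>2 \<le> 2 * R * y" by (rule P_in_K[OF e PK])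
  have "0 \<le> x\<^sup>2 + e\<^sup>2 * y\<^sup>2" by simp
  then have "0 \<le> 2 * R * y" using xy by linarith
  then have y: "0 \<le> y" using R_pos by (simp add: zero_le_mult_iff)
  have "2 * R * y \<le> 2 * 1 * y" using y R_less R_pos by (intro mult_mono) auto
  moreover have "0 \<le> e\<^sup>2 * y\<^sup>2" by simp
  ultimately have x2: "x\<^sup>2 \<le> 2 * y" using xy by linarith
  \<comment> \<open>The difference curve has radius at least \<open>1 - R\<close>. An arc of the
    translate started at \<open>k a\<close> would overshoot the supporting line of \<open>K\<close>
    at \<open>a + h\<close> by at least \<open>c * (1 - cos h)\<close>, which offset and depth of
    the start must compensate.\<close>
  have "((\<lambda>s. m s - k s) has_vector_derivative (r s - q s) *\<^sub>R W s) (at s)" for s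
    using has_vector_derivative_diff[OF der Ko.der] by (simp add: scaleR_diff_left)
  from turning_le[OF this, of "a + h" a c]
  have t: "U (a + h) \<bullet> ((m a - k a) - (m (a + h) - k (a + h))) \<le> - c * (1 - cos (a - (a + h)))"
    using r_ge q_le hb by (simp add: c_def) (smt (verit) r_ge q_le)
  have "U (a + h) \<bullet> (P e a x y + (m (a + h) - m a) - k (a + h)) \<le> 0"
    using PK2 Ko.mem_iff unfolding h_def by blast
  moreover have "U (a + h) \<bullet> (P e a x y + (m (a + h) - m a) - k (a + h))
    = e * x * sin h - e\<^sup>2 * y * cos h - U (a + h) \<bullet> ((m a - k a) - (m (a + h) - k (a + h)))"
    by (simp add: P_def inner_diff_right inner_add_right U_inner_W U_inner_U)
  ultimately have "c * (1 - cos h) \<le> e\<^sup>2 * y * cos h - e * x * sin h" using t by simp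
  also have "\<dots> \<le> e\<^sup>2 * y + e * \<bar>x\<bar> * h"
  proof -
    have "e\<^sup>2 * y * cos h \<le> e\<^sup>2 * y * 1" using y by (intro mult_left_mono) auto
    moreover have "- (e * x * sin h) \<le> e * \<bar>x\<bar> * h"
    proof -
      have "- (e * x * sin h) \<le> \<bar>e * x * sin h\<bar>" by simp
      also have "\<dots> = e * \<bar>x\<bar> * \<bar>sin h\<bar>" using e by (simp add: abs_mult)
      also have "\<dots> \<le> e * \<bar>x\<bar> * h" using e hb abs_sin_x_le_abs_x[of h] by (intro mult_left_mono) auto
      finally show ?thesis .
    qed
    ultimately show ?thesis by linarith
  qed
  finally have "c * (1 - cos h) \<le> e\<^sup>2 * y + e * \<bar>x\<bar> * h" .
  moreover have "c * (h\<^sup>2 / 18) \<le> c * (1 - cos h)" using one_minus_cos_ge[of h] hb c by (intro mult_left_mono) auto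
  ultimately have "c * (h\<^sup>2 / 18) \<le> e\<^sup>2 * y + e * \<bar>x\<bar> * h" by linarith
  then have "e\<^sup>2 * (c * (b\<^sup>2 / 18)) \<le> e\<^sup>2 * (y + \<bar>x\<bar> * b)" by (simp add: h_def power2_eq_square algebra_simps)
  then have 1: "c * (b\<^sup>2 / 18) \<le> y + \<bar>x\<bar> * b" using e by (simp add: mult_le_cancel_left)
  \<comment> \<open>The weights let the mixed term consume exactly half of
    \<open>c * b\<^sup>2 / 18\<close>; this doubles 18 to the 36 in the statement.\<close>
  have 2: "\<bar>x\<bar> * b \<le> c / 36 * b\<^sup>2 + 9 / c * x\<^sup>2"
  proof -
    have "0 \<le> (c * b - 18 * \<bar>x\<bar>)\<^sup>2 / (36 * c)" using c by simp
    also have "\<dots> = c / 36 * b\<^sup>2 + 9 / c * x\<^sup>2 - \<bar>x\<bar> * b"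
      using c by (simp add: power2_diff power_mult_distrib field_simps) (simp add: power2_eq_square)
    finally show ?thesis by linarith
  qed
  have 3: "9 / c * x\<^sup>2 \<le> 9 / c * (2 * y)" using x2 c by (intro mult_left_mono) auto
  have "c * (b\<^sup>2 / 18) = 2 * (c / 36 * b\<^sup>2)" "9 / c * (2 * y) = 18 / c * y" "(1 + 18 / c) * y = y + 18 / c * y"
    by (simp_all add: distrib_right)
  then have "c / 36 * b\<^sup>2 \<le> (1 + 18 / c) * y" using 1 2 3 by linarith
  then have "36 / c * (c / 36 * b\<^sup>2) \<le> 36 / c * ((1 + 18 / c) * y)" using c by (intro mult_left_mono) auto
  moreover have "36 / c * (c / 36 * b\<^sup>2) = b\<^sup>2" using c by simp
  ultimately show ?thesis unfolding c_def[symmetric] by (simp only: mult.assoc)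
qed

text \<open>A rectangle of area proportional to \<open>y\<close> is cut off: it lies in the disc of
  radius \<open>d\<close> inside \<open>K\<close>, and it is shallower than the tangent line of the
  translate. Subtracting 1 makes the bound trivial for small \<open>y\<close>.\<close>

lemma V_lower:
  assumes e: "e > 0" and d: "0 < d" "\<And>s. d \<le> q s" and PK: "P e a x y \<in> K"
  shows "sqrt (d / 2) * (d * y / 2 - 1) \<le> V (P e a x y - m a) / e ^ 3"
proof -
  \<comment> \<open>The rectangle has half width \<open>w\<close> and depths between
    \<open>\<theta> / 2\<close> and \<theta>; since \<open>d < 1\<close>, these depths stay below
    \<open>y\<close>.\<close>
  define \<theta> where "\<theta> = d * y / 2"
  define w where "w = sqrt (d / 2)"
  have w: "0 < w" "w\<^sup>2 = d / 2" using d by (simp_all add: w_def)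
  have xy: "x\<^sup>2 + e\<^sup>2 * y\<^sup>2 \<le> 2 * R * y" by (rule P_in_K[OF e PK])
  have "0 \<le> x\<^sup>2 + e\<^sup>2 * y\<^sup>2" by simp
  then have "0 \<le> 2 * R * y" using xy by linarith
  then have y: "0 \<le> y" using R_pos by (simp add: zero_le_mult_iff)
  have dR: "d < 1" using d(2)[of 0] q_le[of 0] R_less by linarith
  have V0: "0 \<le> V (P e a x y - m a) / e ^ 3" using V_nonneg e by simp
  show ?thesis
  proof (cases "\<theta> < 1")
    case True
    then have "w * (\<theta> - 1) \<le> 0" using w by (simp add: mult_nonneg_nonpos)
    then show ?thesis using V0 by (simp add: w_def \<theta>_def)
  next
    case False
    then have th: "1 \<le> \<theta>" by simp
    then have "y \<noteq> 0" by (auto simp: \<theta>_def)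
    then have y0: "0 < y" using y by simp
    have ey: "e\<^sup>2 * y \<le> 2"
    proof -
      have "0 \<le> x\<^sup>2" by simp
      then have "e\<^sup>2 * y\<^sup>2 \<le> 2 * R * y" using xy by linarith
      then have "y * (e\<^sup>2 * y) \<le> y * (2 * R)" by (simp add: power2_eq_square algebra_simps)
      then have "e\<^sup>2 * y \<le> 2 * R" using y0 by (simp add: mult_le_cancel_left)
      then show ?thesis using R_less by linarith
    qed
    have sub: "(x', y') \<in> H e a x y" if "x' \<in> {-w..w}" "y' \<in> {\<theta>/2..\<theta>}" for x' y'
    proof -
      have y': "0 < y'" "y' < y"
      proof -
        show "0 < y'" using that th by auto
        have "d * y / 2 < 1 * y" using y0 dR by simp
        then show "y' < y" using that by (simp add: \<theta>_def)
      qed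
      have "x'\<^sup>2 \<le> w\<^sup>2" using that w(1) by (intro abs_le_square_iff[THEN iffD1]) auto
      also have "\<dots> = d * (1 / 2)" using w by simp
      also have "\<dots> \<le> d * y'" using that th d by (intro mult_left_mono) auto
      finally have 1: "x'\<^sup>2 \<le> d * y'" .
      have "e\<^sup>2 * y' \<le> e\<^sup>2 * (d * y / 2)" using that by (intro mult_left_mono) (auto simp: \<theta>_def)
      also have "\<dots> = d / 2 * (e\<^sup>2 * y)" by simp
      also have "\<dots> \<le> d / 2 * 2" using ey d by (intro mult_left_mono) auto
      finally have "e\<^sup>2 * y' * y' \<le> d * y'" using y' by (intro mult_right_mono) auto
      then have 2: "x'\<^sup>2 + e\<^sup>2 * y'\<^sup>2 \<le> 2 * d * y'" using 1 by (simp add: power2_eq_square algebra_simps)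
      have "P e a x' y' \<in> K"
      proof (rule Ko.inner_ball[OF d(2)])
        have "P e a x' y' - (k a - d *\<^sub>R U a) = (e * x') *\<^sub>R W a + (d - e\<^sup>2 * y') *\<^sub>R U a"
          by (simp add: P_def algebra_simps)
        then have "(norm (P e a x' y' - (k a - d *\<^sub>R U a)))\<^sup>2 = (e * x')\<^sup>2 + (d - e\<^sup>2 * y')\<^sup>2" by (simp only: norm_UW)
        also have "\<dots> = d\<^sup>2 + e\<^sup>2 * (x'\<^sup>2 + e\<^sup>2 * y'\<^sup>2 - 2 * d * y')" by (simp add: power2_eq_square algebra_simps)
        also have "\<dots> \<le> d\<^sup>2" using 2 by (simp add: mult_nonneg_nonpos)
        finally show "norm (P e a x' y' - (k a - d *\<^sub>R U a)) \<le> d" using d by (simp add: power2_le_iff_abs_le)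
      qed
      moreover have "P e a x' y' - P e a x y + m a \<notin> M"
      proof
        assume "P e a x' y' - P e a x y + m a \<in> M"
        then have "U a \<bullet> (P e a x' y' - P e a x y + m a - m a) \<le> 0" using mem_iff by blast
        then have "e\<^sup>2 * (y - y') \<le> 0"
          unfolding P_diff by (simp add: inner_diff_right inner_add_right U_inner_W U_inner_U algebra_simps)
        moreover have "0 < e\<^sup>2 * (y - y')" using e y' by simp
        ultimately show False by simp
      qed
      ultimately show ?thesis by (simp add: H_def)
    qed
    have "ennreal (w * \<theta>) = ennreal (2 * w) * ennreal (\<theta> / 2)" using w th by (simp add: ennreal_mult[symmetric])
    also have "\<dots> = (\<integral>\<^sup>+x'. ennreal (\<theta> / 2) * indicator {-w..w} x' \<partial>lborel)"
      using w by (subst nn_integral_cmult_indicator) (simp_all add: mult.commute)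
    also have "\<dots> = (\<integral>\<^sup>+x'. \<integral>\<^sup>+y'. indicator {-w..w} x' * indicator {\<theta>/2..\<theta>} y' \<partial>lborel \<partial>lborel)"
      using th by (intro nn_integral_cong, subst nn_integral_cmult) (auto simp: mult.commute)
    also have "\<dots> \<le> (\<integral>\<^sup>+x'. \<integral>\<^sup>+y'. indicator (H e a x y) (x', y') \<partial>lborel \<partial>lborel)"
      using sub by (intro nn_integral_mono) (auto simp: indicator_def)
    also have "\<dots> = ennreal (V (P e a x y - m a) / e ^ 3)" by (rule V_chart[OF e, symmetric])
    finally have "w * \<theta> \<le> V (P e a x y - m a) / e ^ 3" using V0 by (simp add: ennreal_le_iff)
    moreover have "w * (\<theta> - 1) \<le> w * \<theta>" using w by simp
    ultimately have "w * (\<theta> - 1) \<le> V (P e a x y - m a) / e ^ 3" by (rule order_trans[rotated])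
    then show ?thesis unfolding w_def \<theta>_def .
  qed
qed

end

lemma nn_integral_exp_abs:
  assumes "0 < (g::real)"
  shows "(\<integral>\<^sup>+x. ennreal (exp (- g * \<bar>x\<bar>)) \<partial>lborel) < \<infinity>"
proof -
  have 1: "(\<integral>\<^sup>+x. ennreal (exp (- g * x)) * indicator {0..} x \<partial>lborel) = ennreal (0 - (- exp (- g * 0) / g))"
  proof (rule nn_integral_FTC_atLeast[where F = "\<lambda>x. - exp (- g * x) / g"])
    show "((\<lambda>x. - exp (- g * x) / g) has_real_derivative exp (- g * x)) (at x)" for x
      using assms by (auto intro!: derivative_eq_intros)
    show "((\<lambda>x. - exp (- g * x) / g) \<longlongrightarrow> 0) at_top" using assms by real_asymp
  qed auto
  have 2: "(\<integral>\<^sup>+x. ennreal (exp (- g * \<bar>x\<bar>)) * indicator {..0} x \<partial>lborel)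
    = (\<integral>\<^sup>+x. ennreal (exp (- g * x)) * indicator {0..} x \<partial>lborel)"
    by (subst nn_integral_real_affine[where c = "-1" and t = 0])
      (auto intro!: nn_integral_cong simp: indicator_def)
  have "(\<integral>\<^sup>+x. ennreal (exp (- g * \<bar>x\<bar>)) \<partial>lborel)
    \<le> (\<integral>\<^sup>+x. ennreal (exp (- g * \<bar>x\<bar>)) * indicator {..0} x + ennreal (exp (- g * x)) * indicator {0..} x \<partial>lborel)"
    by (intro nn_integral_mono) (auto simp: indicator_def)
  also have "\<dots> = (\<integral>\<^sup>+x. ennreal (exp (- g * \<bar>x\<bar>)) * indicator {..0} x \<partial>lborel) + (\<integral>\<^sup>+x. ennreal (exp (- g * x)) * indicator {0..} x \<partial>lborel)"
    by (rule nn_integral_add) auto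
  also have "\<dots> < \<infinity>" unfolding 2 unfolding 1 by (simp add: ennreal_add_eq_top less_top)
  finally show ?thesis .
qed

lemma nn_integral_limit_step:
  fixes f :: "nat \<Rightarrow> 'a \<Rightarrow> ennreal"
  assumes "\<And>n. f n \<in> borel_measurable N" "f' \<in> borel_measurable N" "w \<in> borel_measurable N"
    and "AE x in N. (\<lambda>n. f n x) \<longlonglongrightarrow> f' x" "\<And>n x. f n x \<le> w x" "(\<integral>\<^sup>+x. w x \<partial>N) < \<infinity>"
  shows "(\<lambda>n. \<integral>\<^sup>+x. f n x \<partial>N) \<longlonglongrightarrow> (\<integral>\<^sup>+x. f' x \<partial>N)"
  by (rule nn_integral_dominated_convergence[where w = w]) (use assms in auto)

context oval_pair begin

text \<open>\<open>V_lower\<close> gives exponential decay in \<open>y\<close> alone. The depth in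
  turn dominates the squares of offset and arc length, so part of the decay can be passed on to
  \<open>x\<close> and \<open>b\<close>.\<close>

lemma F_dominated:
  obtains C g where "0 \<le> C" "0 < g"
    "\<And>N e a b x y. 0 < e \<Longrightarrow> 1 / 2 \<le> real N * e ^ 3 \<Longrightarrow>
      F N e a b x y \<le> indicator {0..<2*pi} a * (C * (exp (- g * \<bar>b\<bar>) * (exp (- g * \<bar>x\<bar>) * exp (- g * \<bar>y\<bar>))))"
proof -
  obtain Cr where Cr: "0 < Cr" "\<And>s. r s \<le> Cr" by (rule r_upper) blast
  obtain d where d: "0 < d" "\<And>s. d \<le> q s" by (rule Ko.r_lower) blast
  define A where "A = measure lborel K"
  define B where "B = 36 / (1 - R) * (1 + 18 / (1 - R))"
  define w where "w = sqrt (d / 2)"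
  \<comment> \<open>\<open>3 * c\<close> is the rate in \<open>y\<close> that \<open>V_lower\<close>
    yields when \<open>real N * e ^ 3\<close> is at least 1/2; one third each goes to
    \<open>b\<close>, \<open>x\<close> and \<open>y\<close>.\<close>
  define c where "c = w * (d / 2) / (2 * A) / 3"
  define g1 where "g1 = c / B"
  have A: "0 < A" using K_pos by (simp add: A_def)
  have B: "0 < B" unfolding B_def using R_less by (intro mult_pos_pos add_pos_pos) auto
  have w: "0 < w" using d by (simp add: w_def)
  have c: "0 < c" unfolding c_def using w d A by simp
  have g1: "0 < g1" using c B by (simp add: g1_def)
  define g where "g = min g1 c"
  have g: "0 < g" "g \<le> g1" "g \<le> c" using g1 c by (auto simp: g_def)
  define C where "C = Cr\<^sup>2 * exp (w / (2 * A)) * (exp g1 / g1) * exp c"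
  have C0: "0 \<le> C" unfolding C_def using g1 by simp
  show ?thesis
  proof (rule that[OF C0 g(1)])
    fix N :: nat and e a b x y :: real
    assume e: "0 < e" and Ne: "1 / 2 \<le> real N * e ^ 3"
    let ?rhs = "indicator {0..<2*pi} a * (C * (exp (- g * \<bar>b\<bar>) * (exp (- g * \<bar>x\<bar>) * exp (- g * \<bar>y\<bar>)))) :: real"
    have rhs0: "0 \<le> ?rhs" using C0 by simp
    show "F N e a b x y \<le> ?rhs"
    proof (cases "a \<in> {0..<2*pi} \<and> e * b \<in> {0<..<pi} \<and> P e a x y \<in> K \<and> P e a x y + (m (a + e * b) - m a) \<in> K")
      case False
      then have "F N e a b x y = 0" by (auto simp: F_def indicator_def)
      then show ?thesis using rhs0 by simp
    next
      case True
      define v where "v = V (P e a x y - m a)"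
      have b: "0 < b" using True e by (auto simp: zero_less_mult_iff)
      have xy: "x\<^sup>2 + e\<^sup>2 * y\<^sup>2 \<le> 2 * R * y" by (rule P_in_K[OF e]) (use True in blast)
      have "0 \<le> x\<^sup>2 + e\<^sup>2 * y\<^sup>2" by simp
      then have "0 \<le> 2 * R * y" using xy by linarith
      then have y: "0 \<le> y" using R_pos by (simp add: zero_le_mult_iff)
      have "2 * R * y \<le> 2 * 1 * y" using y R_less R_pos by (intro mult_mono) auto
      moreover have "0 \<le> e\<^sup>2 * y\<^sup>2" by simp
      ultimately have x2: "x\<^sup>2 \<le> 2 * y" using xy by linarith
      have b2: "b\<^sup>2 \<le> B * y" unfolding B_def by (rule beta_bound[OF e]) (use True in auto)
      have V1: "w * (d * y / 2 - 1) \<le> v / e ^ 3"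
        unfolding w_def v_def by (rule V_lower[OF e d]) (use True in blast)
      have v0: "0 \<le> v / e ^ 3" using V_nonneg e by (simp add: v_def)
      have vA: "0 \<le> 1 - v / A" using V_ratio by (simp add: v_def A_def)
      have "(1 - v / A) ^ N \<le> exp (- (v / A)) ^ N"
        using exp_ge_add_one_self[of "- (v / A)"] vA by (intro power_mono) auto
      also have "\<dots> = exp (- ((real N * e ^ 3) * (v / e ^ 3) / A))"
        using e by (simp flip: exp_of_nat_mult)
      also have "\<dots> \<le> exp (- ((1 / 2) * (v / e ^ 3) / A))"
      proof -
        have "(1 / 2) * (v / e ^ 3) \<le> (real N * e ^ 3) * (v / e ^ 3)" using Ne v0 by (intro mult_right_mono) auto
        then have "(1 / 2) * (v / e ^ 3) / A \<le> (real N * e ^ 3) * (v / e ^ 3) / A" using A by (intro divide_right_mono) auto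
        then show ?thesis by simp
      qed
      also have "\<dots> \<le> exp (- ((1 / 2) * (w * (d * y / 2 - 1)) / A))"
      proof -
        have "(1 / 2) * (w * (d * y / 2 - 1)) / A \<le> (1 / 2) * (v / e ^ 3) / A"
          using V1 A by (intro divide_right_mono mult_left_mono) auto
        then show ?thesis by simp
      qed
      also have "- ((1 / 2) * (w * (d * y / 2 - 1)) / A) = w / (2 * A) - 3 * c * y"
        using A by (simp add: c_def field_simps)
      finally have pw: "(1 - v / A) ^ N \<le> exp (w / (2 * A) - 3 * c * y)" .
      \<comment> \<open>A quadratic bound is weakened to a linear one by \<open>two_abs_le\<close>.
        Its factor 2 yields two exponentials in \<open>b\<close>: one absorbs the factor
        \<open>b\<close> of the Jacobian, the other makes the bound integrable.\<close>
      have e1: "2 * g1 * b - g1 \<le> c * y"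
      proof -
        have "2 * b - 1 \<le> B * y" using two_abs_le[of b] b b2 by linarith
        then have "g1 * (2 * b - 1) \<le> g1 * (B * y)" using g1 by (intro mult_left_mono) auto
        also have "g1 * (B * y) = c * y" using B by (simp add: g1_def)
        finally show ?thesis by (simp add: algebra_simps)
      qed
      have e2: "c * \<bar>x\<bar> - c \<le> c * y"
      proof -
        have "\<bar>x\<bar> - 1 \<le> y" using two_abs_le[of x] x2 by linarith
        then have "c * (\<bar>x\<bar> - 1) \<le> c * y" using c by (intro mult_left_mono) auto
        then show ?thesis by (simp add: algebra_simps)
      qed
      have "w / (2 * A) - 3 * c * y \<le> w / (2 * A) + (g1 - 2 * g1 * b) + (c - c * \<bar>x\<bar>) - c * y"
        using e1 e2 by linarith
      then have "exp (w / (2 * A) - 3 * c * y) \<le> exp (w / (2 * A) + (g1 - 2 * g1 * b) + (c - c * \<bar>x\<bar>) - c * y)" by simp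
      also have "\<dots> = exp (w / (2 * A)) * (exp g1 * exp (- g1 * b) * exp (- g1 * b)) * (exp c * exp (- c * \<bar>x\<bar>)) * exp (- c * \<bar>y\<bar>)"
        using y by (simp flip: exp_add)
      finally have pw2: "(1 - v / A) ^ N \<le> \<dots>" using pw by linarith
      have sb: "sin (e * b) / e \<le> b"
      proof -
        have "sin (e * b) \<le> e * b" using True by (intro sin_x_le_x) auto
        then show ?thesis using e by (simp add: pos_divide_le_eq mult.commute)
      qed
      have s0: "0 \<le> sin (e * b) / e" using True e by (intro divide_nonneg_pos sin_ge_zero) auto
      have bexp: "b * exp (- g1 * b) \<le> 1 / g1"
      proof -
        have "g1 * b \<le> exp (g1 * b)" using exp_ge_add_one_self[of "g1 * b"] by linarith
        then have "g1 * b * exp (- g1 * b) \<le> exp (g1 * b) * exp (- g1 * b)" by (intro mult_right_mono) auto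
        then have "g1 * (b * exp (- g1 * b)) \<le> 1" by (simp flip: exp_add)
        then show ?thesis using g1 by (simp add: pos_le_divide_eq mult.commute)
      qed
      have "F N e a b x y = r a * r (a + e * b) * (sin (e * b) / e) * (1 - v / A) ^ N"
        using True by (simp add: F_def v_def A_def)
      also have "\<dots> \<le> (Cr * Cr * b) * (exp (w / (2 * A)) * (exp g1 * exp (- g1 * b) * exp (- g1 * b)) * (exp c * exp (- c * \<bar>x\<bar>)) * exp (- c * \<bar>y\<bar>))"
        using Cr sb s0 r_pos[of a] r_pos[of "a + e * b"] vA pw2 b
        by (intro mult_mono) (auto intro!: mult_nonneg_nonneg intro: less_imp_le order_trans)
      also have "\<dots> = (Cr\<^sup>2 * exp (w / (2 * A)) * exp g1 * exp c) * ((b * exp (- g1 * b)) * (exp (- g1 * b) * (exp (- c * \<bar>x\<bar>) * exp (- c * \<bar>y\<bar>))))"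
        by (simp add: power2_eq_square mult_ac)
      also have "\<dots> \<le> (Cr\<^sup>2 * exp (w / (2 * A)) * exp g1 * exp c) * ((1 / g1) * (exp (- g * \<bar>b\<bar>) * (exp (- g * \<bar>x\<bar>) * exp (- g * \<bar>y\<bar>))))"
        using bexp g b g1 by (intro mult_left_mono mult_mono) (auto intro: mult_right_mono)
      also have "\<dots> = C * (exp (- g * \<bar>b\<bar>) * (exp (- g * \<bar>x\<bar>) * exp (- g * \<bar>y\<bar>)))"
        by (simp add: C_def)
      finally show ?thesis using True by simp
    qed
  qed
qed

section \<open>Passage to the limit\<close>

definition Flim :: "real \<Rightarrow> real \<Rightarrow> real \<Rightarrow> real \<Rightarrow> real" where
  "Flim a b x y = indicator {0..<2*pi} a * (indicator {0<..} b * ((r a)\<^sup>2 * b *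
    (of_bool (x\<^sup>2 / (2 * q a) < y) * of_bool ((x + r a * b)\<^sup>2 / (2 * q a) < y + r a * b\<^sup>2 / 2) *
      exp (- (4 / 3 * sag a x y * sqrt (2 * sag a x y / kap a) / measure lborel K)))))"

text \<open>The two excluded values of \<open>y\<close> are those for which one end of the arc lies
  on the limiting parabola of \<open>K\<close>, where membership need not stabilize.\<close>

lemma F_tendsto:
  assumes e: "\<And>n. e n > 0" "\<And>n. e n \<le> 1" "e \<longlonglongrightarrow> 0" and Ne: "(\<lambda>n. real (N n) * e n ^ 3) \<longlonglongrightarrow> 1"
    and ne: "y \<noteq> x\<^sup>2 / (2 * q a)" "y \<noteq> (x + r a * b)\<^sup>2 / (2 * q a) - r a * b\<^sup>2 / 2"
  shows "(\<lambda>n. F (N n) (e n) a b x y) \<longlonglongrightarrow> Flim a b x y"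
proof (cases "b > 0 \<and> x\<^sup>2 / (2 * q a) < y")
  case False
  have "\<forall>\<^sub>F n in sequentially. F (N n) (e n) a b x y = 0"
  proof (cases "b > 0")
    case False
    then have "e n * b \<notin> {0<..<pi}" for n using e(1)[of n] by (auto simp: zero_less_mult_iff)
    then show ?thesis by (simp add: F_def)
  next
    case True
    then have "y < x\<^sup>2 / (2 * q a)" using False ne by auto
    from Ko.eventually_below_parabola[OF e(1,3) tendsto_const tendsto_const this]
    show ?thesis by eventually_elim (simp add: F_def P_def)
  qed
  moreover have "Flim a b x y = 0" using False by (auto simp: Flim_def)
  ultimately show ?thesis by (simp add: tendsto_eventually)
next
  case True
  then have b: "0 < b" and xy: "x\<^sup>2 / (2 * q a) < y" by auto
  have "0 \<le> x\<^sup>2 / (2 * q a)" using Ko.r_pos[of a] by simp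
  then have y: "0 \<le> y" using xy by linarith
  define A where "A = measure lborel K"
  have A: "0 < A" using K_pos by (simp add: A_def)
  define v where "v = 4 / 3 * sag a x y * sqrt (2 * sag a x y / kap a)"
  have eb: "(\<lambda>n. e n * b) \<longlonglongrightarrow> 0" using tendsto_mult[OF e(3) tendsto_const, of b] by simp
  have l1: "\<forall>\<^sub>F n in sequentially. e n * b \<in> {0<..<pi}"
  proof -
    have "\<forall>\<^sub>F n in sequentially. e n * b < pi" by (rule order_tendstoD(2)[OF eb]) simp
    then show ?thesis using e(1) b by (auto elim!: eventually_mono)
  qed
  have l2: "\<forall>\<^sub>F n in sequentially. P (e n) a x y \<in> K"
    using Ko.eventually_above_parabola[OF e(1,3) tendsto_const tendsto_const xy] by (simp add: P_def)
  \<comment> \<open>\<open>X\<close> and \<open>Y\<close> are the rescaled coordinates of the second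
    end of the arc; in the limit that end moves along the parabola of the translate.\<close>
  define X where "X n = x + W a \<bullet> (m (a + e n * b) - m a) / e n" for n
  define Y where "Y n = y - U a \<bullet> (m (a + e n * b) - m a) / (e n)\<^sup>2" for n
  have PXY: "P (e n) a x y + (m (a + e n * b) - m a) = k a + (e n * X n) *\<^sub>R W a - ((e n)\<^sup>2 * Y n) *\<^sub>R U a" for n
  proof -
    have "e n * X n = e n * x + W a \<bullet> (m (a + e n * b) - m a)"
      "(e n)\<^sup>2 * Y n = (e n)\<^sup>2 * y - U a \<bullet> (m (a + e n * b) - m a)"
      using e(1)[of n] by (simp_all add: X_def Y_def distrib_left right_diff_distrib)
    note XY = this
    define d where "d = m (a + e n * b) - m a"
    have "P (e n) a x y + d = k a + (e n * x) *\<^sub>R W a - ((e n)\<^sup>2 * y) *\<^sub>R U a + ((W a \<bullet> d) *\<^sub>R W a + (U a \<bullet> d) *\<^sub>R U a)"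
      unfolding P_def using U_decomp[of d a] by simp
    also have "\<dots> = k a + (e n * x + W a \<bullet> d) *\<^sub>R W a - ((e n)\<^sup>2 * y - U a \<bullet> d) *\<^sub>R U a"
      by (simp add: scaleR_add_left scaleR_diff_left)
    finally show ?thesis unfolding XY d_def .
  qed
  have Xl: "X \<longlonglongrightarrow> x + r a * b" unfolding X_def by (intro tendsto_intros tangent_limit e)
  have "Y \<longlonglongrightarrow> y - - (r a * b\<^sup>2 / 2)" unfolding Y_def by (intro tendsto_intros normal_limit e)
  then have Yl: "Y \<longlonglongrightarrow> y + r a * b\<^sup>2 / 2" by simp
  have l3: "\<forall>\<^sub>F n in sequentially. (P (e n) a x y + (m (a + e n * b) - m a) \<in> K) = ((x + r a * b)\<^sup>2 / (2 * q a) < y + r a * b\<^sup>2 / 2)"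
  proof (cases "(x + r a * b)\<^sup>2 / (2 * q a) < y + r a * b\<^sup>2 / 2")
    case True
    from Ko.eventually_above_parabola[OF e(1,3) Xl Yl True] show ?thesis
      unfolding PXY by eventually_elim (use True in simp)
  next
    case False
    then have "y + r a * b\<^sup>2 / 2 < (x + r a * b)\<^sup>2 / (2 * q a)" using ne(2) by auto
    from Ko.eventually_below_parabola[OF e(1,3) Xl Yl this] show ?thesis
      unfolding PXY by eventually_elim (use False in simp)
  qed
  have rl: "(\<lambda>n. r (a + e n * b)) \<longlonglongrightarrow> r a"
  proof -
    have "(\<lambda>n. a + e n * b) \<longlonglongrightarrow> a + 0" by (intro tendsto_intros eb)
    then show ?thesis using continuous_on_tendsto_compose[OF cont_r, of "\<lambda>n. a + e n * b" a sequentially] by simp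
  qed
  have Vl: "(\<lambda>n. V (P (e n) a x y - m a) / e n ^ 3) \<longlonglongrightarrow> v"
    unfolding v_def by (rule V_limit[OF e y])
  have pl: "(\<lambda>n. (1 - V (P (e n) a x y - m a) / A) ^ N n) \<longlonglongrightarrow> exp (- (v / A))"
  proof (rule tendsto_power_exp)
    have l: "(\<lambda>n. (V (P (e n) a x y - m a) / e n ^ 3) * e n ^ 3 / A) \<longlonglongrightarrow> v * 0 ^ 3 / A"
      using A by (intro tendsto_intros Vl e) auto
    have eq: "(V (P (e n) a x y - m a) / e n ^ 3) * e n ^ 3 / A = V (P (e n) a x y - m a) / A" for n
      using e(1)[of n] by simp
    show "(\<lambda>n. V (P (e n) a x y - m a) / A) \<longlonglongrightarrow> 0" using l unfolding eq by simp
    have l': "(\<lambda>n. (real (N n) * e n ^ 3) * (V (P (e n) a x y - m a) / e n ^ 3) / A) \<longlonglongrightarrow> 1 * v / A"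
      using A by (intro tendsto_intros Vl Ne) auto
    have eq': "(real (N n) * e n ^ 3) * (V (P (e n) a x y - m a) / e n ^ 3) / A = real (N n) * (V (P (e n) a x y - m a) / A)" for n
      using e(1)[of n] by simp
    show "(\<lambda>n. real (N n) * (V (P (e n) a x y - m a) / A)) \<longlonglongrightarrow> v / A" using l' unfolding eq' by simp
  qed
  have "(\<lambda>n. indicator {0..<2*pi} a * (r a * r (a + e n * b) * (sin (e n * b) / e n) *
      (of_bool ((x + r a * b)\<^sup>2 / (2 * q a) < y + r a * b\<^sup>2 / 2) * (1 - V (P (e n) a x y - m a) / A) ^ N n)))
    \<longlonglongrightarrow> indicator {0..<2*pi} a * (r a * r a * b * (of_bool ((x + r a * b)\<^sup>2 / (2 * q a) < y + r a * b\<^sup>2 / 2) * exp (- (v / A))))"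
    by (intro tendsto_intros rl pl tendsto_sin_mult_div e)
  moreover have "indicator {0..<2*pi} a * (r a * r a * b * (of_bool ((x + r a * b)\<^sup>2 / (2 * q a) < y + r a * b\<^sup>2 / 2) * exp (- (v / A)))) = Flim a b x y"
    using True by (simp add: Flim_def v_def A_def power2_eq_square)
  moreover have "\<forall>\<^sub>F n in sequentially. indicator {0..<2*pi} a * (r a * r (a + e n * b) * (sin (e n * b) / e n) *
      (of_bool ((x + r a * b)\<^sup>2 / (2 * q a) < y + r a * b\<^sup>2 / 2) * (1 - V (P (e n) a x y - m a) / A) ^ N n)) = F (N n) (e n) a b x y"
    using l1 l2 l3
  proof eventually_elim
    case (elim n)
    show ?case unfolding F_def A_def elim(3)[symmetric] using elim(1,2) by (simp add: indicator_def)
  qed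
  ultimately show ?thesis using Lim_transform_eventually by fastforce
qed

text \<open>Dominated convergence is applied to the four integrals from the inside out. The bound is
  a product of functions of one variable, so each integration merely replaces one factor by the
  constant \<open>G\<close>.\<close>

lemma T_limit:
  assumes e: "\<And>n. e n > 0" "\<And>n. e n \<le> 1" "e \<longlonglongrightarrow> 0" and Ne: "(\<lambda>n. real (N n) * e n ^ 3) \<longlonglongrightarrow> 1"
    and half: "\<And>n. 1 / 2 \<le> real (N n) * e n ^ 3"
  shows "(\<lambda>n. \<integral>\<^sup>+a. \<integral>\<^sup>+b. \<integral>\<^sup>+x. \<integral>\<^sup>+y. ennreal (F (N n) (e n) a b x y) \<partial>lborel \<partial>lborel \<partial>lborel \<partial>lborel)
    \<longlonglongrightarrow> (\<integral>\<^sup>+a. \<integral>\<^sup>+b. \<integral>\<^sup>+x. \<integral>\<^sup>+y. ennreal (Flim a b x y) \<partial>lborel \<partial>lborel \<partial>lborel \<partial>lborel)"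
proof -
  obtain C g where C: "0 \<le> C" and g: "0 < g" and dom: "\<And>n a b x y. F (N n) (e n) a b x y
      \<le> indicator {0..<2*pi} a * (C * (exp (- g * \<bar>b\<bar>) * (exp (- g * \<bar>x\<bar>) * exp (- g * \<bar>y\<bar>))))"
    using F_dominated e(1) half by metis
  define G where "G = (\<integral>\<^sup>+x. ennreal (exp (- g * \<bar>x\<bar>)) \<partial>lborel)"
  have G: "G < \<infinity>" unfolding G_def by (rule nn_integral_exp_abs[OF g])
  have dom': "ennreal (F (N n) (e n) a b x y) \<le> indicator {0..<2*pi} a * (ennreal C * (ennreal (exp (- g * \<bar>b\<bar>)) *
      (ennreal (exp (- g * \<bar>x\<bar>)) * ennreal (exp (- g * \<bar>y\<bar>)))))" for n a b x y
    using ennreal_leI[OF dom[of n a b x y]] C by (cases "a \<in> {0..<2*pi}") (simp_all add: ennreal_mult)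
  have Fm [measurable]: "(\<lambda>p. ennreal (F N e (fst p) (fst (snd p)) (fst (snd (snd p))) (snd (snd (snd p)))))
      \<in> borel_measurable (borel \<Otimes>\<^sub>M borel \<Otimes>\<^sub>M borel \<Otimes>\<^sub>M borel)" for N e
    unfolding F_def P_def by measurable
  note ms = F_def P_def Flim_def sag_def kap_def
  have 1: "(\<lambda>n. \<integral>\<^sup>+y. ennreal (F (N n) (e n) a b x y) \<partial>lborel) \<longlonglongrightarrow> (\<integral>\<^sup>+y. ennreal (Flim a b x y) \<partial>lborel)" for a b x
  proof (rule nn_integral_limit_step[where w = "\<lambda>y. (indicator {0..<2*pi} a * (ennreal C * (ennreal (exp (- g * \<bar>b\<bar>)) *
      ennreal (exp (- g * \<bar>x\<bar>))))) * ennreal (exp (- g * \<bar>y\<bar>))"])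
    have "AE y in lborel. y \<noteq> x\<^sup>2 / (2 * q a)" "AE y in lborel. y \<noteq> (x + r a * b)\<^sup>2 / (2 * q a) - r a * b\<^sup>2 / 2"
      by (rule AE_lborel_singleton)+
    then show "AE y in lborel. (\<lambda>n. ennreal (F (N n) (e n) a b x y)) \<longlonglongrightarrow> ennreal (Flim a b x y)"
      by eventually_elim (intro tendsto_ennrealI F_tendsto e Ne)
    show "ennreal (F (N n) (e n) a b x y) \<le> (indicator {0..<2*pi} a * (ennreal C * (ennreal (exp (- g * \<bar>b\<bar>)) *
      ennreal (exp (- g * \<bar>x\<bar>))))) * ennreal (exp (- g * \<bar>y\<bar>))" for n y
      using dom'[of n a b x y] by (simp only: mult.assoc)
    show "(\<integral>\<^sup>+y. (indicator {0..<2*pi} a * (ennreal C * (ennreal (exp (- g * \<bar>b\<bar>)) *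
      ennreal (exp (- g * \<bar>x\<bar>))))) * ennreal (exp (- g * \<bar>y\<bar>)) \<partial>lborel) < \<infinity>"
      using G unfolding G_def by (subst nn_integral_cmult) (auto simp: ennreal_mult_less_top indicator_def)
    show "(\<lambda>y. ennreal (F (N n) (e n) a b x y)) \<in> borel_measurable lborel" for n unfolding ms by measurable
    show "(\<lambda>y. ennreal (Flim a b x y)) \<in> borel_measurable lborel" unfolding ms by measurable
  qed measurable
  have b1: "(\<integral>\<^sup>+y. ennreal (F (N n) (e n) a b x y) \<partial>lborel)
    \<le> (indicator {0..<2*pi} a * (ennreal C * ennreal (exp (- g * \<bar>b\<bar>))) * G) * ennreal (exp (- g * \<bar>x\<bar>))" for n a b x
  proof -
    have "(\<integral>\<^sup>+y. ennreal (F (N n) (e n) a b x y) \<partial>lborel)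
      \<le> (\<integral>\<^sup>+y. (indicator {0..<2*pi} a * (ennreal C * (ennreal (exp (- g * \<bar>b\<bar>)) * ennreal (exp (- g * \<bar>x\<bar>))))) * ennreal (exp (- g * \<bar>y\<bar>)) \<partial>lborel)"
      using dom' by (intro nn_integral_mono) (simp only: mult.assoc)
    also have "\<dots> = (indicator {0..<2*pi} a * (ennreal C * (ennreal (exp (- g * \<bar>b\<bar>)) * ennreal (exp (- g * \<bar>x\<bar>))))) * G"
      unfolding G_def by (rule nn_integral_cmult) measurable
    finally show ?thesis by (simp only: mult_ac)
  qed
  have 2: "(\<lambda>n. \<integral>\<^sup>+x. \<integral>\<^sup>+y. ennreal (F (N n) (e n) a b x y) \<partial>lborel \<partial>lborel) \<longlonglongrightarrow> (\<integral>\<^sup>+x. \<integral>\<^sup>+y. ennreal (Flim a b x y) \<partial>lborel \<partial>lborel)" for a b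
  proof (rule nn_integral_limit_step[where w = "\<lambda>x. (indicator {0..<2*pi} a * (ennreal C * ennreal (exp (- g * \<bar>b\<bar>))) * G) * ennreal (exp (- g * \<bar>x\<bar>))"])
    show "(\<integral>\<^sup>+x. (indicator {0..<2*pi} a * (ennreal C * ennreal (exp (- g * \<bar>b\<bar>))) * G) * ennreal (exp (- g * \<bar>x\<bar>)) \<partial>lborel) < \<infinity>"
      using G unfolding G_def by (subst nn_integral_cmult) (auto simp: ennreal_mult_less_top indicator_def)
    show "(\<lambda>x. \<integral>\<^sup>+y. ennreal (F (N n) (e n) a b x y) \<partial>lborel) \<in> borel_measurable lborel" for n unfolding ms by measurable
    show "(\<lambda>x. \<integral>\<^sup>+y. ennreal (Flim a b x y) \<partial>lborel) \<in> borel_measurable lborel" unfolding ms by measurable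
  qed (use 1 b1 in \<open>auto intro: AE_I2\<close>)
  have b2: "(\<integral>\<^sup>+x. \<integral>\<^sup>+y. ennreal (F (N n) (e n) a b x y) \<partial>lborel \<partial>lborel)
    \<le> (indicator {0..<2*pi} a * ennreal C * G * G) * ennreal (exp (- g * \<bar>b\<bar>))" for n a b
  proof -
    have "(\<integral>\<^sup>+x. \<integral>\<^sup>+y. ennreal (F (N n) (e n) a b x y) \<partial>lborel \<partial>lborel)
      \<le> (\<integral>\<^sup>+x. (indicator {0..<2*pi} a * (ennreal C * ennreal (exp (- g * \<bar>b\<bar>))) * G) * ennreal (exp (- g * \<bar>x\<bar>)) \<partial>lborel)"
      by (intro nn_integral_mono b1)
    also have "\<dots> = (indicator {0..<2*pi} a * (ennreal C * ennreal (exp (- g * \<bar>b\<bar>))) * G) * G"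
      unfolding G_def[symmetric] by (subst nn_integral_cmult) (auto simp: G_def)
    finally show ?thesis by (simp only: mult_ac)
  qed
  have 3: "(\<lambda>n. \<integral>\<^sup>+b. \<integral>\<^sup>+x. \<integral>\<^sup>+y. ennreal (F (N n) (e n) a b x y) \<partial>lborel \<partial>lborel \<partial>lborel)
    \<longlonglongrightarrow> (\<integral>\<^sup>+b. \<integral>\<^sup>+x. \<integral>\<^sup>+y. ennreal (Flim a b x y) \<partial>lborel \<partial>lborel \<partial>lborel)" for a
  proof (rule nn_integral_limit_step[where w = "\<lambda>b. (indicator {0..<2*pi} a * ennreal C * G * G) * ennreal (exp (- g * \<bar>b\<bar>))"])
    show "(\<integral>\<^sup>+b. (indicator {0..<2*pi} a * ennreal C * G * G) * ennreal (exp (- g * \<bar>b\<bar>)) \<partial>lborel) < \<infinity>"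
      using G unfolding G_def by (subst nn_integral_cmult) (auto simp: ennreal_mult_less_top indicator_def)
    show "(\<lambda>b. \<integral>\<^sup>+x. \<integral>\<^sup>+y. ennreal (F (N n) (e n) a b x y) \<partial>lborel \<partial>lborel) \<in> borel_measurable lborel" for n unfolding ms by measurable
    show "(\<lambda>b. \<integral>\<^sup>+x. \<integral>\<^sup>+y. ennreal (Flim a b x y) \<partial>lborel \<partial>lborel) \<in> borel_measurable lborel" unfolding ms by measurable
  qed (use 2 b2 in \<open>auto intro: AE_I2\<close>)
  have b3: "(\<integral>\<^sup>+b. \<integral>\<^sup>+x. \<integral>\<^sup>+y. ennreal (F (N n) (e n) a b x y) \<partial>lborel \<partial>lborel \<partial>lborel)
    \<le> (ennreal C * G * G * G) * indicator {0..<2*pi} a" for n a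
  proof -
    have "(\<integral>\<^sup>+b. \<integral>\<^sup>+x. \<integral>\<^sup>+y. ennreal (F (N n) (e n) a b x y) \<partial>lborel \<partial>lborel \<partial>lborel)
      \<le> (\<integral>\<^sup>+b. (indicator {0..<2*pi} a * ennreal C * G * G) * ennreal (exp (- g * \<bar>b\<bar>)) \<partial>lborel)"
      by (intro nn_integral_mono b2)
    also have "\<dots> = (indicator {0..<2*pi} a * ennreal C * G * G) * G"
      unfolding G_def[symmetric] by (subst nn_integral_cmult) (auto simp: G_def)
    finally show ?thesis by (simp only: mult_ac)
  qed
  show ?thesis
  proof (rule nn_integral_limit_step[where w = "\<lambda>a. (ennreal C * G * G * G) * indicator {0..<2*pi} a"])
    show "(\<integral>\<^sup>+a. (ennreal C * G * G * G) * indicator {0..<2*pi} a \<partial>lborel) < \<infinity>"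
      using G by (subst nn_integral_cmult_indicator) (auto simp: ennreal_mult_less_top)
    show "(\<lambda>a. \<integral>\<^sup>+b. \<integral>\<^sup>+x. \<integral>\<^sup>+y. ennreal (F (N n) (e n) a b x y) \<partial>lborel \<partial>lborel \<partial>lborel) \<in> borel_measurable lborel" for n unfolding ms by measurable
    show "(\<lambda>a. \<integral>\<^sup>+b. \<integral>\<^sup>+x. \<integral>\<^sup>+y. ennreal (Flim a b x y) \<partial>lborel \<partial>lborel \<partial>lborel) \<in> borel_measurable lborel" unfolding ms by measurable
  qed (use 3 b3 in \<open>auto intro: AE_I2\<close>)
qed

end

section \<open>Evaluation of the limit\<close>

text \<open>The substitution \<open>t = c * s powr (3 / 2)\<close> in the Gamma integral.\<close>

lemma nn_integral_gamma_3_2: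
  assumes c: "0 < (c::real)"
  shows "(\<integral>\<^sup>+s. ennreal (s * sqrt s * exp (- c * (s * sqrt s))) * indicator {0<..} s \<partial>lborel)
    = ennreal (2 / 3 * c powr (- 5 / 3) * Gamma (5 / 3))"
proof -
  define g h f where "g s = c * s powr (3 / 2)" and "h s = c * (3 / 2 * s powr (1 / 2))"
    and "f t = t powr (2 / 3) / exp t" for s t :: real
  have "((\<lambda>t::real. t powr (5 / 3 - 1) / exp t) has_integral Gamma (5 / 3)) {0..}"
    by (rule Gamma_integral_real) simp
  then have "(f has_integral Gamma (5 / 3)) {0..}" by (simp add: f_def[abs_def])
  moreover have "(f has_integral Gamma (5 / 3)) {0..} \<longleftrightarrow> (f has_integral Gamma (5 / 3)) {0<..}"
    by (rule has_integral_spike_set_eq) (auto intro: negligible_subset[OF negligible_sing[of 0]])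
  ultimately have fi: "(f has_integral Gamma (5 / 3)) {0<..}" by simp
  have "f absolutely_integrable_on {0<..}"
    using fi by (intro nonnegative_absolutely_integrable_1) (auto simp: integrable_on_def f_def)
  moreover have img: "g ` {0<..} = {0<..}"
  proof (intro equalityI subsetI)
    fix t :: real assume t: "t \<in> {0<..}"
    have "g ((t / c) powr (2 / 3)) = t" using t c by (simp add: g_def powr_powr)
    moreover have "(t / c) powr (2 / 3) \<in> {0<..}" using t c by simp
    ultimately show "t \<in> g ` {0<..}" by (metis imageI)
  qed (use c in \<open>auto simp: g_def\<close>)
  moreover have "integral {0<..} f = Gamma (5 / 3)" using fi by (rule integral_unique)
  ultimately have "f absolutely_integrable_on g ` {0<..} \<and> integral (g ` {0<..}) f = Gamma (5 / 3)" by simp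
  moreover have "(g has_field_derivative h s) (at s within {0<..})" if "s \<in> {0<..}" for s
    unfolding g_def h_def using that by (auto intro!: derivative_eq_intros)
  moreover have "inj_on g {0<..}"
  proof (rule inj_onI)
    fix x y assume xy: "x \<in> {0<..}" "y \<in> {0<..}" "g x = g y"
    then have "(x powr (3 / 2)) powr (2 / 3) = (y powr (3 / 2)) powr (2 / 3)" using c by (simp add: g_def)
    then show "x = y" using xy by (simp add: powr_powr)
  qed
  ultimately have "(\<lambda>s. \<bar>h s\<bar> *\<^sub>R f (g s)) absolutely_integrable_on {0<..} \<and> integral {0<..} (\<lambda>s. \<bar>h s\<bar> *\<^sub>R f (g s)) = Gamma (5 / 3)"
    by (subst has_absolute_integral_change_of_variables_real) auto
  then have hi: "((\<lambda>s. \<bar>h s\<bar> * f (g s)) has_integral Gamma (5 / 3)) {0<..}"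
    by (auto simp: has_integral_iff absolutely_integrable_on_def)
  have eq: "2 / 3 * c powr (- 5 / 3) * (\<bar>h s\<bar> * f (g s)) = s * sqrt s * exp (- c * (s * sqrt s))" if s: "s \<in> {0<..}" for s
  proof -
    have s0: "0 < s" using s by simp
    have ss: "s * sqrt s = s powr (3 / 2)"
    proof -
      have "s powr (1 + 1 / 2) = s powr 1 * s powr (1 / 2)" by (rule powr_add)
      then show ?thesis using s0 by (simp add: powr_half_sqrt)
    qed
    have "f (g s) = c powr (2 / 3) * s / exp (c * s powr (3 / 2))"
    proof -
      have "(c * s powr (3 / 2)) powr (2 / 3) = c powr (2 / 3) * (s powr (3 / 2)) powr (2 / 3)"
        by (rule powr_mult)
      also have "(s powr (3 / 2)) powr (2 / 3) = s" using s0 by (simp add: powr_powr)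
      finally show ?thesis by (simp add: f_def g_def)
    qed
    note fg = this
    have "2 / 3 * c powr (- 5 / 3) * (\<bar>h s\<bar> * f (g s))
      = (c powr (- 5 / 3) * c powr (2 / 3) * c) * (s * s powr (1 / 2)) * exp (- (c * s powr (3 / 2)))"
    proof -
      have "\<bar>h s\<bar> = c * (3 / 2 * s powr (1 / 2))" using c by (simp add: h_def)
      note hs = this
      show ?thesis unfolding fg exp_minus inverse_eq_divide hs by simp
    qed
    also have "c powr (- 5 / 3) * c powr (2 / 3) * c = 1"
    proof -
      have "c powr (- 5 / 3) * c powr (2 / 3) * c = c powr (- 5 / 3) * c powr (2 / 3) * c powr 1" using c by simp
      also have "\<dots> = c powr (- 5 / 3 + 2 / 3 + 1)" by (simp only: powr_add)
      finally show ?thesis using c by simp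
    qed
    also have "s * s powr (1 / 2) = s * sqrt s" using s0 by (simp add: powr_half_sqrt)
    finally show ?thesis by (simp add: ss)
  qed
  have "((\<lambda>s. 2 / 3 * c powr (- 5 / 3) * (\<bar>h s\<bar> * f (g s))) has_integral 2 / 3 * c powr (- 5 / 3) * Gamma (5 / 3)) {0<..}"
    by (rule has_integral_mult_right[OF hi])
  then have "((\<lambda>s. s * sqrt s * exp (- c * (s * sqrt s))) has_integral 2 / 3 * c powr (- 5 / 3) * Gamma (5 / 3)) {0<..}"
    using eq by (rule has_integral_eq[rotated])
  then show ?thesis by (intro nn_integral_has_integral_lebesgue') auto
qed

text \<open>\<open>\<rho>\<^sup>2 * b\<close> is the limiting Jacobian, and
  \<open>2 * w - \<rho> * b\<close> is, up to a constant factor, the length of the interval left for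
  the offset by an arc of length \<open>b\<close>. Truncation by \<open>ennreal\<close> ends the
  integral at \<open>2 * w / \<rho>\<close>.\<close>

lemma nn_integral_cubic:
  assumes \<rho>: "0 < \<rho>" and w: "0 \<le> w"
  shows "(\<integral>\<^sup>+b. ennreal (\<rho>\<^sup>2 * b) * (indicator {0<..} b * ennreal (2 * w - \<rho> * b)) \<partial>lborel) = ennreal (4 / 3 * w ^ 3)"
proof -
  define L where "L = 2 * w / \<rho>"
  have L: "0 \<le> L" "\<rho> * L = 2 * w" using \<rho> w by (simp_all add: L_def)
  have "(\<integral>\<^sup>+b. ennreal (\<rho>\<^sup>2 * b) * (indicator {0<..} b * ennreal (2 * w - \<rho> * b)) \<partial>lborel)
    = (\<integral>\<^sup>+b. ennreal (\<rho>\<^sup>2 * b * (2 * w - \<rho> * b)) * indicator {0..L} b \<partial>lborel)"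
  proof (rule nn_integral_cong)
    fix b :: real
    consider "b \<le> 0" | "0 < b" "b \<le> L" | "0 < b" "L < b" by linarith
    then show "ennreal (\<rho>\<^sup>2 * b) * (indicator {0<..} b * ennreal (2 * w - \<rho> * b)) = ennreal (\<rho>\<^sup>2 * b * (2 * w - \<rho> * b)) * indicator {0..L} b"
    proof cases
      case 1 then show ?thesis by (cases "b = 0") auto
    next
      case 2
      then have "\<rho> * b \<le> \<rho> * L" using \<rho> by simp
      then show ?thesis using 2 \<rho> L by (simp add: ennreal_mult)
    next
      case 3
      then have "\<rho> * L < \<rho> * b" using \<rho> by simp
      then show ?thesis using 3 L by (simp add: ennreal_neg)
    qed
  qed
  also have "\<dots> = ennreal ((\<rho>\<^sup>2 * w * L\<^sup>2 - \<rho> ^ 3 / 3 * L ^ 3) - (\<rho>\<^sup>2 * w * 0\<^sup>2 - \<rho> ^ 3 / 3 * 0 ^ 3))"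
  proof (rule nn_integral_FTC_Icc[where F = "\<lambda>b. \<rho>\<^sup>2 * w * b\<^sup>2 - \<rho> ^ 3 / 3 * b ^ 3"])
    show "((\<lambda>b. \<rho>\<^sup>2 * w * b\<^sup>2 - \<rho> ^ 3 / 3 * b ^ 3) has_real_derivative \<rho>\<^sup>2 * b * (2 * w - \<rho> * b)) (at b)" for b
      by (auto intro!: derivative_eq_intros simp: power2_eq_square power3_eq_cube algebra_simps)
    show "0 \<le> \<rho>\<^sup>2 * b * (2 * w - \<rho> * b)" if "b \<in> {0..L}" for b
    proof -
      have "\<rho> * b \<le> \<rho> * L" using \<rho> that by simp
      then show ?thesis using that L by simp
    qed
  qed (use L in auto)
  also have "(\<rho>\<^sup>2 * w * L\<^sup>2 - \<rho> ^ 3 / 3 * L ^ 3) - (\<rho>\<^sup>2 * w * 0\<^sup>2 - \<rho> ^ 3 / 3 * 0 ^ 3) = w * (\<rho> * L)\<^sup>2 - (\<rho> * L) ^ 3 / 3"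
    by (simp add: power_mult_distrib)
  also have "\<dots> = 4 / 3 * w ^ 3" unfolding L(2) by (simp add: power2_eq_square power3_eq_cube)
  finally show ?thesis .
qed

context oval_pair begin

section \<open>The limit integral in closed form\<close>

text \<open>The limiting probability that no further point falls into the cut-off region; it depends
  on the offset and the depth only through their \<open>sag\<close>.\<close>

definition decay :: "real \<Rightarrow> real \<Rightarrow> real" where
  "decay a s = exp (- (4 / 3 * s * sqrt (2 * s / kap a) / measure lborel K))"

text \<open>With \<open>s\<close>, the value of \<open>sag\<close>, in place of the depth, the
  exponential no longer involves \<open>x\<close>. Rescaling \<open>x\<close> to \<open>z\<close>
  turns the conditions on the two ends of the arc into bounds on \<open>z\<close> and
  \<open>z + r a * b\<close>; for positive \<open>b\<close> they describe one interval.\<close>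

lemma Flim_shift:
  assumes a: "a \<in> {0..<2*pi}"
  shows "Flim a b x (s - x\<^sup>2 / (2 * (r a - q a))) = indicator {0<..} b * ((r a)\<^sup>2 * b *
    (indicator {x'. - sqrt (2 * s / kap a) * ((r a - q a) / r a) < x' \<and> x' < (sqrt (2 * s / kap a) - r a * b) * ((r a - q a) / r a)} x * decay a s))"
proof -
  define d where "d = r a - q a"
  define w where "w = sqrt (2 * s / kap a)"
  define z where "z = x * (r a / d)"
  have pos: "0 < d" "0 < r a" "0 < q a" "r a = d + q a" using q_less_r[of a] r_pos[of a] Ko.r_pos[of a] by (auto simp: d_def)
  define y where "y = s - x\<^sup>2 / (2 * d)"
  have sag: "sag a x y = s" by (simp add: sag_def y_def d_def)
  have cz: "x - (- x * q a / (r a - q a)) = z"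
  proof -
    have "x - (- x * q a / d) = x * ((d + q a) / d)" using pos(1) by (simp add: field_simps)
    then show ?thesis unfolding z_def pos(4)[symmetric] d_def[symmetric] .
  qed
  \<comment> \<open>\<open>sqrt\<close> is odd and strictly increasing on all reals, so the
    equivalence also covers negative \<open>s\<close>, where \<open>w\<close> is negative.\<close>
  have lt: "kap a / 2 * t\<^sup>2 < s \<longleftrightarrow> \<bar>t\<bar> < w" for t
  proof -
    have "kap a / 2 * t\<^sup>2 < s \<longleftrightarrow> t\<^sup>2 < 2 * s / kap a" using kap_pos[of a] by (simp add: pos_less_divide_eq algebra_simps)
    also have "\<dots> \<longleftrightarrow> sqrt (t\<^sup>2) < w" unfolding w_def by (simp only: real_sqrt_less_iff)
    finally show ?thesis by simp
  qed
  have c1: "x\<^sup>2 / (2 * q a) < y \<longleftrightarrow> \<bar>z\<bar> < w"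
    using sag_eq[of y x x a] lt[of z] unfolding sag cz by auto
  have e2: "x + r a * b - (- x * q a / (r a - q a)) = z + r a * b" using cz by linarith
  have "(x + r a * b - x)\<^sup>2 / (2 * r a) = r a * b\<^sup>2 / 2" using pos(2) by (simp add: power_mult_distrib power2_eq_square)
  then have c2: "(x + r a * b)\<^sup>2 / (2 * q a) < y + r a * b\<^sup>2 / 2 \<longleftrightarrow> \<bar>z + r a * b\<bar> < w"
    using sag_eq[of y "x + r a * b" x a] lt[of "z + r a * b"] unfolding sag e2 by auto
  have x1: "- w * (d / r a) < x \<longleftrightarrow> - w < z" for w
    unfolding z_def using pos by (simp add: field_simps)
  have x2: "x < t * (d / r a) \<longleftrightarrow> z < t" for t
    unfolding z_def using pos by (simp add: field_simps)
  show ?thesis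
  proof (cases "0 < b")
    case True
    then have "0 < r a * b" using pos by simp
    then have "\<bar>z\<bar> < w \<and> \<bar>z + r a * b\<bar> < w \<longleftrightarrow> - w < z \<and> z < w - r a * b" by auto
    then show ?thesis
      using True a c1 c2 x1[of w] x2[of "w - r a * b"] pos(2) unfolding y_def[symmetric] d_def[symmetric] w_def[symmetric]
      by (auto simp: Flim_def sag decay_def w_def[symmetric] indicator_def)
  next
    case False
    then show ?thesis by (simp add: Flim_def)
  qed
qed

text \<open>The integrand of the final formula with its constants; \<open>q a\<close> is the
  reciprocal of the curvature of \<open>K\<close>.\<close>

definition rate :: "real \<Rightarrow> real" where
  "rate a = root 3 (2 / (3 * measure lborel K)) * Gamma (5 / 3) * (kap a powr (1 / 3) * q a)"

text \<open>After splitting off the common Gamma factor, both sides are nonnegative, so their cubes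
  are compared; there all fractional exponents disappear.\<close>

lemma rate_constant:
  "kap a * q a * (4 / 3) * sqrt (2 / kap a) ^ 3 * (2 / 3 * (4 / 3 * sqrt (2 / kap a) / measure lborel K) powr (- 5 / 3) * Gamma (5 / 3))
    = (measure lborel K)\<^sup>2 * rate a"
proof -
  define A where "A = measure lborel K"
  define \<beta> where "\<beta> = sqrt (2 / kap a)"
  have A: "0 < A" using K_pos by (simp add: A_def)
  have k: "0 < kap a" by (rule kap_pos)
  have q: "0 < q a" by (rule Ko.r_pos)
  have \<beta>: "0 < \<beta>" "\<beta>\<^sup>2 = 2 / kap a" using k by (simp_all add: \<beta>_def)
  define c where "c = 4 / 3 * \<beta> / A"
  have c: "0 < c" using \<beta> A by (simp add: c_def)
  let ?l = "kap a * q a * (8 / 9) * \<beta> ^ 3 * c powr (- 5 / 3)"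
  let ?r = "A\<^sup>2 * (root 3 (2 / (3 * A)) * (kap a powr (1 / 3) * q a))"
  have p1: "(c powr (- 5 / 3)) ^ 3 = 1 / c ^ 5"
  proof -
    have "(c powr (- 5 / 3)) ^ 3 = c powr (- 5)" using c by (simp add: powr_power)
    also have "\<dots> = 1 / c ^ 5" using c by (simp add: powr_minus powr_numeral inverse_eq_divide)
    finally show ?thesis .
  qed
  have p2: "(kap a powr (1 / 3)) ^ 3 = kap a" using k by (simp add: powr_power)
  have p3: "root 3 (2 / (3 * A)) ^ 3 = 2 / (3 * A)" using A by (intro real_root_pow_pos2) auto
  have "?l ^ 3 = kap a ^ 3 * q a ^ 3 * (512 / 729) * \<beta> ^ 9 * (1 / c ^ 5)"
    unfolding power_mult_distrib p1 by (simp add: power_divide flip: power_mult)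
  also have "\<dots> = kap a ^ 3 * q a ^ 3 * (1 / 6) * A ^ 5 * (\<beta>\<^sup>2)\<^sup>2"
    unfolding c_def using \<beta>(1) A by (simp add: power_divide power_mult_distrib field_simps flip: power_mult)
  also have "\<dots> = 2 / 3 * kap a * q a ^ 3 * A ^ 5"
    unfolding \<beta>(2) using k by (simp add: power_divide field_simps) (simp add: numeral_eq_Suc)
  also have "\<dots> = ?r ^ 3"
    unfolding power_mult_distrib p2 p3 using A by (simp add: field_simps flip: power_mult) (simp add: numeral_eq_Suc)
  finally have "?l ^ 3 = ?r ^ 3" .
  moreover have "0 \<le> ?l" using k q \<beta> by simp
  moreover have "0 \<le> ?r" using q A by simp
  ultimately have lr: "?l = ?r" by (rule power_eq_imp_eq_base) simp
  have "kap a * q a * (4 / 3) * \<beta> ^ 3 * (2 / 3 * c powr (- 5 / 3) * Gamma (5 / 3)) = ?l * Gamma (5 / 3)" by simp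
  also have "\<dots> = A\<^sup>2 * (root 3 (2 / (3 * A)) * Gamma (5 / 3) * (kap a powr (1 / 3) * q a))"
    unfolding lr by (simp only: mult_ac)
  finally show ?thesis unfolding rate_def A_def[symmetric] \<beta>_def[symmetric] c_def[symmetric] .
qed

text \<open>The shift of the depth decouples the variables: \<open>x\<close> contributes the length
  of an interval, \<open>b\<close> the cubic integral, and \<open>s\<close> the Gamma
  integral.\<close>

lemma Flim_integral:
  "(\<integral>\<^sup>+b. \<integral>\<^sup>+x. \<integral>\<^sup>+y. ennreal (Flim a b x y) \<partial>lborel \<partial>lborel \<partial>lborel)
    = indicator {0..<2*pi} a * ennreal ((measure lborel K)\<^sup>2 * rate a)"
proof (cases "a \<in> {0..<2*pi}")
  case False
  then show ?thesis by (simp add: Flim_def)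
next
  case a: True
  define A where "A = measure lborel K"
  have A: "0 < A" using K_pos by (simp add: A_def)
  define d where "d = (r a - q a) / r a"
  have ra: "0 < r a" by (rule r_pos)
  have d: "0 < d" using ra q_less_r[of a] by (simp add: d_def)
  define w where "w s = sqrt (2 * s / kap a)" for s
  define G where "G b s = {x'. - w s * d < x' \<and> x' < (w s - r a * b) * d}" for b s
  have k: "0 < kap a" by (rule kap_pos)
  have dec [measurable]: "decay a \<in> borel_measurable borel" unfolding decay_def[abs_def] by measurable
  have Gm [measurable]: "(\<lambda>z. indicator (G (u z) (v z)) (t z) :: ennreal) \<in> borel_measurable S"
    if [measurable]: "u \<in> borel_measurable S" "v \<in> borel_measurable S" "t \<in> borel_measurable S" for u v t and S :: "'z measure"
  proof -
    have [measurable]: "Measurable.pred S (\<lambda>z. t z \<in> G (u z) (v z))" unfolding G_def w_def by measurable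
    show ?thesis unfolding indicator_def by measurable
  qed
  have "(\<integral>\<^sup>+b. \<integral>\<^sup>+x. \<integral>\<^sup>+y. ennreal (Flim a b x y) \<partial>lborel \<partial>lborel \<partial>lborel)
    = (\<integral>\<^sup>+b. \<integral>\<^sup>+x. \<integral>\<^sup>+s. indicator {0<..} b * ennreal ((r a)\<^sup>2 * b) * (indicator (G b s) x * ennreal (decay a s)) \<partial>lborel \<partial>lborel \<partial>lborel)"
  proof (rule nn_integral_cong, rule nn_integral_cong)
    fix b x
    have "(\<lambda>y. ennreal (Flim a b x y)) \<in> borel_measurable borel" unfolding Flim_def sag_def kap_def by measurable
    from nn_integral_real_affine[OF this, of 1 "- (x\<^sup>2 / (2 * (r a - q a)))"]
    have "(\<integral>\<^sup>+y. ennreal (Flim a b x y) \<partial>lborel) = (\<integral>\<^sup>+s. ennreal (Flim a b x (s - x\<^sup>2 / (2 * (r a - q a)))) \<partial>lborel)"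
      by simp
    also have "\<dots> = (\<integral>\<^sup>+s. indicator {0<..} b * ennreal ((r a)\<^sup>2 * b) * (indicator (G b s) x * ennreal (decay a s)) \<partial>lborel)"
    proof (rule nn_integral_cong)
      fix s
      show "ennreal (Flim a b x (s - x\<^sup>2 / (2 * (r a - q a)))) = indicator {0<..} b * ennreal ((r a)\<^sup>2 * b) * (indicator (G b s) x * ennreal (decay a s))"
        unfolding Flim_shift[OF a] d_def[symmetric] w_def[symmetric] G_def
        by (auto simp: indicator_def ennreal_mult decay_def)
    qed
    finally show "(\<integral>\<^sup>+y. ennreal (Flim a b x y) \<partial>lborel) = \<dots>" .
  qed
  also have "\<dots> = (\<integral>\<^sup>+b. \<integral>\<^sup>+s. \<integral>\<^sup>+x. indicator {0<..} b * ennreal ((r a)\<^sup>2 * b) * (indicator (G b s) x * ennreal (decay a s)) \<partial>lborel \<partial>lborel \<partial>lborel)"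
    by (intro nn_integral_cong lborel_pair.Fubini') measurable
  also have "\<dots> = (\<integral>\<^sup>+s. \<integral>\<^sup>+b. \<integral>\<^sup>+x. indicator {0<..} b * ennreal ((r a)\<^sup>2 * b) * (indicator (G b s) x * ennreal (decay a s)) \<partial>lborel \<partial>lborel \<partial>lborel)"
    by (intro lborel_pair.Fubini') measurable
  also have "\<dots> = (\<integral>\<^sup>+s. ennreal (d * (4 / 3) * sqrt (2 / kap a) ^ 3) * (ennreal (s * sqrt s * exp (- (4 / 3 * sqrt (2 / kap a) / A) * (s * sqrt s))) * indicator {0<..} s) \<partial>lborel)"
  proof (rule nn_integral_cong)
    fix s :: real
    have Gx: "(\<integral>\<^sup>+x. indicator (G b s) x \<partial>lborel) = ennreal d * ennreal (2 * w s - r a * b)" for b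
    proof -
      have "(\<integral>\<^sup>+x. indicator (G b s) x \<partial>lborel) = emeasure lborel (G b s)"
        unfolding G_def by (rule nn_integral_indicator) measurable
      also have "\<dots> = ennreal ((w s - r a * b) * d - - w s * d)" unfolding G_def by (rule emeasure_open_interval)
      also have "(w s - r a * b) * d - - w s * d = d * (2 * w s - r a * b)" by (simp add: algebra_simps)
      also have "ennreal \<dots> = ennreal d * ennreal (2 * w s - r a * b)" using d by (intro ennreal_mult') simp
      finally show ?thesis .
    qed
    have "(\<integral>\<^sup>+b. \<integral>\<^sup>+x. indicator {0<..} b * ennreal ((r a)\<^sup>2 * b) * (indicator (G b s) x * ennreal (decay a s)) \<partial>lborel \<partial>lborel)
      = (\<integral>\<^sup>+b. (ennreal d * ennreal (decay a s)) * (ennreal ((r a)\<^sup>2 * b) * (indicator {0<..} b * ennreal (2 * w s - r a * b))) \<partial>lborel)"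
    proof (rule nn_integral_cong)
      fix b :: real
      have [measurable]: "(\<lambda>x. indicator (G b s) x :: ennreal) \<in> borel_measurable lborel" by measurable
      have "(\<integral>\<^sup>+x. indicator {0<..} b * ennreal ((r a)\<^sup>2 * b) * (indicator (G b s) x * ennreal (decay a s)) \<partial>lborel)
        = indicator {0<..} b * ennreal ((r a)\<^sup>2 * b) * ((\<integral>\<^sup>+x. indicator (G b s) x \<partial>lborel) * ennreal (decay a s))"
        by (subst nn_integral_cmult, measurable) (subst nn_integral_multc, measurable)
      then show "(\<integral>\<^sup>+x. indicator {0<..} b * ennreal ((r a)\<^sup>2 * b) * (indicator (G b s) x * ennreal (decay a s)) \<partial>lborel)
        = (ennreal d * ennreal (decay a s)) * (ennreal ((r a)\<^sup>2 * b) * (indicator {0<..} b * ennreal (2 * w s - r a * b)))"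
        unfolding Gx by (simp only: mult_ac)
    qed
    also have "\<dots> = (ennreal d * ennreal (decay a s)) * (\<integral>\<^sup>+b. ennreal ((r a)\<^sup>2 * b) * (indicator {0<..} b * ennreal (2 * w s - r a * b)) \<partial>lborel)"
      by (rule nn_integral_cmult) measurable
    also have "\<dots> = ennreal (d * (4 / 3) * sqrt (2 / kap a) ^ 3) * (ennreal (s * sqrt s * exp (- (4 / 3 * sqrt (2 / kap a) / A) * (s * sqrt s))) * indicator {0<..} s)"
    proof (cases "0 < s")
      case True
      then have w0: "0 \<le> w s" using k by (simp add: w_def)
      have ws: "w s = sqrt (2 / kap a) * sqrt s" by (simp add: w_def real_sqrt_mult real_sqrt_divide)
      have w3: "w s ^ 3 = sqrt (2 / kap a) ^ 3 * (s * sqrt s)"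
      proof -
        have "sqrt s ^ 3 = s * sqrt s" using True by (simp add: power3_eq_cube)
        then show ?thesis by (simp only: ws power_mult_distrib)
      qed
      have dc: "decay a s = exp (- (4 / 3 * sqrt (2 / kap a) / A) * (s * sqrt s))"
        unfolding decay_def w_def[symmetric] ws A_def[symmetric] by simp
      show ?thesis unfolding nn_integral_cubic[OF ra w0] w3 dc
        using True d k by (simp add: ennreal_mult[symmetric] mult_ac)
    next
      \<comment> \<open>For \<open>s \<le> 0\<close> the interval of admissible offsets is empty for
        every positive arc.\<close>
      case False
      then have "w s \<le> 0" using k by (simp add: w_def divide_nonpos_pos)
      then have "2 * w s - r a * b \<le> 0" if "0 < b" for b using that ra by (smt (verit) mult_pos_pos)
      then have z: "ennreal ((r a)\<^sup>2 * b) * (indicator {0<..} b * ennreal (2 * w s - r a * b)) = 0" for b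
        by (cases "0 < b") (simp_all add: ennreal_neg)
      show ?thesis unfolding z using False by simp
    qed
    finally show "(\<integral>\<^sup>+b. \<integral>\<^sup>+x. indicator {0<..} b * ennreal ((r a)\<^sup>2 * b) * (indicator (G b s) x * ennreal (decay a s)) \<partial>lborel \<partial>lborel)
      = ennreal (d * (4 / 3) * sqrt (2 / kap a) ^ 3) * (ennreal (s * sqrt s * exp (- (4 / 3 * sqrt (2 / kap a) / A) * (s * sqrt s))) * indicator {0<..} s)" .
  qed
  also have "\<dots> = ennreal (d * (4 / 3) * sqrt (2 / kap a) ^ 3) * (\<integral>\<^sup>+s. ennreal (s * sqrt s * exp (- (4 / 3 * sqrt (2 / kap a) / A) * (s * sqrt s))) * indicator {0<..} s \<partial>lborel)"
    by (rule nn_integral_cmult) measurable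
  also have "(\<integral>\<^sup>+s. ennreal (s * sqrt s * exp (- (4 / 3 * sqrt (2 / kap a) / A) * (s * sqrt s))) * indicator {0<..} s \<partial>lborel)
    = ennreal (2 / 3 * (4 / 3 * sqrt (2 / kap a) / A) powr (- 5 / 3) * Gamma (5 / 3))"
    using k A by (intro nn_integral_gamma_3_2) simp
  also have "ennreal (d * (4 / 3) * sqrt (2 / kap a) ^ 3) * \<dots>
    = ennreal (d * (4 / 3) * sqrt (2 / kap a) ^ 3 * (2 / 3 * (4 / 3 * sqrt (2 / kap a) / A) powr (- 5 / 3) * Gamma (5 / 3)))"
    using d k by (intro ennreal_mult'[symmetric]) simp
  also have "d = kap a * q a"
    using ra Ko.r_pos[of a] by (simp add: d_def kap_def field_simps)
  finally show ?thesis using a unfolding A_def rate_constant by simp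
qed

lemma continuous_rate: "continuous_on S rate"
proof -
  have q: "continuous_on S q" and r: "continuous_on S r"
    using Ko.cont_r cont_r continuous_on_subset by blast+
  have "q x \<noteq> r x" "q x \<noteq> 0" "r x \<noteq> 0" for x using q_less_r[of x] Ko.r_pos[of x] r_pos[of x] by simp_all
  then show ?thesis unfolding rate_def[abs_def] kap_def
    by (intro continuous_intros q r) auto
qed

lemma rate_nonneg: "0 \<le> rate a"
  unfolding rate_def using Ko.r_pos[of a] K_pos by simp

text \<open>The half-open period and the closed interval differ in a null set. The squared area will
  cancel against the densities in \<open>T_chart\<close>.\<close>

lemma Flim_total:
  "(\<integral>\<^sup>+a. \<integral>\<^sup>+b. \<integral>\<^sup>+x. \<integral>\<^sup>+y. ennreal (Flim a b x y) \<partial>lborel \<partial>lborel \<partial>lborel \<partial>lborel)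
    = ennreal ((measure lborel K)\<^sup>2 * (LBINT a:{0..2*pi}. rate a))"
proof -
  have int: "set_integrable lborel {0..2*pi} rate"
    by (rule borel_integrable_atLeastAtMost') (rule continuous_rate)
  have m: "rate \<in> borel_measurable borel" by (rule borel_measurable_continuous_onI) (rule continuous_rate)
  have "AE a in lborel. a \<noteq> 2 * pi" by (rule AE_lborel_singleton)
  then have ae: "AE a in lborel. indicator {0..<2*pi} a * ennreal ((measure lborel K)\<^sup>2 * rate a)
    = ennreal ((measure lborel K)\<^sup>2) * ennreal (indicator {0..2*pi} a *\<^sub>R rate a)"
    by eventually_elim (auto simp: indicator_def ennreal_mult rate_nonneg)
  have "(\<integral>\<^sup>+a. \<integral>\<^sup>+b. \<integral>\<^sup>+x. \<integral>\<^sup>+y. ennreal (Flim a b x y) \<partial>lborel \<partial>lborel \<partial>lborel \<partial>lborel)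
    = (\<integral>\<^sup>+a. ennreal ((measure lborel K)\<^sup>2) * ennreal (indicator {0..2*pi} a *\<^sub>R rate a) \<partial>lborel)"
    unfolding Flim_integral using ae by (rule nn_integral_cong_AE)
  also have "\<dots> = ennreal ((measure lborel K)\<^sup>2) * (\<integral>\<^sup>+a. ennreal (indicator {0..2*pi} a *\<^sub>R rate a) \<partial>lborel)"
    by (rule nn_integral_cmult) (use m in measurable)
  also have "(\<integral>\<^sup>+a. ennreal (indicator {0..2*pi} a *\<^sub>R rate a) \<partial>lborel) = ennreal (LBINT a:{0..2*pi}. rate a)"
    unfolding set_lebesgue_integral_def
    by (rule nn_integral_eq_integral) (use int rate_nonneg in \<open>auto simp: set_integrable_def\<close>)
  also have "ennreal ((measure lborel K)\<^sup>2) * ennreal (LBINT a:{0..2*pi}. rate a) = ennreal ((measure lborel K)\<^sup>2 * (LBINT a:{0..2*pi}. rate a))"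
    by (rule ennreal_mult'[symmetric]) simp
  finally show ?thesis .
qed

theorem expectation_limit:
  fixes X :: "nat \<Rightarrow> nat \<Rightarrow> 'w \<Rightarrow> real^2"
  assumes S: "\<And>n. prob_space (S n)"
    and indep: "\<And>n. prob_space.indep_vars (S n) (\<lambda>_. borel) (X n) {1..n}"
    and distr: "\<And>n i. i \<in> {1..n} \<Longrightarrow> distr (S n) borel (X n i) = uniform_measure lborel K"
  shows "(\<lambda>n. (\<integral>\<omega>. real (f0 M ((\<lambda>i. X n i \<omega>) ` {1..n})) \<partial>S n) * real n powr (-1/3)) \<longlonglongrightarrow> (LBINT a:{0..2*pi}. rate a)"
proof -
  define A where "A = measure lborel K"
  have A: "0 < A" using K_pos by (simp add: A_def)
  define E where "E n = (\<integral>\<omega>. real (f0 M ((\<lambda>i. X n i \<omega>) ` {1..n})) \<partial>S n)" for n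
  \<comment> \<open>The shift by 4 leaves \<open>n + 2\<close> further points besides the two ends
    of the arc and makes \<open>(n + 2) / (n + 4)\<close> at least 1/2 for every \<open>n\<close>,
    as the domination requires.\<close>
  define e where "e n = real (n + 4) powr (-1/3)" for n
  define I where "I n = (\<integral>\<^sup>+a. \<integral>\<^sup>+b. \<integral>\<^sup>+x. \<integral>\<^sup>+y. ennreal (F (n + 2) (e n) a b x y) \<partial>lborel \<partial>lborel \<partial>lborel \<partial>lborel)" for n
  have e0: "0 < e n" for n by (simp add: e_def)
  have e1: "e n \<le> 1" for n
  proof -
    have "real (n + 4) powr (-1/3) \<le> real (n + 4) powr 0" by (intro powr_mono) auto
    then show ?thesis by (simp add: e_def)
  qed
  have e3: "e n ^ 3 = 1 / real (n + 4)" for n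
    unfolding e_def by (subst powr_power) (simp_all add: powr_minus inverse_eq_divide)
  have el: "e \<longlonglongrightarrow> 0" unfolding e_def by real_asymp
  have Nl: "(\<lambda>n. real (n + 2) * e n ^ 3) \<longlonglongrightarrow> 1" unfolding e3 by real_asymp
  have half: "1 / 2 \<le> real (n + 2) * e n ^ 3" for n unfolding e3 by (simp add: field_simps)
  have Il: "I \<longlonglongrightarrow> ennreal (A\<^sup>2 * (LBINT a:{0..2*pi}. rate a))"
    unfolding I_def[abs_def] A_def Flim_total[symmetric] by (rule T_limit[OF e0 e1 el Nl half])
  have Enn: "0 \<le> E n" for n unfolding E_def by simp
  have "ennreal (E (n + 4) * e n) = ennreal (real (n + 3) / real (n + 4) / A\<^sup>2) * I n" for n
  proof -
    have "ennreal (E (n + 4)) = of_nat ((n + 4) * (n + 4 - 1)) * T (n + 4 - 2)"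
      unfolding E_def by (rule expectation_f0[OF S _ indep distr]) auto
    also have "\<dots> = of_nat ((n + 4) * (n + 3)) * (ennreal (e n ^ 5 / A\<^sup>2) * I n)"
    proof -
      have "n + 4 - 1 = n + 3" "n + 4 - 2 = n + 2" by simp_all
      then show ?thesis unfolding A_def I_def T_chart[OF e0[of n], symmetric] by (simp only:)
    qed
    finally have "ennreal (E (n + 4) * e n) = of_nat ((n + 4) * (n + 3)) * (ennreal (e n ^ 5 / A\<^sup>2) * I n) * ennreal (e n)"
      using e0[of n] Enn by (simp add: ennreal_mult)
    also have "\<dots> = (ennreal (real ((n + 4) * (n + 3))) * ennreal (e n ^ 5 / A\<^sup>2) * ennreal (e n)) * I n"
      unfolding ennreal_of_nat_eq_real_of_nat by (simp only: mult_ac)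
    also have "ennreal (real ((n + 4) * (n + 3))) * ennreal (e n ^ 5 / A\<^sup>2) * ennreal (e n) = ennreal (real ((n + 4) * (n + 3)) * (e n ^ 5 / A\<^sup>2) * e n)"
      using e0[of n] A by (simp only: ennreal_mult'[symmetric] ennreal_mult''[symmetric] of_nat_0_le_iff less_imp_le)
    also have "real ((n + 4) * (n + 3)) * (e n ^ 5 / A\<^sup>2) * e n = real (n + 4) * real (n + 3) * (e n ^ 3) ^ 2 / A\<^sup>2"
    proof -
      have "e n ^ 5 * e n = (e n ^ 3) ^ 2" by (simp add: numeral_eq_Suc)
      then have "real ((n + 4) * (n + 3)) * (e n ^ 5 * e n) / A\<^sup>2 = real (n + 4) * real (n + 3) * (e n ^ 3) ^ 2 / A\<^sup>2"
        by (simp only: of_nat_mult)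
      then show ?thesis by simp
    qed
    also have "\<dots> = real (n + 3) / real (n + 4) / A\<^sup>2"
      unfolding e3 by (simp add: power2_eq_square)
    finally show ?thesis .
  qed
  moreover have "(\<lambda>n. ennreal (real (n + 3) / real (n + 4) / A\<^sup>2) * I n) \<longlonglongrightarrow> ennreal (1 / A\<^sup>2) * ennreal (A\<^sup>2 * (LBINT a:{0..2*pi}. rate a))"
  proof (intro tendsto_mult_ennreal Il tendsto_ennrealI)
    have "(\<lambda>n. real (n + 3) / real (n + 4)) \<longlonglongrightarrow> 1" by real_asymp
    then show "(\<lambda>n. real (n + 3) / real (n + 4) / A\<^sup>2) \<longlonglongrightarrow> 1 / A\<^sup>2" using A by (intro tendsto_intros) auto
  qed auto
  moreover have "ennreal (1 / A\<^sup>2) * ennreal (A\<^sup>2 * (LBINT a:{0..2*pi}. rate a)) = ennreal (LBINT a:{0..2*pi}. rate a)"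
    using A by (simp add: ennreal_mult'[symmetric])
  ultimately have "(\<lambda>n. ennreal (E (n + 4) * e n)) \<longlonglongrightarrow> ennreal (LBINT a:{0..2*pi}. rate a)" by simp
  moreover have "0 \<le> (LBINT a:{0..2*pi}. rate a)"
    unfolding set_lebesgue_integral_def by (intro Bochner_Integration.integral_nonneg) (simp add: rate_nonneg)
  ultimately have "(\<lambda>n. E (n + 4) * e n) \<longlonglongrightarrow> (LBINT a:{0..2*pi}. rate a)"
    using Enn e0 by (subst (asm) tendsto_ennreal_iff) (auto simp: less_imp_le)
  then have "(\<lambda>n. E (n + 4) * real (n + 4) powr (-1/3)) \<longlonglongrightarrow> (LBINT a:{0..2*pi}. rate a)"
    unfolding e_def .
  then show ?thesis unfolding E_def by (rule LIMSEQ_offset)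
qed

end

text \<open>Curvatures are reciprocals of the radii, so the hypotheses on them yield the gap needed
  for \<open>oval_pair\<close>, with \<open>R\<close> the reciprocal of the infimum for
  \<open>K\<close>. In these terms the integrand is \<open>kap t powr (1 / 3) * q t\<close>.\<close>

theorem theorem1p1:
  fixes K L :: "(real^2) set"
    and M :: "nat \<Rightarrow> 'w measure"
    and X :: "nat \<Rightarrow> nat \<Rightarrow> 'w \<Rightarrow> real^2"
  assumes "convex_disc K" and "convex_disc L"
    and "C2_plus_boundary K" and "C2_plus_boundary L"
    and "L_convex L K"
    and "(SUP x\<in>frontier L. boundary_curvature L x) < 1"
    and "1 < (INF y\<in>frontier K. boundary_curvature K y)"
    and "\<And>n. prob_space (M n)"
    and "\<And>n. prob_space.indep_vars (M n) (\<lambda>_. borel) (X n) {1..n}"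
    and "\<And>n i. i \<in> {1..n} \<Longrightarrow> distr (M n) borel (X n i) = uniform_measure lborel K"
  shows "(\<lambda>n. (\<integral>\<omega>. real (f0 L ((\<lambda>i. X n i \<omega>) ` {1..n})) \<partial>M n) * real n powr (-1/3))
    \<longlonglongrightarrow> root 3 (2 / (3 * measure lborel K)) * Gamma (5/3) *
      circle_integral (\<lambda>u. (curvature_at_normal K u - curvature_at_normal L u) powr (1/3)
                            / curvature_at_normal K u)"
proof -
  obtain l r where l: "oval L l r" and cl: "\<And>\<theta>. boundary_curvature L (l \<theta>) = 1 / r \<theta>"
    using normal_parametrization[OF assms(2,4)] by blast
  obtain k q where k: "oval K k q" and ck: "\<And>\<theta>. boundary_curvature K (k \<theta>) = 1 / q \<theta>"
    using normal_parametrization[OF assms(1,3)] by blast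
  interpret L: oval L l r by (rule l)
  interpret K: oval K k q by (rule k)
  define s where "s = (INF y\<in>frontier K. boundary_curvature K y)"
  have s: "1 < s" using assms(7) by (simp add: s_def)
  have r1: "1 \<le> r \<theta>" for \<theta>
  proof -
    obtain c where c: "0 < c" "\<And>\<theta>. c \<le> r \<theta>" by (rule L.r_lower) blast
    \<comment> \<open>A supremum of reals bounds its set only if the set is bounded; here the
      positive lower bound on the radii provides this.\<close>
    have "bdd_above (boundary_curvature L ` frontier L)"
    proof (rule bdd_aboveI2)
      fix x assume "x \<in> frontier L"
      then obtain \<theta> where "x = l \<theta>" using L.frontier_eq by blast
      then show "boundary_curvature L x \<le> 1 / c" using c(1) c(2)[of \<theta>] cl by (simp add: frac_le)
    qed
    moreover have "l \<theta> \<in> frontier L" using L.frontier_eq by simp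
    ultimately have "boundary_curvature L (l \<theta>) \<le> (SUP x\<in>frontier L. boundary_curvature L x)" by (rule cSUP_upper[rotated])
    then have "1 / r \<theta> < 1" using assms(6) cl by simp
    then show ?thesis using L.r_pos[of \<theta>] by (simp add: pos_divide_less_eq)
  qed
  have q1: "q \<theta> \<le> 1 / s" for \<theta>
  proof -
    have "bdd_below (boundary_curvature K ` frontier K)"
    proof (rule bdd_belowI2)
      fix y assume "y \<in> frontier K"
      then obtain \<theta> where "y = k \<theta>" using K.frontier_eq by blast
      then show "0 \<le> boundary_curvature K y" using K.r_pos[of \<theta>] ck by simp
    qed
    moreover have "k \<theta> \<in> frontier K" using K.frontier_eq by simp
    ultimately have "s \<le> boundary_curvature K (k \<theta>)" unfolding s_def by (rule cINF_lower)
    then have "s * q \<theta> \<le> 1" using K.r_pos[of \<theta>] ck by (simp add: pos_le_divide_eq)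
    then show ?thesis using s by (simp add: pos_le_divide_eq mult.commute)
  qed
  have Kpos: "0 < measure lborel K"
  proof -
    obtain x e where e: "0 < e" "ball x e \<subseteq> K"
      using assms(1) by (auto simp: convex_disc_def mem_interior)
    have "0 < measure lborel (ball x e)" using e by (simp add: content_ball_pos)
    also have "\<dots> \<le> measure lborel K"
    proof (rule measure_mono_fmeasurable[OF e(2)])
      show "K \<in> fmeasurable lborel" using K.compact_M by (rule fmeasurable_compact)
    qed simp
    finally show ?thesis .
  qed
  interpret oval_pair L l r K k q "1 / s"
    by unfold_locales (use K.compact_M Kpos r1 q1 s in auto)
  have "(\<lambda>n. (\<integral>\<omega>. real (f0 L ((\<lambda>i. X n i \<omega>) ` {1..n})) \<partial>M n) * real n powr (-1/3)) \<longlonglongrightarrow> (LBINT a:{0..2*pi}. rate a)"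
    by (rule expectation_limit) (use assms(8-10) in auto)
  moreover have "(LBINT a:{0..2*pi}. rate a) = root 3 (2 / (3 * measure lborel K)) * Gamma (5/3) *
      circle_integral (\<lambda>u. (curvature_at_normal K u - curvature_at_normal L u) powr (1/3) / curvature_at_normal K u)"
  proof -
    have "curvature_at_normal K (vector [cos t, sin t]) = 1 / q t" "curvature_at_normal L (vector [cos t, sin t]) = 1 / r t" for t
      using K.curvature_at_normal_eq[OF ck] L.curvature_at_normal_eq[OF cl] by (simp_all add: U_def)
    then have "circle_integral (\<lambda>u. (curvature_at_normal K u - curvature_at_normal L u) powr (1/3) / curvature_at_normal K u)
      = (LBINT t:{0..2*pi}. kap t powr (1 / 3) * q t)"
      by (simp add: circle_integral_def kap_def)
    then show ?thesis unfolding rate_def by (simp add: set_integral_mult_right)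
  qed
  ultimately show ?thesis by simp
qed

end
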